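(* Let $(R,\mathfrak{m})$ be a commutative Noetherian local ring with $\mathfrak{m}$-adic completion $\widehat{R}$ and total quotient ring $K$, and let $E = E(R/\mathfrak{m})$ be the injective hull of the residue field. Then $E$ is simple divisible as an $R$-module if and only if the ring $\widehat{R} \otimes_R K$ is a field.
   Context: An $R$-module $N$ is divisible if $rN = N$ for every non-zero-divisor $r \in R$. $N$ is called simple divisible if $N$ is divisible, $N \neq 0$, and every submodule $0 \neq V \subsetneq N$ is not divisible. *)

theory Defs
  imports "HOL-Algebra.Ring_Divisibility" "HOL-Algebra.Ideal_Product" "HOL-Algebra.Module"
    "HOL-Algebra.Free_Abelian_Groups" "HOL-Algebra.Generated_Groups"
begin

section \<open>Modules\<close>

definition module_hom ::
    "('a, 'r) ring_scheme \<Rightarrow> ('a, 'b, 'm) module_scheme \<Rightarrow> ('a, 'c, 'n) module_scheme \<Rightarrow> ('b \<Rightarrow> 'c) set"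
  where "module_hom R M N = {h \<in> carrier M \<rightarrow> carrier N.
    (\<forall>x\<in>carrier M. \<forall>y\<in>carrier M. h (x \<oplus>\<^bsub>M\<^esub> y) = h x \<oplus>\<^bsub>N\<^esub> h y) \<and>
    (\<forall>r\<in>carrier R. \<forall>x\<in>carrier M. h (r \<odot>\<^bsub>M\<^esub> x) = r \<odot>\<^bsub>N\<^esub> h x)}"

definition nonzerodivisors :: "('a, 'r) ring_scheme \<Rightarrow> 'a set"
  where "nonzerodivisors R =
    {r \<in> carrier R. \<forall>s\<in>carrier R. r \<otimes>\<^bsub>R\<^esub> s = \<zero>\<^bsub>R\<^esub> \<longrightarrow> s = \<zero>\<^bsub>R\<^esub>}"

definition divisible :: "('a, 'r) ring_scheme \<Rightarrow> ('a, 'b, 'm) module_scheme \<Rightarrow> bool"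
  where "divisible R N \<longleftrightarrow>
    (\<forall>r\<in>nonzerodivisors R. (\<lambda>x. r \<odot>\<^bsub>N\<^esub> x) ` carrier N = carrier N)"

definition simple_divisible :: "('a, 'r) ring_scheme \<Rightarrow> ('a, 'b, 'm) module_scheme \<Rightarrow> bool"
  where "simple_divisible R N \<longleftrightarrow>
    divisible R N \<and> carrier N \<noteq> {\<zero>\<^bsub>N\<^esub>} \<and>
    (\<forall>V. submodule V R N \<and> V \<noteq> {\<zero>\<^bsub>N\<^esub>} \<and> V \<noteq> carrier N
         \<longrightarrow> \<not> divisible R (N\<lparr>carrier := V\<rparr>))"

text \<open>
  HOL cannot quantify over all types inside a definition, so the test modules are those whose
  elements live in the type of ring elements.  This is no restriction: by Baer's criterion it
  implies the extension property for modules over every type, see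
  \<open>injective_module_extend\<close> below.
\<close>

definition injective_module :: "('a, 'r) ring_scheme \<Rightarrow> ('a, 'e, 'm) module_scheme \<Rightarrow> bool"
  where "injective_module R E \<longleftrightarrow> module R E \<and>
    (\<forall>(M :: ('a, 'a) module) (N :: ('a, 'a) module) f g.
       module R M \<and> module R N \<and> f \<in> module_hom R M N \<and> inj_on f (carrier M) \<and>
       g \<in> module_hom R M E
       \<longrightarrow> (\<exists>h\<in>module_hom R N E. \<forall>x\<in>carrier M. h (f x) = g x))"

definition injective_hull ::
    "('a, 'r) ring_scheme \<Rightarrow> ('a, 'b, 'm) module_scheme \<Rightarrow> ('a, 'e, 'n) module_scheme
      \<Rightarrow> ('b \<Rightarrow> 'e) \<Rightarrow> bool"
  where "injective_hull R M E \<iota> \<longleftrightarrow>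
    module R M \<and> injective_module R E \<and> \<iota> \<in> module_hom R M E \<and> inj_on \<iota> (carrier M) \<and>
    (\<forall>V. submodule V R E \<and> V \<noteq> {\<zero>\<^bsub>E\<^esub>} \<longrightarrow> V \<inter> \<iota> ` carrier M \<noteq> {\<zero>\<^bsub>E\<^esub>})"

definition quotient_module :: "('a, 'r) ring_scheme \<Rightarrow> 'a set \<Rightarrow> ('a, 'a set) module"
  where "quotient_module R I =
    ring.extend (R Quot I)
      (module.fields (\<lambda>r x. (I +>\<^bsub>R\<^esub> r) \<otimes>\<^bsub>R Quot I\<^esub> x))"


section \<open>Local rings, completion and total quotient ring\<close>

definition local_ring :: "('a, 'r) ring_scheme \<Rightarrow> 'a set \<Rightarrow> bool"
  where "local_ring R \<mm> \<longleftrightarrow>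
    cring R \<and> maximalideal \<mm> R \<and> (\<forall>M. maximalideal M R \<longrightarrow> M = \<mm>)"

abbreviation ideal_pow :: "('a, 'r) ring_scheme \<Rightarrow> 'a set \<Rightarrow> nat \<Rightarrow> 'a set"
  where "ideal_pow R I n \<equiv> I [^]\<^bsub>ideals_set R\<^esub> n"

text \<open>
  The inverse limit of the rings \<open>R/I\<^sup>n\<close>.  The transition map from \<open>R/I\<^sup>j\<close> to \<open>R/I\<^sup>i\<close>
  sends a coset to the unique coset of \<open>I\<^sup>i\<close> containing it, whence the inclusion.
\<close>

definition completion :: "('a, 'r) ring_scheme \<Rightarrow> 'a set \<Rightarrow> (nat \<Rightarrow> 'a set) ring"
  where "completion R I =
    \<lparr>carrier = {x. (\<forall>n. x n \<in> carrier (R Quot ideal_pow R I n)) \<and> (\<forall>i j. i \<le> j \<longrightarrow> x j \<subseteq> x i)},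
     monoid.mult = (\<lambda>x y n. x n \<otimes>\<^bsub>R Quot ideal_pow R I n\<^esub> y n),
     monoid.one = (\<lambda>n. \<one>\<^bsub>R Quot ideal_pow R I n\<^esub>),
     ring.zero = (\<lambda>n. \<zero>\<^bsub>R Quot ideal_pow R I n\<^esub>),
     ring.add = (\<lambda>x y n. x n \<oplus>\<^bsub>R Quot ideal_pow R I n\<^esub> y n)\<rparr>"

definition to_completion :: "('a, 'r) ring_scheme \<Rightarrow> 'a set \<Rightarrow> 'a \<Rightarrow> nat \<Rightarrow> 'a set"
  where "to_completion R I r = (\<lambda>n. ideal_pow R I n +>\<^bsub>R\<^esub> r)"

definition fraction :: "('a, 'r) ring_scheme \<Rightarrow> 'a \<Rightarrow> 'a \<Rightarrow> ('a \<times> 'a) set"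
  where "fraction R a s =
    {(b, t). b \<in> carrier R \<and> t \<in> nonzerodivisors R \<and> a \<otimes>\<^bsub>R\<^esub> t = b \<otimes>\<^bsub>R\<^esub> s}"

text \<open>
  As for cosets, an operation on classes is the union over all representatives;
  \<open>fraction_mult\<close> and \<open>fraction_add\<close> below confirm independence of the choice.
\<close>

definition total_quotient_ring :: "('a, 'r) ring_scheme \<Rightarrow> ('a \<times> 'a) set ring"
  where "total_quotient_ring R =
    \<lparr>carrier = {fraction R a s |a s. a \<in> carrier R \<and> s \<in> nonzerodivisors R},
     monoid.mult = (\<lambda>x y. \<Union>(a, s)\<in>x. \<Union>(b, t)\<in>y. fraction R (a \<otimes>\<^bsub>R\<^esub> b) (s \<otimes>\<^bsub>R\<^esub> t)),
     monoid.one = fraction R \<one>\<^bsub>R\<^esub> \<one>\<^bsub>R\<^esub>,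
     ring.zero = fraction R \<zero>\<^bsub>R\<^esub> \<one>\<^bsub>R\<^esub>,
     ring.add = (\<lambda>x y. \<Union>(a, s)\<in>x. \<Union>(b, t)\<in>y.
              fraction R (a \<otimes>\<^bsub>R\<^esub> t \<oplus>\<^bsub>R\<^esub> b \<otimes>\<^bsub>R\<^esub> s) (s \<otimes>\<^bsub>R\<^esub> t))\<rparr>"

definition to_total_quotient_ring :: "('a, 'r) ring_scheme \<Rightarrow> 'a \<Rightarrow> ('a \<times> 'a) set"
  where "to_total_quotient_ring R r = fraction R r \<one>\<^bsub>R\<^esub>"


section \<open>Tensor product of algebras\<close>

text \<open>
  The free abelian group on \<open>A \<times> B\<close>, with the product extending
  \<open>(a, b) (a', b') = (a a', b b')\<close> biadditively.
\<close>

definition pair_ring ::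
    "('b, 'm) ring_scheme \<Rightarrow> ('c, 'n) ring_scheme \<Rightarrow> ('b \<times> 'c \<Rightarrow>\<^sub>0 int) ring"
  where "pair_ring A B =
    \<lparr>carrier = carrier (free_Abelian_group (carrier A \<times> carrier B)),
     monoid.mult = (\<lambda>x y. frag_extend (\<lambda>(a, b).
              frag_extend (\<lambda>(a', b'). frag_of (a \<otimes>\<^bsub>A\<^esub> a', b \<otimes>\<^bsub>B\<^esub> b')) y) x),
     monoid.one = frag_of (\<one>\<^bsub>A\<^esub>, \<one>\<^bsub>B\<^esub>),
     ring.zero = 0,
     ring.add = (+)\<rparr>"

definition tensor_relators ::
    "('a, 'r) ring_scheme \<Rightarrow> ('b, 'm) ring_scheme \<Rightarrow> ('a \<Rightarrow> 'b) \<Rightarrow>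
     ('c, 'n) ring_scheme \<Rightarrow> ('a \<Rightarrow> 'c) \<Rightarrow> ('b \<times> 'c \<Rightarrow>\<^sub>0 int) set"
  where "tensor_relators R A f B g =
     {frag_of (a \<oplus>\<^bsub>A\<^esub> a', b) - frag_of (a, b) - frag_of (a', b) |a a' b.
        a \<in> carrier A \<and> a' \<in> carrier A \<and> b \<in> carrier B} \<union>
     {frag_of (a, b \<oplus>\<^bsub>B\<^esub> b') - frag_of (a, b) - frag_of (a, b') |a b b'.
        a \<in> carrier A \<and> b \<in> carrier B \<and> b' \<in> carrier B} \<union>
     {frag_of (f r \<otimes>\<^bsub>A\<^esub> a, b) - frag_of (a, g r \<otimes>\<^bsub>B\<^esub> b) |r a b.
        r \<in> carrier R \<and> a \<in> carrier A \<and> b \<in> carrier B}"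

text \<open>
  Only the additive subgroup spanned by the relators is divided out, so the additive group
  is literally that of the tensor product of modules; \<open>tensor_ideal\<close> below shows that
  this subgroup is an ideal of the ring above.
\<close>

definition tensor_product ::
    "('a, 'r) ring_scheme \<Rightarrow> ('b, 'm) ring_scheme \<Rightarrow> ('a \<Rightarrow> 'b) \<Rightarrow>
     ('c, 'n) ring_scheme \<Rightarrow> ('a \<Rightarrow> 'c) \<Rightarrow> ('b \<times> 'c \<Rightarrow>\<^sub>0 int) set ring"
  where "tensor_product R A f B g = pair_ring A B Quot
    generate (free_Abelian_group (carrier A \<times> carrier B)) (tensor_relators R A f B g)"


section \<open>Well-definedness\<close>

lemma module_homD:
  assumes "h \<in> module_hom R M N"
  shows "x \<in> carrier M \<Longrightarrow> h x \<in> carrier N"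
    and "x \<in> carrier M \<Longrightarrow> y \<in> carrier M \<Longrightarrow> h (x \<oplus>\<^bsub>M\<^esub> y) = h x \<oplus>\<^bsub>N\<^esub> h y"
    and "r \<in> carrier R \<Longrightarrow> x \<in> carrier M \<Longrightarrow> h (r \<odot>\<^bsub>M\<^esub> x) = r \<odot>\<^bsub>N\<^esub> h x"
  using assms unfolding module_hom_def by auto

text \<open>Extension to larger modules by Zorn's lemma on graphs of partial homomorphisms.\<close>

lemma injective_module_extend:
  fixes R :: "('a, 'r) ring_scheme" and E :: "('a, 'e, 'x) module_scheme"
    and M :: "('a, 'b, 'm) module_scheme" and N :: "('a, 'c, 'n) module_scheme"
  assumes E: "injective_module R E" and M: "module R M" and N: "module R N"
    and f: "f \<in> module_hom R M N" "inj_on f (carrier M)" and g: "g \<in> module_hom R M E"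
  shows "\<exists>h\<in>module_hom R N E. \<forall>x\<in>carrier M. h (f x) = g x"
proof -
  interpret E: module R E using E by (simp add: injective_module_def)
  interpret M: module R M by fact
  interpret N: module R N by fact
  define lin where "lin G \<longleftrightarrow> G \<subseteq> carrier N \<times> carrier E \<and>
      (\<forall>x y x' y'. (x, y) \<in> G \<longrightarrow> (x', y') \<in> G \<longrightarrow> (x \<oplus>\<^bsub>N\<^esub> x', y \<oplus>\<^bsub>E\<^esub> y') \<in> G) \<and>
      (\<forall>r\<in>carrier R. \<forall>x y. (x, y) \<in> G \<longrightarrow> (r \<odot>\<^bsub>N\<^esub> x, r \<odot>\<^bsub>E\<^esub> y) \<in> G) \<and>
      (\<forall>y. (\<zero>\<^bsub>N\<^esub>, y) \<in> G \<longrightarrow> y = \<zero>\<^bsub>E\<^esub>) \<and> (\<lambda>x. (f x, g x)) ` carrier M \<subseteq> G" for G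
  have lin1: "G \<subseteq> carrier N \<times> carrier E"
    and lin2: "\<And>x y x' y'. (x, y) \<in> G \<Longrightarrow> (x', y') \<in> G \<Longrightarrow> (x \<oplus>\<^bsub>N\<^esub> x', y \<oplus>\<^bsub>E\<^esub> y') \<in> G"
    and lin3: "\<And>r x y. (x, y) \<in> G \<Longrightarrow> r \<in> carrier R \<Longrightarrow> (r \<odot>\<^bsub>N\<^esub> x, r \<odot>\<^bsub>E\<^esub> y) \<in> G"
    and lin4: "\<And>y. (\<zero>\<^bsub>N\<^esub>, y) \<in> G \<Longrightarrow> y = \<zero>\<^bsub>E\<^esub>"
    and lin5: "\<And>x. x \<in> carrier M \<Longrightarrow> (f x, g x) \<in> G" if "lin G" for G
    using that unfolding lin_def by simp_all (simp add: image_subset_iff)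
  have f0: "f \<zero>\<^bsub>M\<^esub> = \<zero>\<^bsub>N\<^esub>" and g0: "g \<zero>\<^bsub>M\<^esub> = \<zero>\<^bsub>E\<^esub>"
    using module_homD(3)[OF f(1) E.R.zero_closed M.zero_closed] module_homD(3)[OF g E.R.zero_closed M.zero_closed]
      module_homD(1)[OF f(1) M.zero_closed] module_homD(1)[OF g M.zero_closed] by simp_all
  have "lin ((\<lambda>x. (f x, g x)) ` carrier M)"
    unfolding lin_def
  proof (intro conjI allI impI ballI subset_refl)
    show "(\<lambda>x. (f x, g x)) ` carrier M \<subseteq> carrier N \<times> carrier E"
      using module_homD(1)[OF f(1)] module_homD(1)[OF g] by auto
    show "(x \<oplus>\<^bsub>N\<^esub> x', y \<oplus>\<^bsub>E\<^esub> y') \<in> (\<lambda>x. (f x, g x)) ` carrier M"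
      if "(x, y) \<in> (\<lambda>x. (f x, g x)) ` carrier M" "(x', y') \<in> (\<lambda>x. (f x, g x)) ` carrier M" for x y x' y'
    proof -
      from that obtain u v where "u \<in> carrier M" "v \<in> carrier M" "x = f u" "y = g u" "x' = f v" "y' = g v"
        by auto
      thus ?thesis using module_homD(2)[OF f(1)] module_homD(2)[OF g]
        by (intro image_eqI[of _ _ "u \<oplus>\<^bsub>M\<^esub> v"]) auto
    qed
    show "(r \<odot>\<^bsub>N\<^esub> x, r \<odot>\<^bsub>E\<^esub> y) \<in> (\<lambda>x. (f x, g x)) ` carrier M"
      if "r \<in> carrier R" "(x, y) \<in> (\<lambda>x. (f x, g x)) ` carrier M" for r x y
    proof -
      from that obtain u where "u \<in> carrier M" "x = f u" "y = g u" by auto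
      thus ?thesis using that(1) module_homD(3)[OF f(1)] module_homD(3)[OF g]
        by (intro image_eqI[of _ _ "r \<odot>\<^bsub>M\<^esub> u"]) auto
    qed
    show "y = \<zero>\<^bsub>E\<^esub>" if "(\<zero>\<^bsub>N\<^esub>, y) \<in> (\<lambda>x. (f x, g x)) ` carrier M" for y
    proof -
      from that obtain u where u: "u \<in> carrier M" "f u = \<zero>\<^bsub>N\<^esub>" "y = g u" by auto
      hence "u = \<zero>\<^bsub>M\<^esub>" using inj_onD[OF f(2) _ u(1) M.zero_closed] f0 by metis
      thus ?thesis using u(3) g0 by metis
    qed
  qed
  hence "Collect lin \<noteq> {}" by blast
  moreover have "\<Union>C \<in> Collect lin" if "C \<noteq> {}" "subset.chain (Collect lin) C" for C
  proof -
    have C: "lin G" if "G \<in> C" for G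
      using that(1) \<open>subset.chain (Collect lin) C\<close> unfolding subset_chain_def by blast
    have tot: "G \<subseteq> H \<or> H \<subseteq> G" if "G \<in> C" "H \<in> C" for G H
      using that \<open>subset.chain (Collect lin) C\<close> unfolding subset_chain_def by blast
    have "\<Union>C \<subseteq> carrier N \<times> carrier E" using C lin1 by blast
    moreover have "(x \<oplus>\<^bsub>N\<^esub> x', y \<oplus>\<^bsub>E\<^esub> y') \<in> \<Union>C" if xy: "(x, y) \<in> \<Union>C" "(x', y') \<in> \<Union>C" for x y x' y'
    proof -
      from xy obtain G H where GH: "G \<in> C" "H \<in> C" "(x, y) \<in> G" "(x', y') \<in> H" by blast
      then obtain K where "K \<in> C" "(x, y) \<in> K" "(x', y') \<in> K" using tot[OF GH(1,2)] by blast
      thus ?thesis using lin2[OF C[of K]] by blast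
    qed
    moreover have "(r \<odot>\<^bsub>N\<^esub> x, r \<odot>\<^bsub>E\<^esub> y) \<in> \<Union>C" if r: "r \<in> carrier R" and xy: "(x, y) \<in> \<Union>C" for r x y
      using xy lin3[OF C _ r] by blast
    moreover have "y = \<zero>\<^bsub>E\<^esub>" if "(\<zero>\<^bsub>N\<^esub>, y) \<in> \<Union>C" for y
      using that lin4[OF C] by blast
    moreover have "(\<lambda>x. (f x, g x)) ` carrier M \<subseteq> \<Union>C"
      using \<open>C \<noteq> {}\<close> lin5[OF C] by blast
    ultimately have "lin (\<Union>C)" unfolding lin_def by (intro conjI allI impI ballI)
    thus ?thesis by simp
  qed
  ultimately obtain G where G: "lin G" and maxi: "\<And>G'. lin G' \<Longrightarrow> G \<subseteq> G' \<Longrightarrow> G' = G"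
    using subset_Zorn_nonempty[of "Collect lin"] by (metis mem_Collect_eq)
  have Gcl: "\<And>x y. (x, y) \<in> G \<Longrightarrow> x \<in> carrier N \<and> y \<in> carrier E"
    and Gadd: "\<And>x y x' y'. (x, y) \<in> G \<Longrightarrow> (x', y') \<in> G \<Longrightarrow> (x \<oplus>\<^bsub>N\<^esub> x', y \<oplus>\<^bsub>E\<^esub> y') \<in> G"
    and Gsm: "\<And>r x y. r \<in> carrier R \<Longrightarrow> (x, y) \<in> G \<Longrightarrow> (r \<odot>\<^bsub>N\<^esub> x, r \<odot>\<^bsub>E\<^esub> y) \<in> G"
    and G0: "\<And>y. (\<zero>\<^bsub>N\<^esub>, y) \<in> G \<Longrightarrow> y = \<zero>\<^bsub>E\<^esub>"
    and GM: "\<And>x. x \<in> carrier M \<Longrightarrow> (f x, g x) \<in> G"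
    using lin1[OF G] lin2[OF G] lin3[OF G] lin4[OF G] lin5[OF G] by blast+
  have Gneg: "(\<ominus>\<^bsub>N\<^esub> x, \<ominus>\<^bsub>E\<^esub> y) \<in> G" if "(x, y) \<in> G" for x y
    using Gsm[OF E.R.a_inv_closed[OF E.R.one_closed] that] Gcl[OF that]
      N.smult_l_minus[OF E.R.one_closed, of x] E.smult_l_minus[OF E.R.one_closed, of y] by simp
  have Guniq: "y = y'" if "(x, y) \<in> G" "(x, y') \<in> G" for x y y'
  proof -
    have "(x \<oplus>\<^bsub>N\<^esub> \<ominus>\<^bsub>N\<^esub> x, y \<oplus>\<^bsub>E\<^esub> \<ominus>\<^bsub>E\<^esub> y') \<in> G" using Gadd Gneg that by blast
    hence "y \<oplus>\<^bsub>E\<^esub> \<ominus>\<^bsub>E\<^esub> y' = \<zero>\<^bsub>E\<^esub>" using G0 Gcl[OF that(1)] by (simp add: N.r_neg)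
    thus ?thesis using Gcl[OF that(1)] Gcl[OF that(2)]
      E.M.minus_equality[of y "\<ominus>\<^bsub>E\<^esub> y'"] by simp
  qed
  have G00: "(\<zero>\<^bsub>N\<^esub>, \<zero>\<^bsub>E\<^esub>) \<in> G" using GM[of "\<zero>\<^bsub>M\<^esub>"] f0 g0 by simp
  have dom: "\<exists>y. (x, y) \<in> G" if x: "x \<in> carrier N" for x
  proof -
    define I where "I = {r \<in> carrier R. \<exists>y. (r \<odot>\<^bsub>N\<^esub> x, y) \<in> G}"
    define \<phi> where "\<phi> r = (THE y. (r \<odot>\<^bsub>N\<^esub> x, y) \<in> G)" for r
    have \<phi>: "\<phi> r = y" if "(r \<odot>\<^bsub>N\<^esub> x, y) \<in> G" for r y
      unfolding \<phi>_def using that Guniq by blast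
    define N' :: "('a, 'a) module" where "N' = \<lparr>carrier = carrier R, monoid.mult = monoid.mult R,
      monoid.one = \<one>\<^bsub>R\<^esub>, ring.zero = \<zero>\<^bsub>R\<^esub>, ring.add = ring.add R, smult = monoid.mult R\<rparr>"
    have N'_sel: "carrier N' = carrier R" "ring.add N' = ring.add R" "smult N' = monoid.mult R"
      "ring.zero N' = \<zero>\<^bsub>R\<^esub>"
      by (simp_all add: N'_def)
    have N': "module R N'"
    proof (intro moduleI abelian_groupI)
      show "\<exists>y\<in>carrier N'. y \<oplus>\<^bsub>N'\<^esub> u = \<zero>\<^bsub>N'\<^esub>" if "u \<in> carrier N'" for u
        using that E.R.l_neg by (auto simp: N'_sel)
    qed (auto simp: N'_sel E.R.l_distr E.R.r_distr E.R.m_assoc E.R.a_ac E.R.is_cring)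
    interpret N': module R N' by fact
    have sub: "submodule I R N'"
    proof (rule N'.module_incl_imp_submodule)
      show "I \<subseteq> carrier N'" by (auto simp: I_def N'_sel)
      have Iz: "\<zero>\<^bsub>R\<^esub> \<in> I" using G00 x by (auto simp: I_def)
      have Ia: "r \<oplus>\<^bsub>R\<^esub> s \<in> I" if "r \<in> I" "s \<in> I" for r s
        using that x Gadd[of "r \<odot>\<^bsub>N\<^esub> x" _ "s \<odot>\<^bsub>N\<^esub> x"] unfolding I_def by (force simp: N.smult_l_distr)
      have Is: "r \<otimes>\<^bsub>R\<^esub> s \<in> I" if "r \<in> carrier R" "s \<in> I" for r s
        using that x Gsm[OF that(1), of "s \<odot>\<^bsub>N\<^esub> x"] unfolding I_def by (force simp: N.smult_assoc1)
      have In: "\<ominus>\<^bsub>R\<^esub> s \<in> I" if "s \<in> I" for s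
        using that x Gneg[of "s \<odot>\<^bsub>N\<^esub> x"] unfolding I_def by (force simp: N.smult_l_minus)
      have IR: "r \<in> carrier R" if "r \<in> I" for r using that by (simp add: I_def)
      show "module R (N'\<lparr>carrier := I\<rparr>)"
      proof (intro moduleI abelian_groupI)
        show "\<exists>y\<in>carrier (N'\<lparr>carrier := I\<rparr>). y \<oplus>\<^bsub>N'\<lparr>carrier := I\<rparr>\<^esub> u = \<zero>\<^bsub>N'\<lparr>carrier := I\<rparr>\<^esub>"
          if "u \<in> carrier (N'\<lparr>carrier := I\<rparr>)" for u
          using that In IR E.R.l_neg by (auto simp: N'_sel)
      qed (auto simp: N'_sel Iz Ia Is IR E.R.l_distr E.R.r_distr E.R.m_assoc E.R.a_ac E.R.is_cring)
    qed
    have mI: "module R (N'\<lparr>carrier := I\<rparr>)" using sub N' by (rule submodule.submodule_is_module)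
    have i1: "id \<in> module_hom R (N'\<lparr>carrier := I\<rparr>) N'"
      by (auto simp: module_hom_def I_def N'_sel)
    have \<phi>1: "\<phi> \<in> module_hom R (N'\<lparr>carrier := I\<rparr>) E"
      unfolding module_hom_def
    proof (intro CollectI conjI ballI)
      show "\<phi> \<in> carrier (N'\<lparr>carrier := I\<rparr>) \<rightarrow> carrier E"
        using \<phi> Gcl by (auto simp: I_def)
      show "\<phi> (r \<oplus>\<^bsub>N'\<lparr>carrier := I\<rparr>\<^esub> s) = \<phi> r \<oplus>\<^bsub>E\<^esub> \<phi> s"
        if rs: "r \<in> carrier (N'\<lparr>carrier := I\<rparr>)" "s \<in> carrier (N'\<lparr>carrier := I\<rparr>)" for r s
      proof -
        from rs obtain y z where yz: "(r \<odot>\<^bsub>N\<^esub> x, y) \<in> G" "(s \<odot>\<^bsub>N\<^esub> x, z) \<in> G" "r \<in> carrier R" "s \<in> carrier R"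
          by (auto simp: I_def)
        have "((r \<oplus>\<^bsub>R\<^esub> s) \<odot>\<^bsub>N\<^esub> x, y \<oplus>\<^bsub>E\<^esub> z) \<in> G" using Gadd[OF yz(1,2)] yz x by (simp add: N.smult_l_distr)
        thus ?thesis using \<phi> yz by (simp add: N'_sel)
      qed
      show "\<phi> (r \<odot>\<^bsub>N'\<lparr>carrier := I\<rparr>\<^esub> s) = r \<odot>\<^bsub>E\<^esub> \<phi> s"
        if rs: "r \<in> carrier R" "s \<in> carrier (N'\<lparr>carrier := I\<rparr>)" for r s
      proof -
        from rs obtain z where yz: "(s \<odot>\<^bsub>N\<^esub> x, z) \<in> G" "s \<in> carrier R"
          by (auto simp: I_def)
        have "((r \<otimes>\<^bsub>R\<^esub> s) \<odot>\<^bsub>N\<^esub> x, r \<odot>\<^bsub>E\<^esub> z) \<in> G" using Gsm[OF rs(1) yz(1)] rs yz x by (simp add: N.smult_assoc1)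
        thus ?thesis using \<phi> yz by (simp add: N'_sel)
      qed
    qed
    have "\<exists>h\<in>module_hom R N' E. \<forall>r\<in>carrier (N'\<lparr>carrier := I\<rparr>). h (id r) = \<phi> r"
      using E mI N' i1 \<phi>1 inj_on_id unfolding injective_module_def by blast
    then obtain h where h: "h \<in> module_hom R N' E" "\<And>r. r \<in> I \<Longrightarrow> h r = \<phi> r" by auto
    define e where "e = h \<one>\<^bsub>R\<^esub>"
    have e: "e \<in> carrier E" unfolding e_def using module_homD(1)[OF h(1)] by (simp add: N'_sel)
    have he: "h r = r \<odot>\<^bsub>E\<^esub> e" if "r \<in> carrier R" for r
      using module_homD(3)[OF h(1) that, of "\<one>\<^bsub>R\<^esub>"] that by (simp add: N'_sel e_def)
    define G' where "G' = {(d \<oplus>\<^bsub>N\<^esub> r \<odot>\<^bsub>N\<^esub> x, y \<oplus>\<^bsub>E\<^esub> r \<odot>\<^bsub>E\<^esub> e) |d y r. (d, y) \<in> G \<and> r \<in> carrier R}"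
    have G'I: "(d \<oplus>\<^bsub>N\<^esub> r \<odot>\<^bsub>N\<^esub> x, y \<oplus>\<^bsub>E\<^esub> r \<odot>\<^bsub>E\<^esub> e) \<in> G'" if "(d, y) \<in> G" "r \<in> carrier R" for d y r
      using that unfolding G'_def by blast
    have GG': "G \<subseteq> G'"
    proof
      fix p assume "p \<in> G"
      then obtain d y where p: "p = (d, y)" "(d, y) \<in> G" by (cases p) auto
      show "p \<in> G'" using G'I[OF p(2) E.R.zero_closed] Gcl[OF p(2)] x e p(1) by simp
    qed
    have "lin G'"
      unfolding lin_def
    proof (intro conjI allI impI ballI)
      show "G' \<subseteq> carrier N \<times> carrier E" unfolding G'_def using Gcl x e by auto
      show "(\<lambda>x. (f x, g x)) ` carrier M \<subseteq> G'" using GG' GM by auto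
    next
      fix u v u' v' assume "(u, v) \<in> G'" "(u', v') \<in> G'"
      then obtain d y r d' y' r' where 1: "u = d \<oplus>\<^bsub>N\<^esub> r \<odot>\<^bsub>N\<^esub> x" "v = y \<oplus>\<^bsub>E\<^esub> r \<odot>\<^bsub>E\<^esub> e" "(d, y) \<in> G" "r \<in> carrier R"
        "u' = d' \<oplus>\<^bsub>N\<^esub> r' \<odot>\<^bsub>N\<^esub> x" "v' = y' \<oplus>\<^bsub>E\<^esub> r' \<odot>\<^bsub>E\<^esub> e" "(d', y') \<in> G" "r' \<in> carrier R"
        unfolding G'_def by blast
      have "u \<oplus>\<^bsub>N\<^esub> u' = (d \<oplus>\<^bsub>N\<^esub> d') \<oplus>\<^bsub>N\<^esub> (r \<oplus>\<^bsub>R\<^esub> r') \<odot>\<^bsub>N\<^esub> x"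
        using 1 Gcl[OF 1(3)] Gcl[OF 1(7)] x by (simp add: N.smult_l_distr N.M.a_ac)
      moreover have "v \<oplus>\<^bsub>E\<^esub> v' = (y \<oplus>\<^bsub>E\<^esub> y') \<oplus>\<^bsub>E\<^esub> (r \<oplus>\<^bsub>R\<^esub> r') \<odot>\<^bsub>E\<^esub> e"
        using 1 Gcl[OF 1(3)] Gcl[OF 1(7)] e by (simp add: E.smult_l_distr E.M.a_ac)
      ultimately show "(u \<oplus>\<^bsub>N\<^esub> u', v \<oplus>\<^bsub>E\<^esub> v') \<in> G'" using G'I[OF Gadd[OF 1(3,7)], of "r \<oplus>\<^bsub>R\<^esub> r'"] 1 by simp
    next
      fix s u v assume s: "s \<in> carrier R" and "(u, v) \<in> G'"
      then obtain d y r where 1: "u = d \<oplus>\<^bsub>N\<^esub> r \<odot>\<^bsub>N\<^esub> x" "v = y \<oplus>\<^bsub>E\<^esub> r \<odot>\<^bsub>E\<^esub> e" "(d, y) \<in> G" "r \<in> carrier R"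
        unfolding G'_def by blast
      show "(s \<odot>\<^bsub>N\<^esub> u, s \<odot>\<^bsub>E\<^esub> v) \<in> G'"
        using G'I[OF Gsm[OF s 1(3)], of "s \<otimes>\<^bsub>R\<^esub> r"] 1 s Gcl[OF 1(3)] x e
        by (simp add: N.smult_assoc1 E.smult_assoc1 N.smult_r_distr E.smult_r_distr)
    next
      fix v assume "(\<zero>\<^bsub>N\<^esub>, v) \<in> G'"
      then obtain d y r where 1: "\<zero>\<^bsub>N\<^esub> = d \<oplus>\<^bsub>N\<^esub> r \<odot>\<^bsub>N\<^esub> x" "v = y \<oplus>\<^bsub>E\<^esub> r \<odot>\<^bsub>E\<^esub> e" "(d, y) \<in> G" "r \<in> carrier R"
        unfolding G'_def by blast
      have "r \<odot>\<^bsub>N\<^esub> x \<oplus>\<^bsub>N\<^esub> d = \<zero>\<^bsub>N\<^esub>"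
        using 1(1) Gcl[OF 1(3)] x N.smult_closed[OF 1(4) x] N.M.a_comm by simp
      hence "r \<odot>\<^bsub>N\<^esub> x = \<ominus>\<^bsub>N\<^esub> d"
        using N.M.minus_equality[of "r \<odot>\<^bsub>N\<^esub> x" d] Gcl[OF 1(3)] N.smult_closed[OF 1(4) x] by simp
      hence m: "(r \<odot>\<^bsub>N\<^esub> x, \<ominus>\<^bsub>E\<^esub> y) \<in> G" using Gneg[OF 1(3)] by simp
      hence "r \<in> I" using 1(4) by (auto simp: I_def)
      hence "r \<odot>\<^bsub>E\<^esub> e = \<ominus>\<^bsub>E\<^esub> y" using he[OF 1(4)] h(2) \<phi>[OF m] by simp
      thus "v = \<zero>\<^bsub>E\<^esub>" using 1 Gcl[OF 1(3)] by (simp add: E.M.r_neg)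
    qed
    hence "G' = G" using maxi GG' by blast
    moreover have "(x, e) \<in> G'" using G'I[OF G00 E.R.one_closed] x e by simp
    ultimately show ?thesis by blast
  qed
  define h where "h x = (THE y. (x, y) \<in> G)" for x
  have h: "h x = y" if "(x, y) \<in> G" for x y unfolding h_def using that Guniq by blast
  have hG: "(x, h x) \<in> G" if "x \<in> carrier N" for x using dom[OF that] h by blast
  have "h \<in> module_hom R N E"
    unfolding module_hom_def
  proof (intro CollectI conjI ballI)
    show "h \<in> carrier N \<rightarrow> carrier E" using hG Gcl by blast
    show "h (x \<oplus>\<^bsub>N\<^esub> y) = h x \<oplus>\<^bsub>E\<^esub> h y" if "x \<in> carrier N" "y \<in> carrier N" for x y
      using h[OF Gadd[OF hG[OF that(1)] hG[OF that(2)]]] .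
    show "h (r \<odot>\<^bsub>N\<^esub> x) = r \<odot>\<^bsub>E\<^esub> h x" if "r \<in> carrier R" "x \<in> carrier N" for r x
      using h[OF Gsm[OF that(1) hG[OF that(2)]]] .
  qed
  moreover have "\<forall>x\<in>carrier M. h (f x) = g x" using h GM by blast
  ultimately show ?thesis by blast
qed

lemma quotient_module_sel:
  "carrier (quotient_module R I) = carrier (R Quot I)"
  "monoid.mult (quotient_module R I) = monoid.mult (R Quot I)"
  "monoid.one (quotient_module R I) = monoid.one (R Quot I)"
  "ring.zero (quotient_module R I) = ring.zero (R Quot I)"
  "ring.add (quotient_module R I) = ring.add (R Quot I)"
  "smult (quotient_module R I) r x = (I +>\<^bsub>R\<^esub> r) \<otimes>\<^bsub>R Quot I\<^esub> x"
  by (simp_all add: quotient_module_def ring.defs module.defs)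

lemma quotient_module:
  assumes "cring R" "ideal I R"
  shows "module R (quotient_module R I)"
proof -
  interpret R: cring R by fact
  interpret I: ideal I R by fact
  interpret Q: cring "R Quot I" using I.quotient_is_cring assms(1) .
  have hom: "(+>\<^bsub>R\<^esub>) I \<in> ring_hom R (R Quot I)" by (rule I.rcos_ring_hom)
  note hom_simps = ring_hom_closed[OF hom] ring_hom_mult[OF hom] ring_hom_add[OF hom] ring_hom_one[OF hom]
  show ?thesis
  proof (intro moduleI abelian_groupI)
    show "\<exists>y\<in>carrier (quotient_module R I). y \<oplus>\<^bsub>quotient_module R I\<^esub> x = \<zero>\<^bsub>quotient_module R I\<^esub>"
      if "x \<in> carrier (quotient_module R I)" for x
      using that Q.l_neg Q.a_inv_closed unfolding quotient_module_sel by blast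
  qed (simp_all add: quotient_module_sel hom_simps Q.l_distr Q.r_distr Q.m_assoc Q.a_ac R.is_cring)
qed

lemma ideal_pow_ideal:
  assumes "ring R" "ideal I R" shows "ideal (ideal_pow R I n) R"
proof (induction n)
  case 0
  show ?case using ring.oneideal[OF assms(1)] by (simp add: ideals_set_def)
next
  case (Suc n)
  show ?case using ring.ideal_prod_is_ideal[OF assms(1) Suc assms(2)] by (simp add: ideals_set_def)
qed

lemma ideal_pow_antimono:
  assumes "ring R" "ideal I R" "i \<le> j" shows "ideal_pow R I j \<subseteq> ideal_pow R I i"
  using assms(3)
proof (induction j rule: dec_induct)
  case (step n)
  have "ideal_pow R I (Suc n) \<subseteq> ideal_pow R I n"
    using ring.ideal_prod_inter[OF assms(1) ideal_pow_ideal[OF assms(1,2), of n] assms(2)]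
    by (simp add: ideals_set_def)
  thus ?case using step.IH by (rule order_trans)
qed simp

lemma completion_sel:
  "x \<in> carrier (completion R I) \<longleftrightarrow>
    (\<forall>n. x n \<in> carrier (R Quot ideal_pow R I n)) \<and> (\<forall>i j. i \<le> j \<longrightarrow> x j \<subseteq> x i)"
  "x \<otimes>\<^bsub>completion R I\<^esub> y = (\<lambda>n. x n \<otimes>\<^bsub>R Quot ideal_pow R I n\<^esub> y n)"
  "x \<oplus>\<^bsub>completion R I\<^esub> y = (\<lambda>n. x n \<oplus>\<^bsub>R Quot ideal_pow R I n\<^esub> y n)"
  "\<one>\<^bsub>completion R I\<^esub> = (\<lambda>n. \<one>\<^bsub>R Quot ideal_pow R I n\<^esub>)"
  "\<zero>\<^bsub>completion R I\<^esub> = (\<lambda>n. \<zero>\<^bsub>R Quot ideal_pow R I n\<^esub>)"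
  by (simp_all add: completion_def)

lemma completion_cring:
  assumes R: "cring R" and I: "ideal I R"
  shows "cring (completion R I)"
    and "to_completion R I \<in> ring_hom R (completion R I)"
proof -
  interpret R: cring R by fact
  define P where "P n = ideal_pow R I n" for n
  have P: "ideal (P n) R" for n unfolding P_def by (rule ideal_pow_ideal[OF R.ring_axioms I])
  have Pmono: "P j \<subseteq> P i" if "i \<le> j" for i j
    unfolding P_def by (rule ideal_pow_antimono[OF R.ring_axioms I that])
  have Q: "cring (R Quot P n)" for n by (rule ideal.quotient_is_cring[OF P R])
  have hom: "(+>\<^bsub>R\<^esub>) (P n) \<in> ring_hom R (R Quot P n)" for n by (rule ideal.rcos_ring_hom[OF P])
  note sel = completion_sel[where R = R and I = I, folded P_def]
  have cos_sub: "P j +>\<^bsub>R\<^esub> a \<subseteq> P i +>\<^bsub>R\<^esub> a" if "i \<le> j" for i j a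
    using Pmono[OF that] by (auto simp: a_r_coset_def r_coset_def)
  have rep: "\<exists>a\<in>carrier R. x j = P j +>\<^bsub>R\<^esub> a \<and> x i = P i +>\<^bsub>R\<^esub> a"
    if x: "x \<in> carrier (completion R I)" and ij: "i \<le> j" for x i j
  proof -
    from x have "x j \<in> carrier (R Quot P j)" "x i \<in> carrier (R Quot P i)" "x j \<subseteq> x i"
      using ij unfolding sel by auto
    then obtain a b where a: "a \<in> carrier R" "x j = P j +>\<^bsub>R\<^esub> a" and b: "b \<in> carrier R" "x i = P i +>\<^bsub>R\<^esub> b"
      unfolding FactRing_def A_RCOSETS_def' by auto
    interpret Pi: ideal "P i" R by (rule P)
    interpret Pj: ideal "P j" R by (rule P)
    have "a \<in> P i +>\<^bsub>R\<^esub> b" using Pj.a_rcos_self[OF a(1)] a(2) b(2) \<open>x j \<subseteq> x i\<close> by blast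
    hence "P i +>\<^bsub>R\<^esub> b = P i +>\<^bsub>R\<^esub> a" by (rule Pi.a_repr_independence'[OF _ b(1)])
    thus ?thesis using a b by blast
  qed
  have mk: "(\<lambda>n. P n +>\<^bsub>R\<^esub> a) \<in> carrier (completion R I)" if "a \<in> carrier R" for a
    unfolding sel using cos_sub ring_hom_closed[OF hom that] by auto
  have one: "\<one>\<^bsub>completion R I\<^esub> = (\<lambda>n. P n +>\<^bsub>R\<^esub> \<one>\<^bsub>R\<^esub>)"
    unfolding sel using ring_hom_one[OF hom] by simp
  have zero: "\<zero>\<^bsub>completion R I\<^esub> = (\<lambda>n. P n +>\<^bsub>R\<^esub> \<zero>\<^bsub>R\<^esub>)"
    unfolding sel using ring_hom_zero[OF hom R.ring_axioms cring.axioms(1)[OF Q]] by simp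
  have cmp: "x n \<in> carrier (R Quot P n)" if "x \<in> carrier (completion R I)" for x n
    using that unfolding sel by auto
  have mult: "x \<otimes>\<^bsub>completion R I\<^esub> y \<in> carrier (completion R I)"
    if x: "x \<in> carrier (completion R I)" and y: "y \<in> carrier (completion R I)" for x y
    unfolding sel
  proof (intro conjI allI impI)
    show "x n \<otimes>\<^bsub>R Quot P n\<^esub> y n \<in> carrier (R Quot P n)" for n
      using cring.cring_simprules(5)[OF Q cmp[OF x] cmp[OF y]] .
    show "x j \<otimes>\<^bsub>R Quot P j\<^esub> y j \<subseteq> x i \<otimes>\<^bsub>R Quot P i\<^esub> y i" if ij: "i \<le> j" for i j
    proof -
      obtain a b where "a \<in> carrier R" "b \<in> carrier R" "x j = P j +>\<^bsub>R\<^esub> a" "x i = P i +>\<^bsub>R\<^esub> a"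
        "y j = P j +>\<^bsub>R\<^esub> b" "y i = P i +>\<^bsub>R\<^esub> b" using rep[OF x ij] rep[OF y ij] by blast
      thus ?thesis using cos_sub[OF ij, of "a \<otimes>\<^bsub>R\<^esub> b"] ring_hom_mult[OF hom, of a b] by simp
    qed
  qed
  have add: "x \<oplus>\<^bsub>completion R I\<^esub> y \<in> carrier (completion R I)"
    if x: "x \<in> carrier (completion R I)" and y: "y \<in> carrier (completion R I)" for x y
    unfolding sel
  proof (intro conjI allI impI)
    show "x n \<oplus>\<^bsub>R Quot P n\<^esub> y n \<in> carrier (R Quot P n)" for n
      using cring.cring_simprules(1)[OF Q cmp[OF x] cmp[OF y]] .
    show "x j \<oplus>\<^bsub>R Quot P j\<^esub> y j \<subseteq> x i \<oplus>\<^bsub>R Quot P i\<^esub> y i" if ij: "i \<le> j" for i j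
    proof -
      obtain a b where "a \<in> carrier R" "b \<in> carrier R" "x j = P j +>\<^bsub>R\<^esub> a" "x i = P i +>\<^bsub>R\<^esub> a"
        "y j = P j +>\<^bsub>R\<^esub> b" "y i = P i +>\<^bsub>R\<^esub> b" using rep[OF x ij] rep[OF y ij] by blast
      thus ?thesis using cos_sub[OF ij, of "a \<oplus>\<^bsub>R\<^esub> b"] ring_hom_add[OF hom, of a b] by simp
    qed
  qed
  have neg: "\<exists>y\<in>carrier (completion R I). y \<oplus>\<^bsub>completion R I\<^esub> x = \<zero>\<^bsub>completion R I\<^esub>"
    if x: "x \<in> carrier (completion R I)" for x
  proof -
    have m: "(\<lambda>n. P n +>\<^bsub>R\<^esub> (\<ominus>\<^bsub>R\<^esub> \<one>\<^bsub>R\<^esub>)) \<otimes>\<^bsub>completion R I\<^esub> x \<in> carrier (completion R I)"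
      by (rule mult[OF mk x]) simp
    have e: "((P n +>\<^bsub>R\<^esub> (\<ominus>\<^bsub>R\<^esub> \<one>\<^bsub>R\<^esub>)) \<otimes>\<^bsub>R Quot P n\<^esub> x n) \<oplus>\<^bsub>R Quot P n\<^esub> x n = \<zero>\<^bsub>R Quot P n\<^esub>" for n
    proof -
      obtain a where a: "a \<in> carrier R" "x n = P n +>\<^bsub>R\<^esub> a" using rep[OF x order_refl] by blast
      have "((P n +>\<^bsub>R\<^esub> (\<ominus>\<^bsub>R\<^esub> \<one>\<^bsub>R\<^esub>)) \<otimes>\<^bsub>R Quot P n\<^esub> x n) \<oplus>\<^bsub>R Quot P n\<^esub> x n
          = P n +>\<^bsub>R\<^esub> (\<ominus>\<^bsub>R\<^esub> \<one>\<^bsub>R\<^esub> \<otimes>\<^bsub>R\<^esub> a \<oplus>\<^bsub>R\<^esub> a)"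
        using a ring_hom_mult[OF hom] ring_hom_add[OF hom] by simp
      also have "\<ominus>\<^bsub>R\<^esub> \<one>\<^bsub>R\<^esub> \<otimes>\<^bsub>R\<^esub> a \<oplus>\<^bsub>R\<^esub> a = \<zero>\<^bsub>R\<^esub>" using a by (simp add: R.l_minus R.l_neg)
      finally show ?thesis using ring_hom_zero[OF hom R.ring_axioms cring.axioms(1)[OF Q]] by simp
    qed
    show ?thesis by (rule bexI[OF _ m]) (simp only: sel(2,3,5) e)
  qed
  have one': "\<one>\<^bsub>completion R I\<^esub> \<in> carrier (completion R I)" unfolding one by (rule mk) simp
  have zero': "\<zero>\<^bsub>completion R I\<^esub> \<in> carrier (completion R I)" unfolding zero by (rule mk) simp
  show "cring (completion R I)"
  proof (intro cringI abelian_groupI comm_monoidI)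
    fix x y z
    assume x: "x \<in> carrier (completion R I)" and y: "y \<in> carrier (completion R I)"
      and z: "z \<in> carrier (completion R I)"
    note c = cmp[OF x] cmp[OF y] cmp[OF z]
    show "x \<oplus>\<^bsub>completion R I\<^esub> y \<oplus>\<^bsub>completion R I\<^esub> z = x \<oplus>\<^bsub>completion R I\<^esub> (y \<oplus>\<^bsub>completion R I\<^esub> z)"
      unfolding sel using cring.cring_simprules(7)[OF Q] c by simp
    show "x \<otimes>\<^bsub>completion R I\<^esub> y \<otimes>\<^bsub>completion R I\<^esub> z = x \<otimes>\<^bsub>completion R I\<^esub> (y \<otimes>\<^bsub>completion R I\<^esub> z)"
      unfolding sel using cring.cring_simprules(11)[OF Q] c by simp
    show "(x \<oplus>\<^bsub>completion R I\<^esub> y) \<otimes>\<^bsub>completion R I\<^esub> z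
        = x \<otimes>\<^bsub>completion R I\<^esub> z \<oplus>\<^bsub>completion R I\<^esub> y \<otimes>\<^bsub>completion R I\<^esub> z"
      unfolding sel using cring.cring_simprules(13)[OF Q] c by simp
  next
    fix x y
    assume x: "x \<in> carrier (completion R I)" and y: "y \<in> carrier (completion R I)"
    note c = cmp[OF x] cmp[OF y]
    show "x \<oplus>\<^bsub>completion R I\<^esub> y = y \<oplus>\<^bsub>completion R I\<^esub> x"
      unfolding sel using cring.cring_simprules(10)[OF Q] c by simp
    show "x \<otimes>\<^bsub>completion R I\<^esub> y = y \<otimes>\<^bsub>completion R I\<^esub> x"
      unfolding sel using cring.cring_simprules(14)[OF Q] c by simp
  next
    fix x assume x: "x \<in> carrier (completion R I)"
    show "\<zero>\<^bsub>completion R I\<^esub> \<oplus>\<^bsub>completion R I\<^esub> x = x"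
      unfolding sel using cring.cring_simprules(8)[OF Q cmp[OF x]] by simp
    show "\<one>\<^bsub>completion R I\<^esub> \<otimes>\<^bsub>completion R I\<^esub> x = x"
      unfolding sel using cring.cring_simprules(12)[OF Q cmp[OF x]] by simp
  qed (simp_all add: mult add neg one' zero')
  show "to_completion R I \<in> ring_hom R (completion R I)"
    using mk ring_hom_mult[OF hom] ring_hom_add[OF hom] one
    unfolding to_completion_def P_def[symmetric] by (intro ring_hom_memI) (simp_all add: sel)
qed

lemma UN_pair_const:
  assumes "(a\<^sub>0, s\<^sub>0) \<in> U" "(b\<^sub>0, t\<^sub>0) \<in> V"
    and "\<And>a s b t. (a, s) \<in> U \<Longrightarrow> (b, t) \<in> V \<Longrightarrow> H a s b t = F"
  shows "(\<Union>(a, s)\<in>U. \<Union>(b, t)\<in>V. H a s b t) = F"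
proof (rule subset_antisym)
  show "(\<Union>(a, s)\<in>U. \<Union>(b, t)\<in>V. H a s b t) \<subseteq> F" using assms(3) by blast
  show "F \<subseteq> (\<Union>(a, s)\<in>U. \<Union>(b, t)\<in>V. H a s b t)"
    unfolding assms(3)[OF assms(1,2), symmetric] using assms(1,2) by blast
qed

context cring
begin

lemma nonzerodivisors_carrier: "s \<in> nonzerodivisors R \<Longrightarrow> s \<in> carrier R"
  by (simp add: nonzerodivisors_def)

lemma nonzerodivisors_cancel:
  assumes "s \<in> nonzerodivisors R" "x \<in> carrier R" "y \<in> carrier R" "s \<otimes> x = s \<otimes> y"
  shows "x = y"
proof -
  have s: "s \<in> carrier R" using assms(1) by (rule nonzerodivisors_carrier)
  have "s \<otimes> (x \<ominus> y) = s \<otimes> x \<ominus> s \<otimes> y" using s assms(2,3) by algebra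
  also have "\<dots> = \<zero>" using s assms by simp
  finally have "x \<ominus> y = \<zero>" using assms unfolding nonzerodivisors_def by simp
  thus ?thesis using assms by simp
qed

lemma nonzerodivisors_one: "\<one> \<in> nonzerodivisors R"
  by (simp add: nonzerodivisors_def)

lemma nonzerodivisors_mult:
  assumes "s \<in> nonzerodivisors R" "t \<in> nonzerodivisors R"
  shows "s \<otimes> t \<in> nonzerodivisors R"
proof -
  have s: "s \<in> carrier R" "t \<in> carrier R" using assms[THEN nonzerodivisors_carrier] .
  have "x = \<zero>" if x: "x \<in> carrier R" "s \<otimes> t \<otimes> x = \<zero>" for x
  proof -
    have "s \<otimes> (t \<otimes> x) = s \<otimes> \<zero>" using s x by (simp add: m_assoc[symmetric])
    hence "t \<otimes> x = t \<otimes> \<zero>" using nonzerodivisors_cancel[OF assms(1)] s x by simp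
    thus ?thesis using nonzerodivisors_cancel[OF assms(2) x(1)] by simp
  qed
  thus ?thesis using s by (simp add: nonzerodivisors_def)
qed

lemma fraction_eq_iff:
  assumes a: "a \<in> carrier R" and b: "b \<in> carrier R"
    and s: "s \<in> nonzerodivisors R" and t: "t \<in> nonzerodivisors R"
  shows "fraction R a s = fraction R b t \<longleftrightarrow> a \<otimes> t = b \<otimes> s"
proof
  assume "fraction R a s = fraction R b t"
  moreover have "(b, t) \<in> fraction R b t" using b t by (simp add: fraction_def)
  ultimately have "(b, t) \<in> fraction R a s" by simp
  thus "a \<otimes> t = b \<otimes> s" by (simp add: fraction_def)
next
  have *: "b \<otimes> u = c \<otimes> t" if a: "a \<in> carrier R" and b: "b \<in> carrier R"
    and s: "s \<in> nonzerodivisors R" and t: "t \<in> nonzerodivisors R" and e: "a \<otimes> t = b \<otimes> s"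
    and c: "c \<in> carrier R" and u: "u \<in> nonzerodivisors R" and e': "a \<otimes> u = c \<otimes> s" for a b s t c u
  proof (rule nonzerodivisors_cancel[OF s])
    note cl = a b c nonzerodivisors_carrier[OF s] nonzerodivisors_carrier[OF t] nonzerodivisors_carrier[OF u]
    have "s \<otimes> (b \<otimes> u) = (b \<otimes> s) \<otimes> u" using cl by (simp add: m_ac)
    also have "\<dots> = (a \<otimes> u) \<otimes> t" using cl by (simp add: e[symmetric] m_ac)
    also have "\<dots> = s \<otimes> (c \<otimes> t)" using cl by (simp add: e' m_ac)
    finally show "s \<otimes> (b \<otimes> u) = s \<otimes> (c \<otimes> t)" .
    show "b \<otimes> u \<in> carrier R" "c \<otimes> t \<in> carrier R" using cl by simp_all
  qed
  assume e: "a \<otimes> t = b \<otimes> s"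
  have "p \<in> fraction R a s \<longleftrightarrow> p \<in> fraction R b t" for p
  proof (cases p)
    case (Pair c u)
    show ?thesis using *[OF a b s t e, of c u] *[OF b a t s e[symmetric], of c u]
      by (auto simp: Pair fraction_def)
  qed
  thus "fraction R a s = fraction R b t" by blast
qed

lemma fraction_self: "a \<in> carrier R \<Longrightarrow> s \<in> nonzerodivisors R \<Longrightarrow> (a, s) \<in> fraction R a s"
  by (simp add: fraction_def)

lemma fraction_mult:
  assumes a: "a \<in> carrier R" and b: "b \<in> carrier R"
    and s: "s \<in> nonzerodivisors R" and t: "t \<in> nonzerodivisors R"
  shows "fraction R a s \<otimes>\<^bsub>total_quotient_ring R\<^esub> fraction R b t = fraction R (a \<otimes> b) (s \<otimes> t)"
proof -
  have "fraction R (a' \<otimes> b') (s' \<otimes> t') = fraction R (a \<otimes> b) (s \<otimes> t)"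
    if p: "(a', s') \<in> fraction R a s" and q: "(b', t') \<in> fraction R b t" for a' s' b' t'
  proof -
    from p q have cl: "a' \<in> carrier R" "b' \<in> carrier R" "s' \<in> nonzerodivisors R" "t' \<in> nonzerodivisors R"
      and e: "a \<otimes> s' = a' \<otimes> s" "b \<otimes> t' = b' \<otimes> t" by (simp_all add: fraction_def)
    note c = a b cl(1,2) cl(3,4)[THEN nonzerodivisors_carrier] s[THEN nonzerodivisors_carrier] t[THEN nonzerodivisors_carrier]
    have "(a' \<otimes> b') \<otimes> (s \<otimes> t) = (a' \<otimes> s) \<otimes> (b' \<otimes> t)" using c by (simp add: m_ac)
    also have "\<dots> = (a \<otimes> b) \<otimes> (s' \<otimes> t')" using c by (simp add: e[symmetric] m_ac)
    finally show ?thesis using a b s t cl by (subst fraction_eq_iff) (simp_all add: nonzerodivisors_mult)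
  qed
  note UN_pair_const[OF fraction_self[OF a s] fraction_self[OF b t] this]
  thus ?thesis by (simp add: total_quotient_ring_def)
qed

lemma fraction_add:
  assumes a: "a \<in> carrier R" and b: "b \<in> carrier R"
    and s: "s \<in> nonzerodivisors R" and t: "t \<in> nonzerodivisors R"
  shows "fraction R a s \<oplus>\<^bsub>total_quotient_ring R\<^esub> fraction R b t
    = fraction R (a \<otimes> t \<oplus> b \<otimes> s) (s \<otimes> t)"
proof -
  have "fraction R (a' \<otimes> t' \<oplus> b' \<otimes> s') (s' \<otimes> t') = fraction R (a \<otimes> t \<oplus> b \<otimes> s) (s \<otimes> t)"
    if p: "(a', s') \<in> fraction R a s" and q: "(b', t') \<in> fraction R b t" for a' s' b' t'
  proof -
    from p q have cl: "a' \<in> carrier R" "b' \<in> carrier R" "s' \<in> nonzerodivisors R" "t' \<in> nonzerodivisors R"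
      and e: "a \<otimes> s' = a' \<otimes> s" "b \<otimes> t' = b' \<otimes> t" by (simp_all add: fraction_def)
    note c = a b cl(1,2) cl(3,4)[THEN nonzerodivisors_carrier] s[THEN nonzerodivisors_carrier] t[THEN nonzerodivisors_carrier]
    have "(a' \<otimes> t' \<oplus> b' \<otimes> s') \<otimes> (s \<otimes> t) = (a' \<otimes> s) \<otimes> (t \<otimes> t') \<oplus> (b' \<otimes> t) \<otimes> (s \<otimes> s')"
      using c by algebra
    also have "\<dots> = (a \<otimes> s') \<otimes> (t \<otimes> t') \<oplus> (b \<otimes> t') \<otimes> (s \<otimes> s')" by (simp add: e)
    also have "\<dots> = (a \<otimes> t \<oplus> b \<otimes> s) \<otimes> (s' \<otimes> t')" using c by algebra
    finally show ?thesis using a b s t cl c by (subst fraction_eq_iff) (simp_all add: nonzerodivisors_mult)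
  qed
  note UN_pair_const[OF fraction_self[OF a s] fraction_self[OF b t] this]
  thus ?thesis by (simp add: total_quotient_ring_def)
qed

lemma total_quotient_ring_cring:
  shows "cring (total_quotient_ring R)"
    and "to_total_quotient_ring R \<in> ring_hom R (total_quotient_ring R)"
proof -
  let ?K = "total_quotient_ring R"
  have carr: "x \<in> carrier ?K \<longleftrightarrow> (\<exists>a s. x = fraction R a s \<and> a \<in> carrier R \<and> s \<in> nonzerodivisors R)" for x
    by (auto simp: total_quotient_ring_def)
  have one: "\<one>\<^bsub>?K\<^esub> = fraction R \<one> \<one>" and zero: "\<zero>\<^bsub>?K\<^esub> = fraction R \<zero> \<one>"
    by (simp_all add: total_quotient_ring_def)
  note nz = nonzerodivisors_carrier nonzerodivisors_one nonzerodivisors_mult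
  have mem: "fraction R a s \<in> carrier ?K" if "a \<in> carrier R" "s \<in> nonzerodivisors R" for a s
    using that carr by blast
  show "cring ?K"
  proof (intro cringI abelian_groupI comm_monoidI)
    fix x y z assume "x \<in> carrier ?K" "y \<in> carrier ?K" "z \<in> carrier ?K"
    then obtain a s b t c u where x: "x = fraction R a s" "a \<in> carrier R" "s \<in> nonzerodivisors R"
      and y: "y = fraction R b t" "b \<in> carrier R" "t \<in> nonzerodivisors R"
      and z: "z = fraction R c u" "c \<in> carrier R" "u \<in> nonzerodivisors R" unfolding carr by blast
    note cl = x(2,3) y(2,3) z(2,3)
    note cc = x(2) y(2) z(2) x(3)[THEN nz(1)] y(3)[THEN nz(1)] z(3)[THEN nz(1)]
    have "((a \<otimes> t \<oplus> b \<otimes> s) \<otimes> u \<oplus> c \<otimes> (s \<otimes> t)) \<otimes> (s \<otimes> (t \<otimes> u))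
      = (a \<otimes> (t \<otimes> u) \<oplus> (b \<otimes> u \<oplus> c \<otimes> t) \<otimes> s) \<otimes> (s \<otimes> t \<otimes> u)" using cc by algebra
    thus "x \<oplus>\<^bsub>?K\<^esub> y \<oplus>\<^bsub>?K\<^esub> z = x \<oplus>\<^bsub>?K\<^esub> (y \<oplus>\<^bsub>?K\<^esub> z)"
      using cl cc by (simp add: x(1) y(1) z(1) fraction_add nz(3) fraction_eq_iff)
    show "x \<otimes>\<^bsub>?K\<^esub> y \<otimes>\<^bsub>?K\<^esub> z = x \<otimes>\<^bsub>?K\<^esub> (y \<otimes>\<^bsub>?K\<^esub> z)"
      using cl cc by (simp add: x(1) y(1) z(1) fraction_mult nz(3) m_assoc)
    have "((a \<otimes> t \<oplus> b \<otimes> s) \<otimes> c) \<otimes> ((s \<otimes> u) \<otimes> (t \<otimes> u))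
      = ((a \<otimes> c) \<otimes> (t \<otimes> u) \<oplus> (b \<otimes> c) \<otimes> (s \<otimes> u)) \<otimes> ((s \<otimes> t) \<otimes> u)" using cc by algebra
    thus "(x \<oplus>\<^bsub>?K\<^esub> y) \<otimes>\<^bsub>?K\<^esub> z = x \<otimes>\<^bsub>?K\<^esub> z \<oplus>\<^bsub>?K\<^esub> y \<otimes>\<^bsub>?K\<^esub> z"
      using cl cc by (simp add: x(1) y(1) z(1) fraction_add fraction_mult nz(3) fraction_eq_iff)
  next
    fix x y assume "x \<in> carrier ?K" "y \<in> carrier ?K"
    then obtain a s b t where x: "x = fraction R a s" "a \<in> carrier R" "s \<in> nonzerodivisors R"
      and y: "y = fraction R b t" "b \<in> carrier R" "t \<in> nonzerodivisors R" unfolding carr by blast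
    note cl = x(2,3) y(2,3)
    note cc = x(2) y(2) x(3)[THEN nz(1)] y(3)[THEN nz(1)]
    show "x \<oplus>\<^bsub>?K\<^esub> y \<in> carrier ?K" "x \<otimes>\<^bsub>?K\<^esub> y \<in> carrier ?K"
      using cl cc by (simp_all add: x(1) y(1) fraction_add fraction_mult nz(3) mem)
    show "x \<oplus>\<^bsub>?K\<^esub> y = y \<oplus>\<^bsub>?K\<^esub> x" "x \<otimes>\<^bsub>?K\<^esub> y = y \<otimes>\<^bsub>?K\<^esub> x"
      using cl cc by (simp_all add: x(1) y(1) fraction_add fraction_mult a_comm m_comm)
  next
    fix x assume "x \<in> carrier ?K"
    then obtain a s where x: "x = fraction R a s" "a \<in> carrier R" "s \<in> nonzerodivisors R" unfolding carr by blast
    note cc = x(2) x(3)[THEN nz(1)]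
    show "\<zero>\<^bsub>?K\<^esub> \<oplus>\<^bsub>?K\<^esub> x = x" "\<one>\<^bsub>?K\<^esub> \<otimes>\<^bsub>?K\<^esub> x = x"
      using x cc by (simp_all add: x(1) one zero fraction_add fraction_mult nz(2))
    have "fraction R (\<ominus> a) s \<oplus>\<^bsub>?K\<^esub> x = \<zero>\<^bsub>?K\<^esub>"
      using x(2,3) cc by (simp add: x(1) zero fraction_add nz(2,3) fraction_eq_iff l_minus l_neg)
    thus "\<exists>y\<in>carrier ?K. y \<oplus>\<^bsub>?K\<^esub> x = \<zero>\<^bsub>?K\<^esub>" using mem[of "\<ominus> a" s] x(2,3) by blast
  qed (simp_all add: one zero mem nz(2))
  show "to_total_quotient_ring R \<in> ring_hom R ?K"
    by (intro ring_hom_memI)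
      (simp_all add: to_total_quotient_ring_def mem nz(2) one fraction_add fraction_mult)
qed

end

lemma frag_extend_fun_diff:
  fixes f g :: "'a \<Rightarrow> ('b \<Rightarrow>\<^sub>0 int)"
  shows "frag_extend (\<lambda>i. f i - g i) c = frag_extend f c - frag_extend g c"
proof -
  have d: "frag_cmul k (a - b) = frag_cmul k a - frag_cmul k b" for k and a b :: "'b \<Rightarrow>\<^sub>0 int"
    by (rule poly_mapping_eqI) (simp add: lookup_minus right_diff_distrib)
  show ?thesis by (simp add: frag_extend_def d sum_subtractf)
qed

lemma keys_diff_subset:
  fixes a b :: "'a \<Rightarrow>\<^sub>0 int"
  assumes "Poly_Mapping.keys a \<subseteq> S" "Poly_Mapping.keys b \<subseteq> S"
  shows "Poly_Mapping.keys (a - b) \<subseteq> S"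
  using assms keys_diff[of a b] by blast

lemma pair_ring_sel:
  "carrier (pair_ring A B) = {c. Poly_Mapping.keys c \<subseteq> carrier A \<times> carrier B}"
  "\<one>\<^bsub>pair_ring A B\<^esub> = frag_of (\<one>\<^bsub>A\<^esub>, \<one>\<^bsub>B\<^esub>)"
  "\<zero>\<^bsub>pair_ring A B\<^esub> = 0"
  "x \<oplus>\<^bsub>pair_ring A B\<^esub> y = x + y"
  by (auto simp: pair_ring_def)

lemma pair_ring_mult:
  "frag_of (a, b) \<otimes>\<^bsub>pair_ring A B\<^esub> frag_of (a', b') = frag_of (a \<otimes>\<^bsub>A\<^esub> a', b \<otimes>\<^bsub>B\<^esub> b')"
  "(x - x') \<otimes>\<^bsub>pair_ring A B\<^esub> y = x \<otimes>\<^bsub>pair_ring A B\<^esub> y - x' \<otimes>\<^bsub>pair_ring A B\<^esub> y"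
  "x \<otimes>\<^bsub>pair_ring A B\<^esub> (y - y') = x \<otimes>\<^bsub>pair_ring A B\<^esub> y - x \<otimes>\<^bsub>pair_ring A B\<^esub> y'"
  "0 \<otimes>\<^bsub>pair_ring A B\<^esub> y = 0"
  "x \<otimes>\<^bsub>pair_ring A B\<^esub> 0 = 0"
  by (simp_all add: pair_ring_def frag_extend_diff frag_extend_fun_diff split_def frag_extend_eq_0)

lemma pair_ring_cring:
  assumes "cring A" "cring B"
  shows "cring (pair_ring A B)"
proof -
  interpret A: cring A by fact
  interpret B: cring B by fact
  let ?P = "pair_ring A B"
  let ?S = "carrier A \<times> carrier B"
  have madd: "(x + x') \<otimes>\<^bsub>?P\<^esub> y = x \<otimes>\<^bsub>?P\<^esub> y + x' \<otimes>\<^bsub>?P\<^esub> y" for x x' y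
    by (simp add: pair_ring_def frag_extend_add)
  have closed: "Poly_Mapping.keys (x \<otimes>\<^bsub>?P\<^esub> y) \<subseteq> ?S"
    if x: "Poly_Mapping.keys x \<subseteq> ?S" and y: "Poly_Mapping.keys y \<subseteq> ?S" for x y
    using x
  proof (induction x rule: frag_induction)
    case (one p)
    show ?case using y
    proof (induction y rule: frag_induction)
      case (one q)
      show ?case using \<open>p \<in> ?S\<close> one by (cases p; cases q) (simp add: pair_ring_mult)
    qed (simp_all add: pair_ring_mult keys_diff_subset)
  qed (simp_all add: pair_ring_mult keys_diff_subset)
  have comm: "x \<otimes>\<^bsub>?P\<^esub> y = y \<otimes>\<^bsub>?P\<^esub> x"
    if x: "Poly_Mapping.keys x \<subseteq> ?S" and y: "Poly_Mapping.keys y \<subseteq> ?S" for x y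
    using x
  proof (induction x rule: frag_induction)
    case (one p)
    show ?case using y
    proof (induction y rule: frag_induction)
      case (one q)
      show ?case using \<open>p \<in> ?S\<close> one by (cases p; cases q) (simp add: pair_ring_mult A.m_comm B.m_comm)
    qed (simp_all add: pair_ring_mult)
  qed (simp_all add: pair_ring_mult)
  have assoc: "x \<otimes>\<^bsub>?P\<^esub> y \<otimes>\<^bsub>?P\<^esub> z = x \<otimes>\<^bsub>?P\<^esub> (y \<otimes>\<^bsub>?P\<^esub> z)"
    if x: "Poly_Mapping.keys x \<subseteq> ?S" and y: "Poly_Mapping.keys y \<subseteq> ?S"
      and z: "Poly_Mapping.keys z \<subseteq> ?S" for x y z
    using x
  proof (induction x rule: frag_induction)
    case (one p)
    show ?case using y
    proof (induction y rule: frag_induction)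
      case (one q)
      show ?case using z
      proof (induction z rule: frag_induction)
        case (one r)
        show ?case using \<open>p \<in> ?S\<close> \<open>q \<in> ?S\<close> one
          by (cases p; cases q; cases r) (simp add: pair_ring_mult A.m_assoc B.m_assoc)
      qed (simp_all add: pair_ring_mult)
    qed (simp_all add: pair_ring_mult)
  qed (simp_all add: pair_ring_mult)
  have one: "\<one>\<^bsub>?P\<^esub> \<otimes>\<^bsub>?P\<^esub> x = x" if "Poly_Mapping.keys x \<subseteq> ?S" for x
    using that
  proof (induction x rule: frag_induction)
    case (one p)
    thus ?case by (cases p) (simp add: pair_ring_sel pair_ring_mult)
  qed (simp_all add: pair_ring_mult)
  show ?thesis
  proof (intro cringI abelian_groupI comm_monoidI)
    show "x \<oplus>\<^bsub>?P\<^esub> y \<in> carrier ?P" if "x \<in> carrier ?P" "y \<in> carrier ?P" for x y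
      using that Poly_Mapping.keys_add[of x y] unfolding pair_ring_sel by blast
    show "\<exists>y\<in>carrier ?P. y \<oplus>\<^bsub>?P\<^esub> x = \<zero>\<^bsub>?P\<^esub>" if "x \<in> carrier ?P" for x
      using that by (intro bexI[of _ "- x"]) (simp_all add: pair_ring_sel keys_minus)
    show "x \<otimes>\<^bsub>?P\<^esub> y = y \<otimes>\<^bsub>?P\<^esub> x" if "x \<in> carrier ?P" "y \<in> carrier ?P" for x y
      using that comm by (simp add: pair_ring_sel)
  qed (simp_all add: pair_ring_sel(1,3,4) closed assoc madd one[unfolded pair_ring_sel] pair_ring_sel(2))
qed

text \<open>The additive subgroup divided out in \<^const>\<open>tensor_product\<close> is an ideal.\<close>

lemma tensor_ideal:
  assumes A: "cring A" and B: "cring B"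
    and f: "f \<in> ring_hom R A" and g: "g \<in> ring_hom R B"
  shows "ideal (generate (free_Abelian_group (carrier A \<times> carrier B)) (tensor_relators R A f B g))
    (pair_ring A B)"
proof -
  interpret A: cring A by fact
  interpret B: cring B by fact
  let ?P = "pair_ring A B"
  let ?S = "carrier A \<times> carrier B"
  let ?F = "free_Abelian_group ?S"
  let ?T = "tensor_relators R A f B g"
  interpret P: cring ?P by (rule pair_ring_cring[OF A B])
  interpret F: group ?F by simp
  have T: "?T \<subseteq> carrier ?F"
  proof
    fix t assume "t \<in> ?T"
    hence "Poly_Mapping.keys t \<subseteq> ?S"
      unfolding tensor_relators_def
      by (elim UnE CollectE exE conjE; simp only:; intro keys_diff_subset;
          simp add: ring_hom_closed[OF f] ring_hom_closed[OF g])
    thus "t \<in> carrier ?F" by simp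
  qed
  have sub: "subgroup (generate ?F ?T) ?F" using F.generate_is_subgroup[OF T] .
  hence sub': "subgroup (generate ?F ?T) (add_monoid ?P)"
    by (simp add: pair_ring_def free_Abelian_group_def)
  have diff: "a - b \<in> generate ?F ?T" if "a \<in> generate ?F ?T" "b \<in> generate ?F ?T" for a b
    using subgroup.m_closed[OF sub that(1) subgroup.m_inv_closed[OF sub that(2)]]
      subgroup.subset[OF sub] that by auto
  have rel: "frag_of (c, d) \<otimes>\<^bsub>?P\<^esub> t \<in> ?T" if t: "t \<in> ?T" and c: "c \<in> carrier A" and d: "d \<in> carrier B" for c d t
    using t[unfolded tensor_relators_def]
  proof (elim UnE CollectE exE conjE)
    fix a a' b assume t: "t = frag_of (a \<oplus>\<^bsub>A\<^esub> a', b) - frag_of (a, b) - frag_of (a', b)"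
      and cl: "a \<in> carrier A" "a' \<in> carrier A" "b \<in> carrier B"
    have "frag_of (c, d) \<otimes>\<^bsub>?P\<^esub> t = frag_of (c \<otimes>\<^bsub>A\<^esub> a \<oplus>\<^bsub>A\<^esub> c \<otimes>\<^bsub>A\<^esub> a', d \<otimes>\<^bsub>B\<^esub> b)
        - frag_of (c \<otimes>\<^bsub>A\<^esub> a, d \<otimes>\<^bsub>B\<^esub> b) - frag_of (c \<otimes>\<^bsub>A\<^esub> a', d \<otimes>\<^bsub>B\<^esub> b)"
      using cl c d by (simp add: t pair_ring_mult A.r_distr)
    thus "frag_of (c, d) \<otimes>\<^bsub>?P\<^esub> t \<in> ?T" unfolding tensor_relators_def
      using A.m_closed[OF c cl(1)] A.m_closed[OF c cl(2)] B.m_closed[OF d cl(3)] by blast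
  next
    fix a b b' assume t: "t = frag_of (a, b \<oplus>\<^bsub>B\<^esub> b') - frag_of (a, b) - frag_of (a, b')"
      and cl: "a \<in> carrier A" "b \<in> carrier B" "b' \<in> carrier B"
    have "frag_of (c, d) \<otimes>\<^bsub>?P\<^esub> t = frag_of (c \<otimes>\<^bsub>A\<^esub> a, d \<otimes>\<^bsub>B\<^esub> b \<oplus>\<^bsub>B\<^esub> d \<otimes>\<^bsub>B\<^esub> b')
        - frag_of (c \<otimes>\<^bsub>A\<^esub> a, d \<otimes>\<^bsub>B\<^esub> b) - frag_of (c \<otimes>\<^bsub>A\<^esub> a, d \<otimes>\<^bsub>B\<^esub> b')"
      using cl c d by (simp add: t pair_ring_mult B.r_distr)
    thus "frag_of (c, d) \<otimes>\<^bsub>?P\<^esub> t \<in> ?T" unfolding tensor_relators_def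
      using A.m_closed[OF c cl(1)] B.m_closed[OF d cl(2)] B.m_closed[OF d cl(3)] by blast
  next
    fix r a b assume t: "t = frag_of (f r \<otimes>\<^bsub>A\<^esub> a, b) - frag_of (a, g r \<otimes>\<^bsub>B\<^esub> b)"
      and cl: "r \<in> carrier R" "a \<in> carrier A" "b \<in> carrier B"
    have "frag_of (c, d) \<otimes>\<^bsub>?P\<^esub> t = frag_of (f r \<otimes>\<^bsub>A\<^esub> (c \<otimes>\<^bsub>A\<^esub> a), d \<otimes>\<^bsub>B\<^esub> b)
        - frag_of (c \<otimes>\<^bsub>A\<^esub> a, g r \<otimes>\<^bsub>B\<^esub> (d \<otimes>\<^bsub>B\<^esub> b))"
      using cl c d ring_hom_closed[OF f cl(1)] ring_hom_closed[OF g cl(1)]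
      by (simp add: t pair_ring_mult A.m_lcomm B.m_lcomm)
    thus "frag_of (c, d) \<otimes>\<^bsub>?P\<^esub> t \<in> ?T" unfolding tensor_relators_def
      using cl(1) A.m_closed[OF c cl(2)] B.m_closed[OF d cl(3)] by blast
  qed
  have rel': "x \<otimes>\<^bsub>?P\<^esub> t \<in> generate ?F ?T" if t: "t \<in> ?T" and x: "Poly_Mapping.keys x \<subseteq> ?S" for x t
    using x
  proof (induction x rule: frag_induction)
    case zero
    show ?case using generate.one[of ?F ?T] by (simp add: pair_ring_mult)
  next
    case (one p)
    thus ?case using rel[OF t] by (cases p) (auto intro: generate.incl)
  qed (simp add: pair_ring_mult diff)
  have mneg: "x \<otimes>\<^bsub>?P\<^esub> (- t) = - (x \<otimes>\<^bsub>?P\<^esub> t)" for x t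
    using pair_ring_mult(3)[where x = x and A = A and B = B and y = 0 and y' = t] by (simp add: pair_ring_mult)
  have madd: "x \<otimes>\<^bsub>?P\<^esub> (t + u) = x \<otimes>\<^bsub>?P\<^esub> t + x \<otimes>\<^bsub>?P\<^esub> u" for x t u
    using pair_ring_mult(3)[where x = x and A = A and B = B and y = t and y' = "- u"] by (simp add: mneg)
  have l: "x \<otimes>\<^bsub>?P\<^esub> t \<in> generate ?F ?T" if t: "t \<in> generate ?F ?T" and x: "Poly_Mapping.keys x \<subseteq> ?S" for x t
    using t
  proof (induction t rule: generate.induct)
    case one
    show ?case using generate.one[of ?F ?T] by (simp add: pair_ring_mult)
  next
    case (incl h)
    thus ?case using rel' x by blast
  next
    case (inv h)
    have "0 \<in> generate ?F ?T" using generate.one[of ?F ?T] by simp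
    hence "0 - x \<otimes>\<^bsub>?P\<^esub> h \<in> generate ?F ?T" by (rule diff[OF _ rel'[OF inv x]])
    moreover have "inv\<^bsub>?F\<^esub> h = - h" using inv T by auto
    ultimately show ?case by (simp add: mneg)
  next
    case (eng h1 h2)
    thus ?case using generate.eng[OF eng.IH] by (simp add: madd)
  qed
  have gen: "t \<in> carrier ?P" if "t \<in> generate ?F ?T" for t
    using subsetD[OF subgroup.subset[OF sub] that] by (simp add: pair_ring_sel)
  show ?thesis
  proof (rule idealI[OF P.ring_axioms sub'])
    fix a x assume a: "a \<in> generate ?F ?T" and x: "x \<in> carrier ?P"
    show "x \<otimes>\<^bsub>?P\<^esub> a \<in> generate ?F ?T" using l[OF a] x by (simp add: pair_ring_sel)
    thus "a \<otimes>\<^bsub>?P\<^esub> x \<in> generate ?F ?T" using P.m_comm[OF gen[OF a] x] by simp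
  qed
qed

lemma tensor_product_cring:
  assumes "cring A" "cring B" "f \<in> ring_hom R A" "g \<in> ring_hom R B"
  shows "cring (tensor_product R A f B g)"
  unfolding tensor_product_def
  by (rule ideal.quotient_is_cring[OF tensor_ideal[OF assms] pair_ring_cring[OF assms(1,2)]])

end

theory Submission
  imports Defs
begin

text \<open>
  Let \<open>A\<close> be the \<open>\<mm>\<close>-adic completion of \<open>R\<close> and \<open>e\<close> a generator of the copy of \<open>R/\<mm>\<close>
  in \<open>E\<close>.  The theorem rests on two facts about \<open>E\<close> going back to Matlis: its
  \<open>R\<close>-endomorphisms are exactly the multiplications by elements of \<open>A\<close>, distinct elements
  giving distinct endomorphisms (\<open>hom_is_act\<close>, \<open>act_faithful\<close>), and \<open>E\<close> satisfies the
  descending chain condition on submodules (\<open>dcc_E\<close>).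

  On the ring side, a sum of pure tensors over \<open>R\<close> has a common denominator, so every element
  of \<open>A \<otimes> K\<close> is \<open>a \<otimes> 1/s\<close>.  Since non-zero-divisors of \<open>R\<close> stay non-zero-divisors in \<open>A\<close>,
  such a tensor vanishes only for \<open>a = 0\<close>.  Hence \<open>A \<otimes> K\<close> is a field iff \<open>A\<close> is nonzero and every nonzero
  \<open>a\<close> in \<open>A\<close> divides a non-zero-divisor \<open>s\<close> of \<open>R\<close> in \<open>A\<close> (\<open>field_tensor_iff\<close>).

  If this holds and \<open>V\<close> is a divisible submodule missing some \<open>x \<in> E\<close>, then, \<open>E\<close> being an injective
  cogenerator, some endomorphism kills \<open>V\<close> but not \<open>x\<close>.  It is multiplication by a nonzero
  \<open>a\<close>, and \<open>s = b a\<close> gives \<open>V = s V = 0\<close>.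

  Conversely, let \<open>E\<close> be simple divisible and \<open>a \<noteq> 0\<close>.  The image \<open>a E\<close> is divisible and nonzero,
  so \<open>a E = E\<close>.  Among the submodules \<open>s V\<close> of the kernel \<open>V\<close> of \<open>a\<close> there is a minimal one; it
  equals all its multiples, so it is divisible and, being proper, zero.  Thus some \<open>s\<close> vanishes on the kernel
  of the surjection \<open>a\<close> and factors through it as \<open>s = h \<circ> a\<close>, where \<open>h\<close> is multiplication by
  some \<open>b\<close> in \<open>A\<close>.
\<close>

section \<open>Tensoring an algebra with the total quotient ring\<close>

locale regular_algebra = R: cring R + A: cring A
  for R :: "('a, 'r) ring_scheme" (structure) and A :: "('b, 'm) ring_scheme" and \<phi> :: "'a \<Rightarrow> 'b" +
  assumes hom: "\<phi> \<in> ring_hom R A"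
    and regular: "s \<in> nonzerodivisors R \<Longrightarrow> \<phi> s \<in> nonzerodivisors A"
begin

abbreviation K where "K \<equiv> total_quotient_ring R"
abbreviation Q where "Q \<equiv> total_quotient_ring A"
abbreviation P where "P \<equiv> pair_ring A K"
abbreviation T where "T \<equiv> tensor_product R A \<phi> K (to_total_quotient_ring R)"
abbreviation relations where "relations \<equiv>
  generate (free_Abelian_group (carrier A \<times> carrier K)) (tensor_relators R A \<phi> K (to_total_quotient_ring R))"

definition pure :: "'b \<Rightarrow> ('a \<times> 'a) set \<Rightarrow> ('b \<times> ('a \<times> 'a) set \<Rightarrow>\<^sub>0 int) set"
  where "pure a x = relations +>\<^bsub>P\<^esub> frag_of (a, x)"

text \<open>
  Together with \<open>A \<rightarrow> Q\<close> this map induces \<open>A \<otimes> K \<rightarrow> Q\<close>, which detects nonzero tensors.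
\<close>

definition fraction_map :: "('a \<times> 'a) set \<Rightarrow> ('b \<times> 'b) set"
  where "fraction_map x = (\<Union>(r, s)\<in>x. fraction A (\<phi> r) (\<phi> s))"

sublocale K: cring K by (rule R.total_quotient_ring_cring)
sublocale Q: cring Q by (rule A.total_quotient_ring_cring)
sublocale P: cring P by (rule pair_ring_cring) (unfold_locales)
sublocale T: cring T
  by (rule tensor_product_cring[OF A.cring_axioms K.cring_axioms hom R.total_quotient_ring_cring(2)])
sublocale relations: ideal relations P
  by (rule tensor_ideal[OF A.cring_axioms K.cring_axioms hom R.total_quotient_ring_cring(2)])

lemma K_carrier: "x \<in> carrier K \<longleftrightarrow> (\<exists>r s. x = fraction R r s \<and> r \<in> carrier R \<and> s \<in> nonzerodivisors R)"
  by (auto simp: total_quotient_ring_def)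

lemma fraction_in_K: "r \<in> carrier R \<Longrightarrow> s \<in> nonzerodivisors R \<Longrightarrow> fraction R r s \<in> carrier K"
  using K_carrier by blast

lemmas hom_simps = ring_hom_closed[OF hom] ring_hom_mult[OF hom] ring_hom_add[OF hom] ring_hom_one[OF hom]

lemma T_hom: "(+>\<^bsub>P\<^esub>) relations \<in> ring_hom P T"
  unfolding tensor_product_def by (rule relations.rcos_ring_hom)

lemma frag_in_P: "a \<in> carrier A \<Longrightarrow> x \<in> carrier K \<Longrightarrow> frag_of (a, x) \<in> carrier P"
  by (simp add: pair_ring_sel)

lemma pure_closed: "a \<in> carrier A \<Longrightarrow> x \<in> carrier K \<Longrightarrow> pure a x \<in> carrier T"
  unfolding pure_def by (rule ring_hom_closed[OF T_hom frag_in_P])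

lemma pure_mult:
  assumes "a \<in> carrier A" "b \<in> carrier A" "x \<in> carrier K" "y \<in> carrier K"
  shows "pure a x \<otimes>\<^bsub>T\<^esub> pure b y = pure (a \<otimes>\<^bsub>A\<^esub> b) (x \<otimes>\<^bsub>K\<^esub> y)"
  using assms unfolding pure_def
  by (simp add: ring_hom_mult[OF T_hom, symmetric] frag_in_P pair_ring_mult)

lemma pure_one: "pure \<one>\<^bsub>A\<^esub> \<one>\<^bsub>K\<^esub> = \<one>\<^bsub>T\<^esub>"
  unfolding pure_def using ring_hom_one[OF T_hom] by (simp add: pair_ring_sel)

lemma coset_eqI:
  assumes "u \<in> carrier P" "v \<in> carrier P" "u - v \<in> relations"
  shows "relations +>\<^bsub>P\<^esub> u = relations +>\<^bsub>P\<^esub> v"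
proof -
  have "u - v \<in> carrier P" using assms(3) by (rule relations.Icarr)
  hence "relations +>\<^bsub>P\<^esub> ((u - v) + v) = (relations +>\<^bsub>P\<^esub> (u - v)) \<oplus>\<^bsub>T\<^esub> (relations +>\<^bsub>P\<^esub> v)"
    using ring_hom_add[OF T_hom, of "u - v" v] assms by (simp add: pair_ring_sel)
  also have "relations +>\<^bsub>P\<^esub> (u - v) = \<zero>\<^bsub>T\<^esub>"
    using P.a_rcos_zero[OF relations.ideal_axioms assms(3)] by (simp add: tensor_product_def FactRing_def)
  finally show ?thesis using ring_hom_closed[OF T_hom assms(2)] by simp
qed

lemma pure_add_left:
  assumes "a \<in> carrier A" "b \<in> carrier A" "x \<in> carrier K"
  shows "pure (a \<oplus>\<^bsub>A\<^esub> b) x = pure a x \<oplus>\<^bsub>T\<^esub> pure b x"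
proof -
  have "frag_of (a \<oplus>\<^bsub>A\<^esub> b, x) - frag_of (a, x) - frag_of (b, x)
      \<in> tensor_relators R A \<phi> K (to_total_quotient_ring R)"
    unfolding tensor_relators_def using assms by blast
  hence "frag_of (a \<oplus>\<^bsub>A\<^esub> b, x) - (frag_of (a, x) + frag_of (b, x)) \<in> relations"
    by (auto intro: generate.incl simp: diff_diff_add)
  from coset_eqI[OF _ _ this] show ?thesis
    unfolding pure_def using assms frag_in_P[OF assms(1,3)] frag_in_P[OF assms(2,3)]
      P.add.m_closed[OF frag_in_P[OF assms(1,3)] frag_in_P[OF assms(2,3)]]
      ring_hom_add[OF T_hom frag_in_P[OF assms(1,3)] frag_in_P[OF assms(2,3)]]
      frag_in_P[OF A.add.m_closed[OF assms(1,2)] assms(3)]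
    by (simp add: pair_ring_sel)
qed

lemma pure_zero_left:
  assumes "x \<in> carrier K" shows "pure \<zero>\<^bsub>A\<^esub> x = \<zero>\<^bsub>T\<^esub>"
  using pure_add_left[OF A.zero_closed A.zero_closed assms] pure_closed[OF A.zero_closed assms]
  by (simp add: T.add.l_cancel_one')

lemma pure_minus_left:
  assumes "a \<in> carrier A" "b \<in> carrier A" "x \<in> carrier K"
  shows "pure (a \<ominus>\<^bsub>A\<^esub> b) x = pure a x \<ominus>\<^bsub>T\<^esub> pure b x"
proof -
  have "pure a x = pure (a \<ominus>\<^bsub>A\<^esub> b) x \<oplus>\<^bsub>T\<^esub> pure b x"
    using assms pure_add_left[of "a \<ominus>\<^bsub>A\<^esub> b" b x]
    by (simp add: A.minus_eq A.a_assoc A.l_neg)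
  thus ?thesis using assms pure_closed[of "a \<ominus>\<^bsub>A\<^esub> b" x] pure_closed[of b x]
    by (simp add: T.minus_eq T.a_assoc T.r_neg)
qed

lemma pure_balanced:
  assumes "a \<in> carrier A" "r \<in> carrier R" "x \<in> carrier K"
  shows "pure (\<phi> r \<otimes>\<^bsub>A\<^esub> a) x = pure a (to_total_quotient_ring R r \<otimes>\<^bsub>K\<^esub> x)"
proof -
  have "frag_of (\<phi> r \<otimes>\<^bsub>A\<^esub> a, x) - frag_of (a, to_total_quotient_ring R r \<otimes>\<^bsub>K\<^esub> x)
      \<in> tensor_relators R A \<phi> K (to_total_quotient_ring R)"
    unfolding tensor_relators_def using assms by blast
  hence "frag_of (\<phi> r \<otimes>\<^bsub>A\<^esub> a, x) - frag_of (a, to_total_quotient_ring R r \<otimes>\<^bsub>K\<^esub> x) \<in> relations"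
    by (rule generate.incl)
  thus ?thesis unfolding pure_def
    using assms ring_hom_closed[OF R.total_quotient_ring_cring(2), of r]
    by (intro coset_eqI) (simp_all add: frag_in_P hom_simps)
qed

lemma pure_fraction:
  assumes "a \<in> carrier A" "r \<in> carrier R" "s \<in> nonzerodivisors R" "t \<in> nonzerodivisors R"
  shows "pure a (fraction R r (s \<otimes> t)) = pure (\<phi> r \<otimes>\<^bsub>A\<^esub> a) (fraction R \<one> (s \<otimes> t))"
  using assms R.nonzerodivisors_mult[OF assms(3,4)] R.nonzerodivisors_carrier[of s] R.nonzerodivisors_carrier[of t]
  by (simp add: pure_balanced fraction_in_K to_total_quotient_ring_def R.fraction_mult R.nonzerodivisors_one)

lemma pure_expand:
  assumes "a \<in> carrier A" "s \<in> nonzerodivisors R" "t \<in> nonzerodivisors R"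
  shows "pure a (fraction R \<one> s) = pure (\<phi> t \<otimes>\<^bsub>A\<^esub> a) (fraction R \<one> (s \<otimes> t))"
proof -
  have "fraction R \<one> s = fraction R t (s \<otimes> t)"
    using assms R.nonzerodivisors_mult R.nonzerodivisors_carrier
    by (subst R.fraction_eq_iff) (simp_all add: R.m_comm)
  thus ?thesis using pure_fraction[OF assms(1) _ assms(2,3), of t] assms R.nonzerodivisors_carrier by simp
qed

text \<open>
  Finitely many fractions have a common denominator, and numerators move into \<open>A\<close> by balancing.
\<close>

lemma T_pure:
  assumes "t \<in> carrier T"
  obtains a s where "a \<in> carrier A" "s \<in> nonzerodivisors R" "t = pure a (fraction R \<one> s)"
proof -
  from assms obtain u where u: "u \<in> carrier P" "t = relations +>\<^bsub>P\<^esub> u"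
    unfolding tensor_product_def FactRing_def A_RCOSETS_def' by auto
  have "u \<in> carrier P \<and> (\<exists>a\<in>carrier A. \<exists>s\<in>nonzerodivisors R. relations +>\<^bsub>P\<^esub> u = pure a (fraction R \<one> s))"
    using u(1)[unfolded pair_ring_sel mem_Collect_eq]
  proof (induction u rule: frag_induction)
    case zero
    have "relations +>\<^bsub>P\<^esub> 0 = \<zero>\<^bsub>T\<^esub>"
      using ring_hom_zero[OF T_hom P.ring_axioms T.ring_axioms] by (simp add: pair_ring_sel)
    hence "relations +>\<^bsub>P\<^esub> 0 = pure \<zero>\<^bsub>A\<^esub> (fraction R \<one> \<one>)"
      using pure_zero_left[of "fraction R \<one> \<one>"] R.nonzerodivisors_one fraction_in_K by simp
    thus ?case using R.nonzerodivisors_one P.zero_closed by (auto simp: pair_ring_sel)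
  next
    case (one p)
    then obtain a r s where p: "p = (a, fraction R r s)" "a \<in> carrier A" "r \<in> carrier R" "s \<in> nonzerodivisors R"
      using K_carrier by auto
    have "pure a (fraction R r s) = pure (\<phi> r \<otimes>\<^bsub>A\<^esub> a) (fraction R \<one> s)"
      using pure_fraction[OF p(2,3,4) R.nonzerodivisors_one] R.nonzerodivisors_carrier[OF p(4)] by simp
    thus ?case using p one frag_in_P[of a "fraction R r s"]
      by (auto simp: pure_def[symmetric] hom_simps fraction_in_K)
  next
    case (diff u v)
    then obtain a s b t where *: "u \<in> carrier P" "v \<in> carrier P" "a \<in> carrier A" "b \<in> carrier A"
      "s \<in> nonzerodivisors R" "t \<in> nonzerodivisors R" "relations +>\<^bsub>P\<^esub> u = pure a (fraction R \<one> s)"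
      "relations +>\<^bsub>P\<^esub> v = pure b (fraction R \<one> t)" by blast
    have uv: "u - v \<in> carrier P" using *(1,2) by (simp add: pair_ring_sel keys_diff_subset)
    note c = *(3-6) R.nonzerodivisors_carrier[OF *(5)] R.nonzerodivisors_carrier[OF *(6)]
    have "relations +>\<^bsub>P\<^esub> u = (relations +>\<^bsub>P\<^esub> (u - v)) \<oplus>\<^bsub>T\<^esub> (relations +>\<^bsub>P\<^esub> v)"
      using ring_hom_add[OF T_hom uv *(2)] by (simp add: pair_ring_sel)
    hence "relations +>\<^bsub>P\<^esub> (u - v) = pure a (fraction R \<one> s) \<ominus>\<^bsub>T\<^esub> pure b (fraction R \<one> t)"
      using ring_hom_closed[OF T_hom uv] pure_closed[of b "fraction R \<one> t"] c fraction_in_K *(7,8)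
      by (simp add: T.minus_eq T.a_assoc T.r_neg)
    also have "pure b (fraction R \<one> t) = pure (\<phi> s \<otimes>\<^bsub>A\<^esub> b) (fraction R \<one> (s \<otimes> t))"
      using pure_expand[of b t s] c by (simp add: R.m_comm)
    also have "pure a (fraction R \<one> s) = pure (\<phi> t \<otimes>\<^bsub>A\<^esub> a) (fraction R \<one> (s \<otimes> t))"
      using pure_expand[of a s t] c by simp
    finally have "relations +>\<^bsub>P\<^esub> (u - v) = pure (\<phi> t \<otimes>\<^bsub>A\<^esub> a \<ominus>\<^bsub>A\<^esub> \<phi> s \<otimes>\<^bsub>A\<^esub> b) (fraction R \<one> (s \<otimes> t))"
      using c by (simp add: pure_minus_left hom_simps fraction_in_K R.nonzerodivisors_mult)
    moreover have "\<phi> t \<otimes>\<^bsub>A\<^esub> a \<ominus>\<^bsub>A\<^esub> \<phi> s \<otimes>\<^bsub>A\<^esub> b \<in> carrier A" using c by (simp add: hom_simps)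
    ultimately show ?case using uv R.nonzerodivisors_mult[OF *(5,6)] by blast
  qed
  thus thesis using that u(2) by blast
qed

lemma fraction_map_fraction:
  assumes "r \<in> carrier R" "s \<in> nonzerodivisors R"
  shows "fraction_map (fraction R r s) = fraction A (\<phi> r) (\<phi> s)"
proof -
  have "fraction A (\<phi> b) (\<phi> t) = fraction A (\<phi> r) (\<phi> s)" if "(b, t) \<in> fraction R r s" for b t
  proof -
    from that have bt: "b \<in> carrier R" "t \<in> nonzerodivisors R" "r \<otimes> t = b \<otimes> s" by (simp_all add: fraction_def)
    have "\<phi> b \<otimes>\<^bsub>A\<^esub> \<phi> s = \<phi> r \<otimes>\<^bsub>A\<^esub> \<phi> t"
      using bt(3) assms bt(1,2) R.nonzerodivisors_carrier by (simp flip: hom_simps(2))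
    thus ?thesis using assms bt by (subst A.fraction_eq_iff) (simp_all add: hom_simps regular)
  qed
  thus ?thesis unfolding fraction_map_def using R.fraction_self[OF assms] by fast
qed

lemma fraction_map_hom: "fraction_map \<in> ring_hom K Q"
proof (rule ring_hom_memI)
  note nz = R.nonzerodivisors_carrier R.nonzerodivisors_mult R.nonzerodivisors_one regular
    A.nonzerodivisors_carrier
  show "fraction_map x \<in> carrier Q" if "x \<in> carrier K" for x
  proof -
    from that obtain r s where "x = fraction R r s" "\<phi> r \<in> carrier A" "\<phi> s \<in> nonzerodivisors A"
      "fraction_map x = fraction A (\<phi> r) (\<phi> s)"
      unfolding K_carrier using fraction_map_fraction hom_simps(1) regular by blast
    thus ?thesis by (auto simp: total_quotient_ring_def)
  qed
  show "fraction_map (x \<otimes>\<^bsub>K\<^esub> y) = fraction_map x \<otimes>\<^bsub>Q\<^esub> fraction_map y"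
    "fraction_map (x \<oplus>\<^bsub>K\<^esub> y) = fraction_map x \<oplus>\<^bsub>Q\<^esub> fraction_map y"
    if "x \<in> carrier K" "y \<in> carrier K" for x y
    using that by (auto simp: K_carrier fraction_map_fraction R.fraction_mult R.fraction_add
        A.fraction_mult A.fraction_add hom_simps nz)
  show "fraction_map \<one>\<^bsub>K\<^esub> = \<one>\<^bsub>Q\<^esub>"
    using fraction_map_fraction[of \<one> \<one>] by (simp add: total_quotient_ring_def hom_simps nz)
qed

text \<open>
  The biadditive map sending \<open>(a, x)\<close> to \<open>a/1\<close> times the image of \<open>x\<close> in \<open>Q\<close> kills the relators,
  so an equality of tensors can be read off in the total quotient ring of \<open>A\<close>.
\<close>

lemma pure_eqD:
  assumes a: "a \<in> carrier A" and b: "b \<in> carrier A" and s: "s \<in> nonzerodivisors R" and t: "t \<in> nonzerodivisors R"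
    and eq: "pure a (fraction R \<one> s) = pure b (fraction R \<one> t)"
  shows "a \<otimes>\<^bsub>A\<^esub> \<phi> t = b \<otimes>\<^bsub>A\<^esub> \<phi> s"
proof -
  let ?F = "free_Abelian_group (carrier A \<times> carrier K)"
  let ?tq = "to_total_quotient_ring A"
  define f where "f = (\<lambda>(a, x). ?tq a \<otimes>\<^bsub>Q\<^esub> fraction_map x)"
  note tq = A.total_quotient_ring_cring(2)
  note Qs = ring_hom_closed[OF tq] ring_hom_closed[OF fraction_map_hom] ring_hom_mult[OF tq]
    ring_hom_add[OF tq] ring_hom_mult[OF fraction_map_hom] ring_hom_add[OF fraction_map_hom]
  have "f ` (carrier A \<times> carrier K) \<subseteq> carrier (add_monoid Q)"
    by (auto simp: f_def Qs)
  then obtain h where h: "h \<in> hom ?F (add_monoid Q)" and hf: "\<And>p. p \<in> carrier A \<times> carrier K \<Longrightarrow> h (frag_of p) = f p"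
    using comm_group.free_Abelian_group_universal[OF Q.a_comm_group] by blast
  interpret h: group_hom ?F "add_monoid Q" h
    by (intro group_hom.intro group_hom_axioms.intro h Q.a_group group_free_Abelian_group)
  have hd: "h (u - v) = h u \<ominus>\<^bsub>Q\<^esub> h v" if "u \<in> carrier ?F" "v \<in> carrier ?F" for u v
  proof -
    have "h u = h ((u - v) + v)" by simp
    also have "\<dots> = h (u - v) \<oplus>\<^bsub>Q\<^esub> h v"
      using h.hom_mult[of "u - v" v] that by (simp add: keys_diff_subset)
    finally show ?thesis using that h.hom_closed[of "u - v"] h.hom_closed[of v]
      by (simp add: Q.minus_eq Q.a_assoc Q.r_neg keys_diff_subset)
  qed
  have fr: "\<And>a x. a \<in> carrier A \<Longrightarrow> x \<in> carrier K \<Longrightarrow> frag_of (a, x) \<in> carrier ?F" by simp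
  have fK: "to_total_quotient_ring R r \<in> carrier K" if "r \<in> carrier R" for r
    using ring_hom_closed[OF R.total_quotient_ring_cring(2) that] .
  have "?tq (\<phi> r) = fraction_map (to_total_quotient_ring R r)" if "r \<in> carrier R" for r
    using that by (simp add: to_total_quotient_ring_def fraction_map_fraction R.nonzerodivisors_one hom_simps)
  hence fg: "?tq (\<phi> r) = fraction_map (to_total_quotient_ring R r)" if "r \<in> carrier R" for r
    using that .
  have 3: "h (u - v - w) = \<zero>\<^bsub>Q\<^esub>" if "u \<in> carrier ?F" "v \<in> carrier ?F" "w \<in> carrier ?F" "h u = h v \<oplus>\<^bsub>Q\<^esub> h w" for u v w
  proof -
    have "h v \<in> carrier Q" "h w \<in> carrier Q" using that h.hom_closed by simp_all
    hence "h v \<oplus>\<^bsub>Q\<^esub> h w \<ominus>\<^bsub>Q\<^esub> h v \<ominus>\<^bsub>Q\<^esub> h w = \<zero>\<^bsub>Q\<^esub>" by algebra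
    thus ?thesis using that hd[of "u - v" w] hd[of u v] by (simp add: keys_diff_subset)
  qed
  have 2: "h (u - v) = \<zero>\<^bsub>Q\<^esub>" if "u \<in> carrier ?F" "v \<in> carrier ?F" "h u = h v" for u v
    using that hd[of u v] h.hom_closed[of v] by (simp add: Q.minus_eq Q.r_neg)
  have "h u = \<zero>\<^bsub>Q\<^esub>" if "u \<in> tensor_relators R A \<phi> K (to_total_quotient_ring R)" for u
    using that unfolding tensor_relators_def
  proof (elim UnE CollectE exE conjE)
    fix a a' x assume "u = frag_of (a \<oplus>\<^bsub>A\<^esub> a', x) - frag_of (a, x) - frag_of (a', x)"
      and "a \<in> carrier A" "a' \<in> carrier A" "x \<in> carrier K"
    thus ?thesis by (simp only:, intro 3) (simp_all add: hf f_def Qs Q.l_distr)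
  next
    fix a x x' assume "u = frag_of (a, x \<oplus>\<^bsub>K\<^esub> x') - frag_of (a, x) - frag_of (a, x')"
      and "a \<in> carrier A" "x \<in> carrier K" "x' \<in> carrier K"
    thus ?thesis by (simp only:, intro 3) (simp_all add: hf f_def Qs Q.r_distr)
  next
    fix r a x assume "u = frag_of (\<phi> r \<otimes>\<^bsub>A\<^esub> a, x) - frag_of (a, to_total_quotient_ring R r \<otimes>\<^bsub>K\<^esub> x)"
      and "r \<in> carrier R" "a \<in> carrier A" "x \<in> carrier K"
    thus ?thesis by (simp only:, intro 2) (simp_all add: hf f_def Qs fK fg hom_simps Q.m_ac)
  qed
  moreover have "tensor_relators R A \<phi> K (to_total_quotient_ring R) \<subseteq> relations" by (auto intro: generate.incl)
  hence "tensor_relators R A \<phi> K (to_total_quotient_ring R) \<subseteq> carrier ?F"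
    using relations.Icarr by (auto simp: pair_ring_sel)
  ultimately have "tensor_relators R A \<phi> K (to_total_quotient_ring R) \<subseteq> {u \<in> carrier ?F. h u = \<zero>\<^bsub>Q\<^esub>}" by blast
  moreover have "subgroup {u \<in> carrier ?F. h u = \<zero>\<^bsub>Q\<^esub>} ?F"
    using h.subgroup_kernel by (simp add: kernel_def)
  ultimately have ker: "relations \<subseteq> {u \<in> carrier ?F. h u = \<zero>\<^bsub>Q\<^esub>}"
    using group.generate_subgroup_incl[OF group_free_Abelian_group] by blast
  let ?u = "frag_of (a, fraction R \<one> s)" and ?v = "frag_of (b, fraction R \<one> t)"
  have uF: "?u \<in> carrier P" "?v \<in> carrier P" using a b s t by (simp_all add: frag_in_P fraction_in_K)
  have "?u \<ominus>\<^bsub>P\<^esub> ?v \<in> relations"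
    using eq uF P.quotient_eq_iff_same_a_r_cos[OF relations.ideal_axioms] unfolding pure_def by blast
  moreover have "?u \<ominus>\<^bsub>P\<^esub> ?v = ?u - ?v"
  proof -
    have "?u - ?v \<in> carrier P" using uF by (simp add: pair_ring_sel keys_diff_subset)
    moreover have "?u = (?u - ?v) \<oplus>\<^bsub>P\<^esub> ?v" by (simp add: pair_ring_sel)
    ultimately show ?thesis using uF by (metis P.add.inv_solve_right a_minus_def)
  qed
  ultimately have "h ?u \<ominus>\<^bsub>Q\<^esub> h ?v = \<zero>\<^bsub>Q\<^esub>" using ker hd[of ?u ?v] a b s t fraction_in_K by (simp add: subset_iff)
  hence "f (a, fraction R \<one> s) = f (b, fraction R \<one> t)"
    using hf a b s t fraction_in_K h.hom_closed[of ?u] h.hom_closed[of ?v] by simp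
  thus ?thesis
    using a b s t by (simp add: f_def fraction_map_fraction to_total_quotient_ring_def A.fraction_mult
        A.nonzerodivisors_one hom_simps regular A.fraction_eq_iff A.nonzerodivisors_carrier)
qed

text \<open>
  If \<open>b a = s\<close>, the inverse of \<open>a \<otimes> 1/t\<close> is \<open>t b \<otimes> 1/s\<close>.  Conversely an inverse \<open>b \<otimes> 1/s\<close> of
  \<open>a \<otimes> 1\<close> satisfies \<open>b a \<otimes> 1/s = 1 \<otimes> 1\<close>, and \<open>pure_eqD\<close> clears the denominator.
\<close>

lemma field_tensor_iff:
  "field T \<longleftrightarrow> \<one>\<^bsub>A\<^esub> \<noteq> \<zero>\<^bsub>A\<^esub> \<and>
    (\<forall>a\<in>carrier A - {\<zero>\<^bsub>A\<^esub>}. \<exists>b\<in>carrier A. \<exists>s\<in>nonzerodivisors R. b \<otimes>\<^bsub>A\<^esub> a = \<phi> s)"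
proof
  have one: "pure \<one>\<^bsub>A\<^esub> (fraction R \<one> \<one>) = \<one>\<^bsub>T\<^esub>"
    using pure_one by (simp add: total_quotient_ring_def)
  have zero: "pure \<zero>\<^bsub>A\<^esub> (fraction R \<one> \<one>) = \<zero>\<^bsub>T\<^esub>"
    by (rule pure_zero_left) (simp add: fraction_in_K R.nonzerodivisors_one)
  note nz = R.nonzerodivisors_carrier R.nonzerodivisors_mult R.nonzerodivisors_one
  {
    assume "field T"
    then interpret T: field T .
    show "\<one>\<^bsub>A\<^esub> \<noteq> \<zero>\<^bsub>A\<^esub> \<and>
      (\<forall>a\<in>carrier A - {\<zero>\<^bsub>A\<^esub>}. \<exists>b\<in>carrier A. \<exists>s\<in>nonzerodivisors R. b \<otimes>\<^bsub>A\<^esub> a = \<phi> s)"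
    proof (intro conjI ballI)
      show "\<one>\<^bsub>A\<^esub> \<noteq> \<zero>\<^bsub>A\<^esub>" using one zero T.one_not_zero by metis
      fix a assume a: "a \<in> carrier A - {\<zero>\<^bsub>A\<^esub>}"
      let ?t = "pure a (fraction R \<one> \<one>)"
      have "?t \<noteq> \<zero>\<^bsub>T\<^esub>"
        using a pure_eqD[of a "\<zero>\<^bsub>A\<^esub>" \<one> \<one>] unfolding zero[symmetric] by (auto simp: nz hom_simps)
      moreover have tc: "?t \<in> carrier T" using a by (simp add: pure_closed fraction_in_K nz)
      ultimately have "?t \<in> Units T" by (simp add: T.field_Units)
      then obtain u where u: "u \<in> carrier T" "u \<otimes>\<^bsub>T\<^esub> ?t = \<one>\<^bsub>T\<^esub>" unfolding Units_def by blast
      from u(1) obtain b s where b: "b \<in> carrier A" "s \<in> nonzerodivisors R" "u = pure b (fraction R \<one> s)"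
        by (rule T_pure)
      have "pure (b \<otimes>\<^bsub>A\<^esub> a) (fraction R \<one> s) = pure \<one>\<^bsub>A\<^esub> (fraction R \<one> \<one>)"
        using u(2) b a by (simp add: one pure_mult fraction_in_K nz R.fraction_mult)
      hence "b \<otimes>\<^bsub>A\<^esub> a = \<phi> s"
        using pure_eqD[of "b \<otimes>\<^bsub>A\<^esub> a" "\<one>\<^bsub>A\<^esub>" s \<one>] a b by (simp add: nz hom_simps)
      thus "\<exists>b\<in>carrier A. \<exists>s\<in>nonzerodivisors R. b \<otimes>\<^bsub>A\<^esub> a = \<phi> s" using b by blast
    qed
  next
    assume *: "\<one>\<^bsub>A\<^esub> \<noteq> \<zero>\<^bsub>A\<^esub> \<and>
      (\<forall>a\<in>carrier A - {\<zero>\<^bsub>A\<^esub>}. \<exists>b\<in>carrier A. \<exists>s\<in>nonzerodivisors R. b \<otimes>\<^bsub>A\<^esub> a = \<phi> s)"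
    have nt: "\<one>\<^bsub>T\<^esub> \<noteq> \<zero>\<^bsub>T\<^esub>"
      using * pure_eqD[of "\<one>\<^bsub>A\<^esub>" "\<zero>\<^bsub>A\<^esub>" \<one> \<one>] by (auto simp: one zero nz hom_simps)
    have "t \<in> Units T" if t: "t \<in> carrier T - {\<zero>\<^bsub>T\<^esub>}" for t
    proof -
      obtain a s where a: "a \<in> carrier A" "s \<in> nonzerodivisors R" "t = pure a (fraction R \<one> s)"
        using t T_pure by blast
      have "a \<noteq> \<zero>\<^bsub>A\<^esub>" using t a pure_zero_left[of "fraction R \<one> s"] by (auto simp: fraction_in_K)
      then obtain b s' where b: "b \<in> carrier A" "s' \<in> nonzerodivisors R" "b \<otimes>\<^bsub>A\<^esub> a = \<phi> s'" using * a by blast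
      let ?u = "pure (\<phi> s \<otimes>\<^bsub>A\<^esub> b) (fraction R \<one> s')"
      have "?u \<otimes>\<^bsub>T\<^esub> t = pure (\<phi> s \<otimes>\<^bsub>A\<^esub> (b \<otimes>\<^bsub>A\<^esub> a)) (fraction R \<one> (s' \<otimes> s))"
        using a b by (simp add: pure_mult fraction_in_K nz R.fraction_mult hom_simps A.m_assoc)
      also have "\<dots> = pure (\<phi> (s' \<otimes> s) \<otimes>\<^bsub>A\<^esub> \<one>\<^bsub>A\<^esub>) (fraction R \<one> (\<one> \<otimes> (s' \<otimes> s)))"
        using a b by (simp add: hom_simps nz A.m_comm)
      also have "\<dots> = \<one>\<^bsub>T\<^esub>"
        using a b pure_expand[of "\<one>\<^bsub>A\<^esub>" \<one> "s' \<otimes> s"] by (simp only: one nz A.one_closed)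
      finally have "?u \<otimes>\<^bsub>T\<^esub> t = \<one>\<^bsub>T\<^esub>" .
      moreover have "?u \<in> carrier T" using a b by (simp add: pure_closed hom_simps nz fraction_in_K)
      moreover have "t \<otimes>\<^bsub>T\<^esub> ?u = ?u \<otimes>\<^bsub>T\<^esub> t" using calculation(2) t by (simp add: T.m_comm)
      ultimately show ?thesis using t unfolding Units_def mem_Collect_eq by (metis DiffD1)
    qed
    moreover have "\<zero>\<^bsub>T\<^esub> \<notin> Units T" using nt unfolding Units_def by auto
    ultimately have "Units T = carrier T - {\<zero>\<^bsub>T\<^esub>}" by (auto simp: T.Units_closed)
    thus "field T" by (rule T.cring_fieldI)
  }
qed

end

section \<open>Modules and ideals\<close>

lemma module_hom_zero:
  assumes "module R M" "module R N" "h \<in> module_hom R M N"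
  shows "h \<zero>\<^bsub>M\<^esub> = \<zero>\<^bsub>N\<^esub>"
proof -
  interpret M: module R M by fact
  interpret N: module R N by fact
  show ?thesis using module_homD(3)[OF assms(3) M.R.zero_closed M.zero_closed]
      module_homD(1)[OF assms(3) M.zero_closed] by simp
qed

lemma module_hom_minus:
  assumes "module R M" "module R N" "h \<in> module_hom R M N" "x \<in> carrier M" "y \<in> carrier M"
  shows "h (x \<ominus>\<^bsub>M\<^esub> y) = h x \<ominus>\<^bsub>N\<^esub> h y"
proof -
  interpret M: module R M by fact
  interpret N: module R N by fact
  have "x = (x \<ominus>\<^bsub>M\<^esub> y) \<oplus>\<^bsub>M\<^esub> y" using assms(4,5) by (simp add: M.minus_eq M.M.a_assoc M.M.l_neg)
  hence "h x = h (x \<ominus>\<^bsub>M\<^esub> y) \<oplus>\<^bsub>N\<^esub> h y" using module_homD(2)[OF assms(3), of "x \<ominus>\<^bsub>M\<^esub> y" y] assms(4,5) by simp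
  thus ?thesis using module_homD(1)[OF assms(3), of "x \<ominus>\<^bsub>M\<^esub> y"] module_homD(1)[OF assms(3), of y] assms(4,5)
    by (simp add: N.minus_eq N.M.a_assoc N.M.r_neg)
qed

context module
begin

lemma submoduleI':
  assumes "V \<subseteq> carrier M" "\<zero>\<^bsub>M\<^esub> \<in> V" "\<And>a b. a \<in> V \<Longrightarrow> b \<in> V \<Longrightarrow> a \<oplus>\<^bsub>M\<^esub> b \<in> V"
    and smult: "\<And>r x. r \<in> carrier R \<Longrightarrow> x \<in> V \<Longrightarrow> r \<odot>\<^bsub>M\<^esub> x \<in> V"
  shows "submodule V R M"
proof (rule submoduleI)
  show "\<ominus>\<^bsub>M\<^esub> a \<in> V" if "a \<in> V" for a
    using smult[OF _ that, of "\<ominus> \<one>"] that assms(1) by (auto simp: smult_l_minus)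
qed (use assms in auto)

lemma submodule_zero: "submodule V R M \<Longrightarrow> \<zero>\<^bsub>M\<^esub> \<in> V"
  using submoduleE(1,2,4)[of V] smult_l_null by (metis R.zero_closed ex_in_conv subsetD)

lemma submodule_minus: "submodule V R M \<Longrightarrow> x \<in> V \<Longrightarrow> y \<in> V \<Longrightarrow> x \<ominus>\<^bsub>M\<^esub> y \<in> V"
  using submoduleE(3,5)[of V] by (simp add: a_minus_def)

lemma diff_add: "x \<in> carrier M \<Longrightarrow> y \<in> carrier M \<Longrightarrow> (x \<ominus>\<^bsub>M\<^esub> y) \<oplus>\<^bsub>M\<^esub> y = x"
  by (simp add: M.minus_eq M.a_assoc M.l_neg)

lemma diff_zeroD: "x \<ominus>\<^bsub>M\<^esub> y = \<zero>\<^bsub>M\<^esub> \<Longrightarrow> x \<in> carrier M \<Longrightarrow> y \<in> carrier M \<Longrightarrow> x = y"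
  using diff_add[of x y] by simp

lemma smult_diff_left:
  "r \<in> carrier R \<Longrightarrow> s \<in> carrier R \<Longrightarrow> x \<in> carrier M \<Longrightarrow>
    (r \<ominus> s) \<odot>\<^bsub>M\<^esub> x = r \<odot>\<^bsub>M\<^esub> x \<ominus>\<^bsub>M\<^esub> s \<odot>\<^bsub>M\<^esub> x"
  by (simp add: R.minus_eq M.minus_eq smult_l_distr smult_l_minus)

lemma smult_diff_right:
  "r \<in> carrier R \<Longrightarrow> x \<in> carrier M \<Longrightarrow> y \<in> carrier M \<Longrightarrow>
    r \<odot>\<^bsub>M\<^esub> (x \<ominus>\<^bsub>M\<^esub> y) = r \<odot>\<^bsub>M\<^esub> x \<ominus>\<^bsub>M\<^esub> r \<odot>\<^bsub>M\<^esub> y"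
  by (simp add: M.minus_eq smult_r_distr smult_r_minus)

lemma smult_lcomm:
  "r \<in> carrier R \<Longrightarrow> s \<in> carrier R \<Longrightarrow> x \<in> carrier M \<Longrightarrow> r \<odot>\<^bsub>M\<^esub> (s \<odot>\<^bsub>M\<^esub> x) = s \<odot>\<^bsub>M\<^esub> (r \<odot>\<^bsub>M\<^esub> x)"
  by (simp add: smult_assoc1[symmetric] R.m_comm)

lemma diff_self: "x \<in> carrier M \<Longrightarrow> x \<ominus>\<^bsub>M\<^esub> x = \<zero>\<^bsub>M\<^esub>"
  by (simp add: M.minus_eq M.r_neg)

lemma submodule_inter: "submodule V R M \<Longrightarrow> submodule W R M \<Longrightarrow> submodule (V \<inter> W) R M"
  using submoduleE(1,4,5)[of V] submoduleE(4,5)[of W] submodule_zero[of V] submodule_zero[of W]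
  by (intro submoduleI') auto

lemma zero_submodule: "submodule {\<zero>\<^bsub>M\<^esub>} R M"
  by (rule submoduleI') auto

lemma colon_ideal:
  assumes "submodule V R M" "x \<in> carrier M"
  shows "ideal {r \<in> carrier R. r \<odot>\<^bsub>M\<^esub> x \<in> V} R"
proof (rule idealI)
  note V = submoduleE[OF assms(1)] submodule_zero[OF assms(1)]
  show "subgroup {r \<in> carrier R. r \<odot>\<^bsub>M\<^esub> x \<in> V} (add_monoid R)"
  proof (rule R.add.subgroupI)
    show "{r \<in> carrier R. r \<odot>\<^bsub>M\<^esub> x \<in> V} \<noteq> {}" using assms(2) V(7) by (auto intro: exI[of _ \<zero>])
    show "\<ominus> a \<in> {r \<in> carrier R. r \<odot>\<^bsub>M\<^esub> x \<in> V}" if "a \<in> {r \<in> carrier R. r \<odot>\<^bsub>M\<^esub> x \<in> V}" for a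
      using that assms(2) V(3) by (auto simp: smult_l_minus)
    show "a \<oplus> b \<in> {r \<in> carrier R. r \<odot>\<^bsub>M\<^esub> x \<in> V}"
      if "a \<in> {r \<in> carrier R. r \<odot>\<^bsub>M\<^esub> x \<in> V}" "b \<in> {r \<in> carrier R. r \<odot>\<^bsub>M\<^esub> x \<in> V}" for a b
      using that assms(2) V(5) by (auto simp: smult_l_distr)
  qed auto
  fix a r assume "a \<in> {r \<in> carrier R. r \<odot>\<^bsub>M\<^esub> x \<in> V}" "r \<in> carrier R"
  thus "r \<otimes> a \<in> {r \<in> carrier R. r \<odot>\<^bsub>M\<^esub> x \<in> V}"
    using V(4) assms(2) by (auto simp: smult_assoc1)
  moreover have "a \<otimes> r = r \<otimes> a" using \<open>a \<in> _\<close> \<open>r \<in> carrier R\<close> by (simp add: R.m_comm)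
  ultimately show "a \<otimes> r \<in> {r \<in> carrier R. r \<odot>\<^bsub>M\<^esub> x \<in> V}" by simp
qed (rule R.ring_axioms)

lemma cyclic_submodule:
  assumes "x \<in> carrier M"
  shows "submodule ((\<lambda>r. r \<odot>\<^bsub>M\<^esub> x) ` carrier R) R M"
proof (rule submoduleI')
  show "\<zero>\<^bsub>M\<^esub> \<in> (\<lambda>r. r \<odot>\<^bsub>M\<^esub> x) ` carrier R" using assms by (auto intro: image_eqI[of _ _ \<zero>])
  show "a \<oplus>\<^bsub>M\<^esub> b \<in> (\<lambda>r. r \<odot>\<^bsub>M\<^esub> x) ` carrier R"
    if "a \<in> (\<lambda>r. r \<odot>\<^bsub>M\<^esub> x) ` carrier R" "b \<in> (\<lambda>r. r \<odot>\<^bsub>M\<^esub> x) ` carrier R" for a b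
    using that assms by (auto simp: smult_l_distr[symmetric])
  show "s \<odot>\<^bsub>M\<^esub> a \<in> (\<lambda>r. r \<odot>\<^bsub>M\<^esub> x) ` carrier R"
    if "s \<in> carrier R" "a \<in> (\<lambda>r. r \<odot>\<^bsub>M\<^esub> x) ` carrier R" for a s
    using that assms by (auto simp: smult_assoc1[symmetric])
qed (use assms in auto)

lemma scalar_hom: "r \<in> carrier R \<Longrightarrow> (\<lambda>x. r \<odot>\<^bsub>M\<^esub> x) \<in> module_hom R M M"
  by (auto simp: module_hom_def smult_r_distr smult_assoc1[symmetric] R.m_comm)

lemma divisible_submodule_iff:
  assumes V: "submodule V R M"
  shows "divisible R (M\<lparr>carrier := V\<rparr>) \<longleftrightarrow> (\<forall>s\<in>nonzerodivisors R. V \<subseteq> (\<lambda>x. s \<odot>\<^bsub>M\<^esub> x) ` V)"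
  using submoduleE(4)[OF V] R.nonzerodivisors_carrier unfolding divisible_def by fastforce

lemma kernel_submodule:
  assumes N: "module R N" and h: "h \<in> module_hom R M N"
  shows "submodule {x \<in> carrier M. h x = \<zero>\<^bsub>N\<^esub>} R M"
proof -
  interpret N: module R N by fact
  show ?thesis using module_homD[OF h] module_hom_zero[OF module_axioms N h]
    by (intro submoduleI') auto
qed

lemma image_submodule:
  assumes N: "module R N" and h: "h \<in> module_hom R N M" and V: "submodule V R N"
  shows "submodule (h ` V) R M"
proof -
  interpret N: module R N by fact
  note * = N.submoduleE[OF V] N.submodule_zero[OF V] module_homD[OF h]
  show ?thesis
  proof (rule submoduleI')
    show "h ` V \<subseteq> carrier M" using * by auto
    show "\<zero>\<^bsub>M\<^esub> \<in> h ` V" using * module_hom_zero[OF N module_axioms h] by (metis image_eqI)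
    show "a \<oplus>\<^bsub>M\<^esub> b \<in> h ` V" if "a \<in> h ` V" "b \<in> h ` V" for a b
    proof -
      from that obtain u v where "u \<in> V" "v \<in> V" "a = h u" "b = h v" by blast
      thus ?thesis using *(5) *(9)[OF subsetD subsetD, OF *(1) _ *(1)]
        by (intro image_eqI[of _ _ "u \<oplus>\<^bsub>N\<^esub> v"]) simp_all
    qed
    show "r \<odot>\<^bsub>M\<^esub> a \<in> h ` V" if "r \<in> carrier R" "a \<in> h ` V" for a r
    proof -
      from that obtain u where "u \<in> V" "a = h u" by blast
      thus ?thesis using *(4)[OF that(1)] *(10)[OF that(1) subsetD, OF *(1)]
        by (intro image_eqI[of _ _ "r \<odot>\<^bsub>N\<^esub> u"]) simp_all
    qed
  qed
qed

end

definition regular_module :: "('a, 'r) ring_scheme \<Rightarrow> ('a, 'a) module"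
  where "regular_module R = \<lparr>carrier = carrier R, monoid.mult = monoid.mult R, monoid.one = \<one>\<^bsub>R\<^esub>,
    ring.zero = \<zero>\<^bsub>R\<^esub>, ring.add = ring.add R, smult = monoid.mult R\<rparr>"

lemma regular_module_sel [simp]:
  "carrier (regular_module R) = carrier R" "\<zero>\<^bsub>regular_module R\<^esub> = \<zero>\<^bsub>R\<^esub>"
  "ring.add (regular_module R) = ring.add R" "smult (regular_module R) = monoid.mult R"
  by (simp_all add: regular_module_def)

lemma (in cring) regular_module: "module R (regular_module R)"
proof (intro moduleI abelian_groupI)
  show "\<exists>y\<in>carrier (regular_module R). y \<oplus>\<^bsub>regular_module R\<^esub> u = \<zero>\<^bsub>regular_module R\<^esub>"
    if "u \<in> carrier (regular_module R)" for u
    using that l_neg by auto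
qed (auto simp: l_distr r_distr m_assoc a_ac is_cring)

lemma (in cring) ideal_submodule:
  assumes "ideal I R" shows "submodule I R (regular_module R)"
proof -
  interpret I: ideal I R by fact
  interpret M: module R "regular_module R" by (rule regular_module)
  show ?thesis using I.I_l_closed I.a_subset by (intro M.submoduleI') auto
qed

lemma (in noetherian_ring) maximal_ideal_in_family:
  assumes "\<F> \<noteq> {}" "\<And>I. I \<in> \<F> \<Longrightarrow> ideal I R"
  obtains I where "I \<in> \<F>" "\<And>J. J \<in> \<F> \<Longrightarrow> I \<subseteq> J \<Longrightarrow> J = I"
proof -
  have "\<Union>C \<in> \<F>" if "C \<noteq> {}" "subset.chain \<F> C" for C
  proof -
    have "subset.chain {I. ideal I R} C" using that(2) assms(2) unfolding subset_chain_def by blast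
    from ideal_chain_is_trivial[OF that(1) this] show ?thesis
      using that(2) unfolding subset_chain_def by blast
  qed
  from subset_Zorn_nonempty[OF assms(1) this]
  obtain I where "I \<in> \<F>" "\<forall>J\<in>\<F>. I \<subseteq> J \<longrightarrow> J = I" by blast
  thus thesis using that[of I] by blast
qed

section \<open>Descending chains of submodules\<close>

context module
begin

definition dcc :: "'c set \<Rightarrow> bool"
  where "dcc V \<longleftrightarrow> (\<forall>W::nat \<Rightarrow> 'c set.
    (\<forall>n. submodule (W n) R M \<and> W n \<subseteq> V \<and> W (Suc n) \<subseteq> W n) \<longrightarrow> (\<exists>N. \<forall>n\<ge>N. W n = W N))"

lemma dccD:
  assumes "dcc V" "\<And>n. submodule (W n) R M" "\<And>n. W n \<subseteq> V" "\<And>n. W (Suc n) \<subseteq> W n"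
  obtains N :: nat where "\<And>n. n \<ge> N \<Longrightarrow> W n = W N"
proof -
  have "\<exists>N. \<forall>n\<ge>N. W n = W N" using assms unfolding dcc_def by blast
  thus thesis using that by blast
qed

lemma dcc_minimal:
  assumes "dcc V" "\<F> \<noteq> {}" "\<And>W. W \<in> \<F> \<Longrightarrow> submodule W R M \<and> W \<subseteq> V"
  obtains W where "W \<in> \<F>" "\<And>U. U \<in> \<F> \<Longrightarrow> U \<subseteq> W \<Longrightarrow> U = W"
proof (rule ccontr)
  assume "\<not> thesis"
  hence *: "\<exists>U\<in>\<F>. U \<subset> W" if "W \<in> \<F>" for W using \<open>W \<in> \<F>\<close> \<open>\<And>W. \<lbrakk>W \<in> \<F>; \<And>U. \<lbrakk>U \<in> \<F>; U \<subseteq> W\<rbrakk> \<Longrightarrow> U = W\<rbrakk> \<Longrightarrow> thesis\<close> by blast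
  have "\<exists>f. \<forall>n. f n \<in> \<F> \<and> f (Suc n) \<subset> f n"
    using assms(2) * by (intro dependent_nat_choice) auto
  then obtain f :: "nat \<Rightarrow> 'c set" where f: "\<And>n. f n \<in> \<F>" "\<And>n. f (Suc n) \<subset> f n" by blast
  obtain N where N: "\<And>n. n \<ge> N \<Longrightarrow> f n = f N"
    using dccD[OF assms(1), of f] assms(3)[OF f(1)] f(2) by blast
  have "f (Suc N) = f N" by (rule N) simp
  thus False using f(2)[of N] by blast
qed

text \<open>
  The layers \<open>x\<^sup>n (W \<inter> ker x\<^sup>n\<^sup>+\<^sup>1)\<close> of a submodule \<open>W\<close> all lie in the kernel of \<open>x\<close>, decrease in \<open>n\<close> and
  in \<open>W\<close>, and determine \<open>W\<close> inside a larger submodule because \<open>V\<close> is \<open>x\<close>-torsion.  So for a descending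
  chain it suffices that the doubly indexed family of layers stabilizes simultaneously in all rows.
\<close>

lemma dcc_of_kernel:
  assumes V: "submodule V R M" and x: "x \<in> carrier R"
    and tors: "\<And>v. v \<in> V \<Longrightarrow> \<exists>n::nat. (x [^] n) \<odot>\<^bsub>M\<^esub> v = \<zero>\<^bsub>M\<^esub>"
    and ker: "dcc {v \<in> V. x \<odot>\<^bsub>M\<^esub> v = \<zero>\<^bsub>M\<^esub>}"
  shows "dcc V"
  unfolding dcc_def
proof (intro allI impI)
  fix W :: "nat \<Rightarrow> 'c set"
  assume "\<forall>n. submodule (W n) R M \<and> W n \<subseteq> V \<and> W (Suc n) \<subseteq> W n"
  hence W: "\<And>n. submodule (W n) R M" "\<And>n. W n \<subseteq> V" "\<And>n. W (Suc n) \<subseteq> W n" by auto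
  have Wanti: "W j \<subseteq> W i" if "i \<le> j" for i j using lift_Suc_antimono_le[of W, OF W(3) that] .
  have Vc: "v \<in> carrier M" if "v \<in> V" for v using submoduleE(1)[OF V] that by blast
  have Wc: "v \<in> carrier M" if "v \<in> W i" for v i using W(2) Vc that by blast
  have xn: "(x [^] Suc n) \<odot>\<^bsub>M\<^esub> v = x \<odot>\<^bsub>M\<^esub> ((x [^] n) \<odot>\<^bsub>M\<^esub> v)"
    "(x [^] Suc n) \<odot>\<^bsub>M\<^esub> v = (x [^] n) \<odot>\<^bsub>M\<^esub> (x \<odot>\<^bsub>M\<^esub> v)" if "v \<in> carrier M" for n :: nat and v
    using that x by (simp_all add: smult_assoc1[symmetric] R.m_comm)
  define F where "F n i = (\<lambda>v. (x [^] n) \<odot>\<^bsub>M\<^esub> v) ` (W i \<inter> {v \<in> carrier M. (x [^] Suc n) \<odot>\<^bsub>M\<^esub> v = \<zero>\<^bsub>M\<^esub>})" for n i :: nat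
  have FI: "(x [^] n) \<odot>\<^bsub>M\<^esub> v \<in> F n i" if "v \<in> W i" "(x [^] Suc n) \<odot>\<^bsub>M\<^esub> v = \<zero>\<^bsub>M\<^esub>" for n i v
    using that Wc unfolding F_def by blast
  have FE: "\<exists>v\<in>W i. (x [^] Suc n) \<odot>\<^bsub>M\<^esub> v = \<zero>\<^bsub>M\<^esub> \<and> u = (x [^] n) \<odot>\<^bsub>M\<^esub> v" if "u \<in> F n i" for u n i
    using that unfolding F_def by blast
  have Fsub: "submodule (F n i) R M" for n i
    unfolding F_def using x
    by (intro image_submodule[OF module_axioms] scalar_hom submodule_inter W(1) kernel_submodule[OF module_axioms])
      (auto simp del: R.nat_pow_Suc)
  have Fker: "F n i \<subseteq> {v \<in> V. x \<odot>\<^bsub>M\<^esub> v = \<zero>\<^bsub>M\<^esub>}" for n i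
  proof
    fix u assume "u \<in> F n i"
    then obtain v where v: "v \<in> W i" "(x [^] Suc n) \<odot>\<^bsub>M\<^esub> v = \<zero>\<^bsub>M\<^esub>" "u = (x [^] n) \<odot>\<^bsub>M\<^esub> v" using FE by blast
    have "u \<in> V" using submoduleE(4)[OF V] v W(2) x by blast
    thus "u \<in> {v \<in> V. x \<odot>\<^bsub>M\<^esub> v = \<zero>\<^bsub>M\<^esub>}" using v xn(1)[OF Wc[OF v(1)], of n] by simp
  qed
  have F1: "F (Suc n) i \<subseteq> F n i" for n i
  proof
    fix u assume "u \<in> F (Suc n) i"
    then obtain v where v: "v \<in> W i" "(x [^] Suc (Suc n)) \<odot>\<^bsub>M\<^esub> v = \<zero>\<^bsub>M\<^esub>" "u = (x [^] Suc n) \<odot>\<^bsub>M\<^esub> v" using FE by blast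
    show "u \<in> F n i"
      using FI[of "x \<odot>\<^bsub>M\<^esub> v" i n] submoduleE(4)[OF W(1) x v(1)] v(2,3)
      unfolding xn(2)[OF Wc[OF v(1)]] by metis
  qed
  have F2: "F n (Suc i) \<subseteq> F n i" for n i unfolding F_def using W(3)[of i] by blast
  have Fanti: "F n' i' \<subseteq> F n i" if "n \<le> n'" "i \<le> i'" for n n' i i'
    using lift_Suc_antimono_le[of "\<lambda>n. F n i'", OF F1 that(1)] lift_Suc_antimono_le[of "F n", OF F2 that(2)] by blast
  \<comment> \<open>the diagonal controls all large indices, and finitely many rows remain\<close>
  obtain N where N: "\<And>n. n \<ge> N \<Longrightarrow> F n n = F N N"
    using dccD[OF ker, of "\<lambda>n. F n n"] Fsub Fker Fanti[of n "Suc n" n "Suc n" for n] by auto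
  have "\<exists>N'. \<forall>i\<ge>N'. F n i = F n N'" for n
    using dccD[OF ker, of "F n"] Fsub Fker F2 by metis
  then obtain N' where N': "\<And>n i. i \<ge> N' n \<Longrightarrow> F n i = F n (N' n)" by metis
  define L where "L = Max (insert N (N' ` {..<N}))"
  have L: "N \<le> L" "n < N \<Longrightarrow> N' n \<le> L" for n unfolding L_def by (auto intro!: Max_ge)
  have stable: "F n i = F n L" if "i \<ge> L" for n i
  proof (cases "n < N")
    case True
    thus ?thesis using N'[of n i] N'[of n L] L(2) that by (metis order_trans order_refl)
  next
    case False
    have "F n j = F N N" if "j \<ge> N" for j
    proof -
      have "F (max n j) (max n j) \<subseteq> F n j" "F n j \<subseteq> F N N" using Fanti False that by auto
      thus ?thesis using N[of "max n j"] that by auto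
    qed
    thus ?thesis using that L(1) by auto
  qed
  have "W i = W L" if "i \<ge> L" for i
  proof
    show "W i \<subseteq> W L" using Wanti that .
    have "\<forall>v\<in>W L. (x [^] k) \<odot>\<^bsub>M\<^esub> v = \<zero>\<^bsub>M\<^esub> \<longrightarrow> v \<in> W i" for k :: nat
    proof (induction k)
      case 0
      thus ?case using Wc submodule_zero[OF W(1)] by auto
    next
      case (Suc k)
      show ?case
      proof (intro ballI impI)
        fix v assume v: "v \<in> W L" "(x [^] Suc k) \<odot>\<^bsub>M\<^esub> v = \<zero>\<^bsub>M\<^esub>"
        have "(x [^] k) \<odot>\<^bsub>M\<^esub> v \<in> F k i" using FI[OF v] stable[OF that] by simp
        then obtain v' where v': "v' \<in> W i" "(x [^] k) \<odot>\<^bsub>M\<^esub> v = (x [^] k) \<odot>\<^bsub>M\<^esub> v'" using FE by blast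
        note c = Wc[OF v(1)] Wc[OF v'(1)]
        have "(x [^] k) \<odot>\<^bsub>M\<^esub> (v \<ominus>\<^bsub>M\<^esub> v') = \<zero>\<^bsub>M\<^esub>" using c x v'(2) by (simp add: smult_diff_right diff_self)
        moreover have "v \<ominus>\<^bsub>M\<^esub> v' \<in> W L" using submodule_minus[OF W(1)] v v' Wanti[OF that] by blast
        ultimately have "(v \<ominus>\<^bsub>M\<^esub> v') \<oplus>\<^bsub>M\<^esub> v' \<in> W i" using Suc submoduleE(5)[OF W(1)] v'(1) by blast
        thus "v \<in> W i" using diff_add[OF c] by simp
      qed
    qed
    thus "W L \<subseteq> W i" using tors W(2) by blast
  qed
  thus "\<exists>N. \<forall>n\<ge>N. W n = W N" by blast
qed

end

section \<open>Injective modules with an essential simple socle\<close>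

text \<open>
  The injective hull of the residue field enters the argument only through these properties of
  the image \<open>e\<close> of the unit class, see \<open>socle_injective_hull\<close>.
\<close>

locale socle_injective = module R E + noetherian_ring R
  for R :: "('a, 'r) ring_scheme" (structure) and E :: "('a, 'e, 'm) module_scheme" (structure) +
  fixes \<mm> :: "'a set" and e :: 'e
  assumes local: "local_ring R \<mm>"
    and injective: "injective_module R E"
    and e_closed: "e \<in> carrier E" and e_nonzero: "e \<noteq> \<zero>\<^bsub>E\<^esub>"
    and e_socle: "r \<in> \<mm> \<Longrightarrow> r \<odot>\<^bsub>E\<^esub> e = \<zero>\<^bsub>E\<^esub>"
    and e_essential: "submodule V R E \<Longrightarrow> V \<noteq> {\<zero>\<^bsub>E\<^esub>} \<Longrightarrow> e \<in> V"
begin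

lemma \<mm>_maximal: "maximalideal \<mm> R" and \<mm>_unique: "maximalideal J R \<Longrightarrow> J = \<mm>"
  using local unfolding local_ring_def by auto

sublocale \<mm>: maximalideal \<mm> R by (rule \<mm>_maximal)

lemma proper_ideal_le:
  assumes "ideal I R" "\<one> \<notin> I" shows "I \<subseteq> \<mm>"
proof -
  obtain J where J: "J \<in> {J. ideal J R \<and> I \<subseteq> J \<and> \<one> \<notin> J}"
    and maxi: "\<And>J'. J' \<in> {J. ideal J R \<and> I \<subseteq> J \<and> \<one> \<notin> J} \<Longrightarrow> J \<subseteq> J' \<Longrightarrow> J' = J"
    using maximal_ideal_in_family[of "{J. ideal J R \<and> I \<subseteq> J \<and> \<one> \<notin> J}"] assms by blast
  have "maximalideal J R"
  proof (rule maximalidealI)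
    show "ideal J R" "carrier R \<noteq> J" using J by auto
    show "J' = J \<or> J' = carrier R" if "ideal J' R" "J \<subseteq> J'" for J'
      using that maxi[of J'] J ideal.one_imp_carrier[of J' R] by auto
  qed
  thus ?thesis using \<mm>_unique J by blast
qed

lemma unit_outside:
  assumes "r \<in> carrier R" "r \<notin> \<mm>"
  obtains r' where "r' \<in> carrier R" "r' \<otimes> r = \<one>"
proof -
  have "\<one> \<in> PIdl r" using proper_ideal_le[OF cgenideal_ideal[OF assms(1)]] cgenideal_self[OF assms(1)] assms(2) by blast
  then obtain r0 where "r0 \<in> carrier R" "\<one> = r0 \<otimes> r" unfolding cgenideal_def by blast
  thus thesis by (intro that[of r0]) simp_all
qed

lemma e_multiple:
  assumes r: "r \<in> carrier R" and "r \<odot>\<^bsub>E\<^esub> e \<noteq> \<zero>\<^bsub>E\<^esub>"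
  obtains r' where "r' \<in> carrier R" "r' \<otimes> r = \<one>"
proof -
  have "r \<notin> \<mm>" using e_socle assms(2) by auto
  from unit_outside[OF r this] show thesis using that by blast
qed

lemma hom_extend:
  assumes N: "module R N" and V: "submodule V R N" and h: "h \<in> module_hom R (N\<lparr>carrier := V\<rparr>) E"
  obtains g where "g \<in> module_hom R N E" "\<And>x. x \<in> V \<Longrightarrow> g x = h x"
proof -
  interpret N: module R N by fact
  have "id \<in> module_hom R (N\<lparr>carrier := V\<rparr>) N"
    using N.submoduleE[OF V] by (auto simp: module_hom_def)
  hence "\<exists>g\<in>module_hom R N E. \<forall>x\<in>carrier (N\<lparr>carrier := V\<rparr>). g (id x) = h x"
    using injective_module_extend[OF injective submodule.submodule_is_module[OF V N] N _ inj_on_id h] by blast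
  thus thesis using that by auto
qed

text \<open>
  \<open>E\<close> is a cogenerator: \<open>v + r x \<mapsto> r e\<close> is a well-defined homomorphism on \<open>V + R x\<close>, which extends
  to \<open>N\<close> by injectivity.
\<close>

lemma separating_hom:
  assumes N: "module R N" and V: "submodule V R N" and x: "x \<in> carrier N" "x \<notin> V"
  obtains h where "h \<in> module_hom R N E" "\<And>v. v \<in> V \<Longrightarrow> h v = \<zero>\<^bsub>E\<^esub>" "h x = e"
proof -
  interpret N: module R N by fact
  note V' = N.submoduleE[OF V] N.submodule_zero[OF V]
  define W where "W = {v \<oplus>\<^bsub>N\<^esub> r \<odot>\<^bsub>N\<^esub> x |v r. v \<in> V \<and> r \<in> carrier R}"
  have WI: "v \<oplus>\<^bsub>N\<^esub> r \<odot>\<^bsub>N\<^esub> x \<in> W" if "v \<in> V" "r \<in> carrier R" for v r using that W_def by blast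
  have Vc: "v \<in> carrier N" if "v \<in> V" for v using that V'(1) by blast
  have add: "(v \<oplus>\<^bsub>N\<^esub> r \<odot>\<^bsub>N\<^esub> x) \<oplus>\<^bsub>N\<^esub> (v' \<oplus>\<^bsub>N\<^esub> r' \<odot>\<^bsub>N\<^esub> x) = (v \<oplus>\<^bsub>N\<^esub> v') \<oplus>\<^bsub>N\<^esub> (r \<oplus> r') \<odot>\<^bsub>N\<^esub> x"
    if "v \<in> V" "v' \<in> V" "r \<in> carrier R" "r' \<in> carrier R" for v v' r r'
    using that x Vc by (simp add: N.smult_l_distr N.M.a_ac)
  have smul: "s \<odot>\<^bsub>N\<^esub> (v \<oplus>\<^bsub>N\<^esub> r \<odot>\<^bsub>N\<^esub> x) = s \<odot>\<^bsub>N\<^esub> v \<oplus>\<^bsub>N\<^esub> (s \<otimes> r) \<odot>\<^bsub>N\<^esub> x"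
    if "v \<in> V" "r \<in> carrier R" "s \<in> carrier R" for v r s
    using that x Vc by (simp add: N.smult_r_distr N.smult_assoc1)
  have W: "submodule W R N"
  proof (rule N.submoduleI')
    show "W \<subseteq> carrier N" using x Vc by (auto simp: W_def)
    show "\<zero>\<^bsub>N\<^esub> \<in> W" using WI[OF V'(7), of \<zero>] x by simp
    show "a \<oplus>\<^bsub>N\<^esub> b \<in> W" if "a \<in> W" "b \<in> W" for a b
      using that add V'(5) unfolding W_def by (smt (verit, best) R.a_closed mem_Collect_eq)
    show "s \<odot>\<^bsub>N\<^esub> a \<in> W" if "s \<in> carrier R" "a \<in> W" for s a
      using that smul V'(4) unfolding W_def by (smt (verit, best) R.m_closed mem_Collect_eq)
  qed
  define g where "g w = (SOME y. \<exists>v\<in>V. \<exists>r\<in>carrier R. w = v \<oplus>\<^bsub>N\<^esub> r \<odot>\<^bsub>N\<^esub> x \<and> y = r \<odot>\<^bsub>E\<^esub> e)" for w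
  \<comment> \<open>the scalars moving \<open>x\<close> into \<open>V\<close> form a proper ideal, hence kill \<open>e\<close>\<close>
  have kill: "r \<odot>\<^bsub>E\<^esub> e = \<zero>\<^bsub>E\<^esub>" if "r \<in> carrier R" "r \<odot>\<^bsub>N\<^esub> x \<in> V" for r
    using proper_ideal_le[OF N.colon_ideal[OF V x(1)]] that x e_socle by auto
  have g: "g (v \<oplus>\<^bsub>N\<^esub> r \<odot>\<^bsub>N\<^esub> x) = r \<odot>\<^bsub>E\<^esub> e" if vr: "v \<in> V" "r \<in> carrier R" for v r
    unfolding g_def
  proof (rule some_equality)
    show "\<exists>v'\<in>V. \<exists>r'\<in>carrier R. v \<oplus>\<^bsub>N\<^esub> r \<odot>\<^bsub>N\<^esub> x = v' \<oplus>\<^bsub>N\<^esub> r' \<odot>\<^bsub>N\<^esub> x \<and> r \<odot>\<^bsub>E\<^esub> e = r' \<odot>\<^bsub>E\<^esub> e"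
      using vr by blast
    fix y assume "\<exists>v'\<in>V. \<exists>r'\<in>carrier R. v \<oplus>\<^bsub>N\<^esub> r \<odot>\<^bsub>N\<^esub> x = v' \<oplus>\<^bsub>N\<^esub> r' \<odot>\<^bsub>N\<^esub> x \<and> y = r' \<odot>\<^bsub>E\<^esub> e"
    then obtain v' r' where 1: "v' \<in> V" "r' \<in> carrier R" "v \<oplus>\<^bsub>N\<^esub> r \<odot>\<^bsub>N\<^esub> x = v' \<oplus>\<^bsub>N\<^esub> r' \<odot>\<^bsub>N\<^esub> x" "y = r' \<odot>\<^bsub>E\<^esub> e" by blast
    define p q where "p = r \<odot>\<^bsub>N\<^esub> x" and "q = r' \<odot>\<^bsub>N\<^esub> x"
    have pq: "p \<in> carrier N" "q \<in> carrier N" using vr 1 x by (auto simp: p_def q_def)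
    have "(r' \<ominus> r) \<odot>\<^bsub>N\<^esub> x = q \<ominus>\<^bsub>N\<^esub> p"
      using vr 1 x by (simp add: N.smult_diff_left p_def q_def)
    also have "\<dots> = v \<ominus>\<^bsub>N\<^esub> v'"
    proof -
      have "q = \<ominus>\<^bsub>N\<^esub> v' \<oplus>\<^bsub>N\<^esub> (v' \<oplus>\<^bsub>N\<^esub> q)" using pq Vc[OF 1(1)] by (simp add: N.M.a_assoc[symmetric] N.M.l_neg)
      also have "v' \<oplus>\<^bsub>N\<^esub> q = v \<oplus>\<^bsub>N\<^esub> p" using 1(3) by (simp add: p_def q_def)
      finally have "q = \<ominus>\<^bsub>N\<^esub> v' \<oplus>\<^bsub>N\<^esub> (v \<oplus>\<^bsub>N\<^esub> p)" .
      hence "q = (v \<ominus>\<^bsub>N\<^esub> v') \<oplus>\<^bsub>N\<^esub> p"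
        using pq Vc[OF 1(1)] Vc[OF vr(1)] by (simp add: N.minus_eq N.M.a_ac)
      thus ?thesis using pq Vc[OF 1(1)] Vc[OF vr(1)] by (simp add: N.minus_eq N.M.a_assoc N.M.r_neg)
    qed
    also have "\<dots> \<in> V" by (rule N.submodule_minus[OF V vr(1) 1(1)])
    finally have "(r' \<ominus> r) \<odot>\<^bsub>E\<^esub> e = \<zero>\<^bsub>E\<^esub>" using kill vr 1 by simp
    hence "r' \<odot>\<^bsub>E\<^esub> e \<ominus>\<^bsub>E\<^esub> r \<odot>\<^bsub>E\<^esub> e = \<zero>\<^bsub>E\<^esub>" using vr 1(2) e_closed
      by (simp add: smult_diff_left)
    thus "y = r \<odot>\<^bsub>E\<^esub> e" using vr 1(2,4) e_closed diff_zeroD by simp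
  qed
  have "g \<in> module_hom R (N\<lparr>carrier := W\<rparr>) E"
    unfolding module_hom_def
  proof (intro CollectI conjI ballI funcsetI)
    fix a assume "a \<in> carrier (N\<lparr>carrier := W\<rparr>)"
    then obtain v r where a: "v \<in> V" "r \<in> carrier R" "a = v \<oplus>\<^bsub>N\<^esub> r \<odot>\<^bsub>N\<^esub> x" by (auto simp: W_def)
    show "g a \<in> carrier E" using a g e_closed by simp
    show "g (s \<odot>\<^bsub>N\<lparr>carrier := W\<rparr>\<^esub> a) = s \<odot>\<^bsub>E\<^esub> g a" if "s \<in> carrier R" for s
      using a that g e_closed smul V'(4) by (simp add: smult_assoc1)
    fix b assume "b \<in> carrier (N\<lparr>carrier := W\<rparr>)"
    then obtain v' r' where b: "v' \<in> V" "r' \<in> carrier R" "b = v' \<oplus>\<^bsub>N\<^esub> r' \<odot>\<^bsub>N\<^esub> x" by (auto simp: W_def)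
    show "g (a \<oplus>\<^bsub>N\<lparr>carrier := W\<rparr>\<^esub> b) = g a \<oplus>\<^bsub>E\<^esub> g b"
      using a b g e_closed add V'(5) by (simp add: smult_l_distr)
  qed
  then obtain h where h: "h \<in> module_hom R N E" "\<And>w. w \<in> W \<Longrightarrow> h w = g w"
    using hom_extend[OF N W] by blast
  have "h v = \<zero>\<^bsub>E\<^esub>" if "v \<in> V" for v
    using h(2)[OF WI[OF that R.zero_closed]] g[OF that R.zero_closed] Vc[OF that] x e_closed by simp
  moreover have "h x = e" using h(2)[OF WI[OF V'(7) R.one_closed]] g[OF V'(7) R.one_closed] x e_closed by simp
  ultimately show thesis using that h(1) by blast
qed

text \<open>
  Extend \<open>r \<mapsto> r x\<close> along the injection \<open>r \<mapsto> s r\<close> of \<open>R\<close> into itself; the value of the extension at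
  \<open>1\<close> is the required quotient of \<open>x\<close> by \<open>s\<close>.
\<close>

lemma divisible_E: "divisible R E"
  unfolding divisible_def
proof (intro ballI equalityI subsetI)
  fix s x assume s: "s \<in> nonzerodivisors R" and x: "x \<in> carrier E"
  note sc = nonzerodivisors_carrier[OF s]
  interpret M: module R "regular_module R" by (rule regular_module)
  have "(\<lambda>r. s \<otimes> r) \<in> module_hom R (regular_module R) (regular_module R)"
    using M.scalar_hom[OF sc] by simp
  moreover have "inj_on (\<lambda>r. s \<otimes> r) (carrier (regular_module R))"
    using nonzerodivisors_cancel[OF s] by (auto simp: inj_on_def)
  moreover have "(\<lambda>r. r \<odot>\<^bsub>E\<^esub> x) \<in> module_hom R (regular_module R) E"
    using x by (auto simp: module_hom_def smult_l_distr smult_assoc1)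
  ultimately obtain h where h: "h \<in> module_hom R (regular_module R) E"
    "\<And>r. r \<in> carrier R \<Longrightarrow> h (s \<otimes> r) = r \<odot>\<^bsub>E\<^esub> x"
    using injective_module_extend[OF injective regular_module regular_module] by fastforce
  have "s \<odot>\<^bsub>E\<^esub> h \<one> = x"
    using module_homD(3)[OF h(1) sc, of \<one>] h(2)[of \<one>] sc x by simp
  thus "x \<in> (\<lambda>x. s \<odot>\<^bsub>E\<^esub> x) ` carrier E" using module_homD(1)[OF h(1), of \<one>] by auto
qed (auto dest: nonzerodivisors_carrier)


section \<open>Torsion and the descending chain condition\<close>

abbreviation pow :: "nat \<Rightarrow> 'a set" where "pow \<equiv> ideal_pow R \<mm>"

definition ann :: "'a set \<Rightarrow> 'e set"
  where "ann J = {x \<in> carrier E. \<forall>r\<in>J. r \<odot>\<^bsub>E\<^esub> x = \<zero>\<^bsub>E\<^esub>}"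

lemma pow_ideal: "ideal (pow n) R"
  by (rule ideal_pow_ideal[OF ring_axioms \<mm>.ideal_axioms])

lemma pow_0: "pow 0 = carrier R" and pow_Suc: "pow (Suc n) = pow n \<cdot> \<mm>"
  by (simp_all add: ideals_set_def)

lemma pow_antimono: "i \<le> j \<Longrightarrow> pow j \<subseteq> pow i"
  by (rule ideal_pow_antimono[OF ring_axioms \<mm>.ideal_axioms])

lemma ann_submodule: "J \<subseteq> carrier R \<Longrightarrow> submodule (ann J) R E"
proof (rule submoduleI')
  fix r x assume "J \<subseteq> carrier R" "r \<in> carrier R" "x \<in> ann J"
  thus "r \<odot>\<^bsub>E\<^esub> x \<in> ann J" using smult_lcomm[of _ r x] by (auto simp: ann_def subset_iff)
qed (auto simp: ann_def subset_iff smult_r_distr)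

lemma ann_carrier: "x \<in> ann J \<Longrightarrow> x \<in> carrier E" by (simp add: ann_def)

lemma ann_kill: "x \<in> ann J \<Longrightarrow> r \<in> J \<Longrightarrow> r \<odot>\<^bsub>E\<^esub> x = \<zero>\<^bsub>E\<^esub>" by (simp add: ann_def)

lemma ann_mono: "i \<le> j \<Longrightarrow> x \<in> ann (pow i) \<Longrightarrow> x \<in> ann (pow j)"
  using pow_antimono by (auto simp: ann_def)

lemma ann_pow_submodule: "submodule (ann (pow n)) R E"
  by (rule ann_submodule) (rule additive_subgroup.a_subset[OF ideal.axioms(1)[OF pow_ideal]])

lemma ann_pow_Suc:
  assumes x: "x \<in> carrier E" and *: "\<And>y. y \<in> \<mm> \<Longrightarrow> y \<odot>\<^bsub>E\<^esub> x \<in> ann (pow n)"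
  shows "x \<in> ann (pow (Suc n))"
proof -
  interpret I: ideal "pow n" R by (rule pow_ideal)
  have "r \<in> carrier R \<and> r \<odot>\<^bsub>E\<^esub> x = \<zero>\<^bsub>E\<^esub>" if "r \<in> pow n \<cdot> \<mm>" for r
    using that
  proof induction
    case (prod i j)
    thus ?case using x *[OF prod(2)] I.Icarr \<mm>.Icarr by (simp add: smult_assoc1 ann_kill)
  next
    case (sum s t)
    thus ?case using x by (simp add: smult_l_distr)
  qed
  thus ?thesis using x unfolding pow_Suc ann_def by blast
qed

lemma socle_cyclic:
  assumes x: "x \<in> carrier E" and kill: "\<And>y. y \<in> \<mm> \<Longrightarrow> y \<odot>\<^bsub>E\<^esub> x = \<zero>\<^bsub>E\<^esub>"
  obtains c where "c \<in> carrier R" "x = c \<odot>\<^bsub>E\<^esub> e"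
proof (cases "x = \<zero>\<^bsub>E\<^esub>")
  case True
  thus thesis using that[of \<zero>] e_closed by simp
next
  case False
  hence "(\<lambda>r. r \<odot>\<^bsub>E\<^esub> x) ` carrier R \<noteq> {\<zero>\<^bsub>E\<^esub>}" using smult_one[OF x] R.one_closed by (metis image_eqI singletonD)
  from e_essential[OF cyclic_submodule[OF x] this] obtain r where r: "r \<in> carrier R" "e = r \<odot>\<^bsub>E\<^esub> x" by blast
  hence "r \<notin> \<mm>" using kill e_nonzero by auto
  then obtain c where c: "c \<in> carrier R" "c \<otimes> r = \<one>" using unit_outside[OF r(1)] by blast
  have "c \<odot>\<^bsub>E\<^esub> e = x" using c r x by (simp add: smult_assoc1[symmetric])
  thus thesis using that c(1) by blast
qed

lemma finite_bound:
  assumes "finite F" "\<And>y. y \<in> F \<Longrightarrow> \<exists>n::nat. P y n" "\<And>y n m. P y n \<Longrightarrow> n \<le> m \<Longrightarrow> P y m"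
  shows "\<exists>n. \<forall>y\<in>F. P y n"
  using assms(1,2)
proof (induction F rule: finite_induct)
  case (insert y F)
  from insert.prems obtain m where m: "P y m" by blast
  obtain n where n: "\<forall>y\<in>F. P y n" using insert.IH insert.prems by (metis insertCI)
  have "P z (max n m)" if "z \<in> insert y F" for z
    using that m n assms(3)[of z n "max n m"] assms(3)[of y m "max n m"] by auto
  thus ?case by blast
qed simp

text \<open>
  Among the counterexamples choose \<open>z\<close> with maximal annihilator.  For \<open>y \<in> \<mm>\<close> the annihilator of
  \<open>y z\<close> is strictly larger: it contains those \<open>r\<close> with \<open>r z = e\<close>, which exist because the
  submodule \<open>R z\<close> contains \<open>e\<close>.  So each \<open>y z\<close> is killed by
  a power of \<open>\<mm>\<close>; finitely many \<open>y\<close> generate \<open>\<mm>\<close>, and one power works for all of them.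
\<close>

lemma torsion:
  assumes "x \<in> carrier E"
  obtains n where "x \<in> ann (pow n)"
proof (rule ccontr)
  assume no: "\<not> thesis"
  define bad where "bad x \<longleftrightarrow> x \<in> carrier E \<and> (\<forall>n. x \<notin> ann (pow n))" for x
  define Ann where "Ann x = {r \<in> carrier R. r \<odot>\<^bsub>E\<^esub> x \<in> {\<zero>\<^bsub>E\<^esub>}}" for x
  have "bad x" using assms no that by (auto simp: bad_def)
  moreover have "ideal (Ann x) R" if "bad x" for x
    unfolding Ann_def using that colon_ideal[OF zero_submodule] by (simp add: bad_def)
  ultimately have fam: "Ann ` Collect bad \<noteq> {}" "\<And>I. I \<in> Ann ` Collect bad \<Longrightarrow> ideal I R" by auto
  obtain I where I: "I \<in> Ann ` Collect bad" "\<And>J. J \<in> Ann ` Collect bad \<Longrightarrow> I \<subseteq> J \<Longrightarrow> J = I"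
    by (rule maximal_ideal_in_family[OF fam]) auto
  from I(1) obtain z where z0: "bad z" "I = Ann z" by blast
  have z: "bad z" "\<And>y. bad y \<Longrightarrow> Ann z \<subseteq> Ann y \<Longrightarrow> Ann y = Ann z"
    using z0 I(2) by simp_all
  have zc: "z \<in> carrier E" using z(1) by (simp add: bad_def)
  have "z \<notin> ann (pow 0)" using z(1) unfolding bad_def by blast
  hence "z \<noteq> \<zero>\<^bsub>E\<^esub>" using submodule_zero[OF ann_pow_submodule] by metis
  hence "(\<lambda>r. r \<odot>\<^bsub>E\<^esub> z) ` carrier R \<noteq> {\<zero>\<^bsub>E\<^esub>}" using smult_one[OF zc] R.one_closed by (metis image_eqI singletonD)
  from e_essential[OF cyclic_submodule[OF zc] this] obtain r where r: "r \<in> carrier R" "e = r \<odot>\<^bsub>E\<^esub> z" by blast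
  have tame: "\<exists>n. y \<odot>\<^bsub>E\<^esub> z \<in> ann (pow n)" if y: "y \<in> \<mm>" for y
  proof (rule ccontr)
    assume "\<nexists>n. y \<odot>\<^bsub>E\<^esub> z \<in> ann (pow n)"
    hence b: "bad (y \<odot>\<^bsub>E\<^esub> z)" using zc \<mm>.Icarr[OF y] by (simp add: bad_def)
    have comm: "s \<odot>\<^bsub>E\<^esub> (y \<odot>\<^bsub>E\<^esub> z) = y \<odot>\<^bsub>E\<^esub> (s \<odot>\<^bsub>E\<^esub> z)" if "s \<in> carrier R" for s
      by (rule smult_lcomm[OF that \<mm>.Icarr[OF y] zc])
    have "Ann z \<subseteq> Ann (y \<odot>\<^bsub>E\<^esub> z)" using \<mm>.Icarr[OF y] by (auto simp: Ann_def comm)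
    hence "Ann (y \<odot>\<^bsub>E\<^esub> z) = Ann z" using z(2)[OF b] by simp
    moreover have "r \<in> Ann (y \<odot>\<^bsub>E\<^esub> z)" using r y e_socle comm by (simp add: Ann_def)
    ultimately show False using r e_nonzero by (auto simp: Ann_def)
  qed
  obtain F where F: "F \<subseteq> carrier R" "finite F" "\<mm> = Idl F" using finetely_gen[OF \<mm>.ideal_axioms] by blast
  have "\<exists>n. \<forall>y\<in>F. y \<odot>\<^bsub>E\<^esub> z \<in> ann (pow n)"
    using F(2) tame genideal_self[OF F(1)] ann_mono unfolding F(3) by (intro finite_bound) blast+
  then obtain n where "\<forall>y\<in>F. y \<odot>\<^bsub>E\<^esub> z \<in> ann (pow n)" by blast
  hence "Idl F \<subseteq> {y \<in> carrier R. y \<odot>\<^bsub>E\<^esub> z \<in> ann (pow n)}"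
    using F(1) by (intro genideal_minimal colon_ideal zc ann_pow_submodule) auto
  hence "\<mm> \<subseteq> {y \<in> carrier R. y \<odot>\<^bsub>E\<^esub> z \<in> ann (pow n)}" by (simp only: F(3)[symmetric])
  hence "z \<in> ann (pow (Suc n))" by (intro ann_pow_Suc zc) auto
  thus False using z(1) unfolding bad_def by blast
qed

text \<open>
  Dropping one element of \<open>F\<close> at a time enlarges \<open>ann F\<close> to a module in which the old one is the kernel
  of that element, so \<open>dcc_of_kernel\<close> applies at each step.
\<close>

lemma dcc_ann_finite:
  assumes "finite F" "F \<subseteq> \<mm>" "dcc (ann F)"
  shows "dcc (carrier E)"
  using assms
proof (induction F rule: finite_induct)
  case empty
  have "ann {} = carrier E" by (auto simp: ann_def)
  thus ?case using empty by simp
next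
  case (insert x F)
  have x: "x \<in> carrier R" "F \<subseteq> carrier R" using insert.prems \<mm>.Icarr by auto
  have "\<exists>n::nat. (x [^] n) \<odot>\<^bsub>E\<^esub> v = \<zero>\<^bsub>E\<^esub>" if v: "v \<in> ann F" for v
  proof -
    obtain n where n: "v \<in> ann (pow n)" using torsion ann_carrier[OF v] by blast
    have "x [^] k \<in> pow k" for k :: nat
    proof (induction k)
      case 0
      show ?case by (simp only: pow_0) simp
    next
      case (Suc k)
      thus ?case unfolding pow_Suc using insert.prems by (auto intro: ideal_prod.prod)
    qed
    thus ?thesis using ann_kill[OF n] by blast
  qed
  moreover have "ann (insert x F) = {v \<in> ann F. x \<odot>\<^bsub>E\<^esub> v = \<zero>\<^bsub>E\<^esub>}" by (auto simp: ann_def)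
  ultimately have "dcc (ann F)"
    using dcc_of_kernel[OF ann_submodule[OF x(2)] x(1)] insert.prems(2) by simp
  thus ?case using insert by simp
qed

text \<open>
  For generators \<open>F\<close> of \<open>\<mm>\<close> the module \<open>ann F\<close> is the socle \<open>R e\<close>, which is simple, and
  \<open>dcc_ann_finite\<close> climbs from there to \<open>E\<close>.
\<close>

lemma dcc_E: "dcc (carrier E)"
proof -
  obtain F where F: "F \<subseteq> carrier R" "finite F" "\<mm> = Idl F" using finetely_gen[OF \<mm>.ideal_axioms] by blast
  have socle: "V = {\<zero>\<^bsub>E\<^esub>} \<or> V = ann F" if V: "submodule V R E" "V \<subseteq> ann F" for V
  proof (cases "V = {\<zero>\<^bsub>E\<^esub>}")
    case False
    hence e: "e \<in> V" using e_essential[OF V(1)] by blast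
    have "x \<in> V" if x: "x \<in> ann F" for x
    proof -
      have "\<mm> \<subseteq> {r \<in> carrier R. r \<odot>\<^bsub>E\<^esub> x \<in> {\<zero>\<^bsub>E\<^esub>}}"
        unfolding F(3) using F(1) x ann_carrier
        by (intro genideal_minimal colon_ideal zero_submodule) (auto simp: ann_kill)
      then obtain c where "c \<in> carrier R" "x = c \<odot>\<^bsub>E\<^esub> e" using socle_cyclic[OF ann_carrier[OF x]] by blast
      thus ?thesis using submoduleE(4)[OF V(1)] e by blast
    qed
    thus ?thesis using V(2) by blast
  qed simp
  have "dcc (ann F)"
    unfolding dcc_def
  proof (intro allI impI)
    fix W :: "nat \<Rightarrow> 'e set"
    assume W: "\<forall>n. submodule (W n) R E \<and> W n \<subseteq> ann F \<and> W (Suc n) \<subseteq> W n"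
    show "\<exists>N. \<forall>n\<ge>N. W n = W N"
    proof (cases "\<exists>N. W N = {\<zero>\<^bsub>E\<^esub>}")
      case True
      then obtain N where N: "W N = {\<zero>\<^bsub>E\<^esub>}" by blast
      have "W n = {\<zero>\<^bsub>E\<^esub>}" if "n \<ge> N" for n
        using lift_Suc_antimono_le[of W N n] W that N submodule_zero by blast
      thus ?thesis using N by blast
    next
      case False
      hence "W n = ann F" for n using socle W by blast
      thus ?thesis by blast
    qed
  qed
  moreover have "F \<subseteq> \<mm>" using genideal_self[OF F(1)] F(3) by blast
  ultimately show ?thesis using dcc_ann_finite F(2) by blast
qed


section \<open>Endomorphisms and the completion\<close>

abbreviation completed where "completed \<equiv> completion R \<mm>"

sublocale completed: cring completed
  by (rule completion_cring(1)[OF R.cring_axioms \<mm>.ideal_axioms])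

lemma E_module: "module R E" by (rule module_axioms)

text \<open>
  The induction on \<open>J\<close> plays the role of comparing lengths in Matlis duality.  For a maximal counterexample \<open>I\<close> take
  \<open>y \<notin> I\<close> with \<open>\<mm> y \<subseteq> I\<close>.  On the annihilator of \<open>J = I + R y\<close> the homomorphism is multiplication by
  some \<open>r\<close>.  The difference \<open>h'\<close> of the two vanishes on the kernel of \<open>y\<close>, so it depends only on \<open>y x\<close>,
  which lies in the one-dimensional socle; hence it is a multiple of \<open>y\<close>.
\<close>

lemma ann_hom_scalar:
  assumes J: "ideal J R" "pow n \<subseteq> J" and h: "h \<in> module_hom R (E\<lparr>carrier := ann J\<rparr>) E"
  shows "\<exists>c\<in>carrier R. \<forall>x\<in>ann J. h x = c \<odot>\<^bsub>E\<^esub> x"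
proof (rule ccontr)
  assume no: "\<not> ?thesis"
  define good where "good J \<longleftrightarrow> (\<forall>h\<in>module_hom R (E\<lparr>carrier := ann J\<rparr>) E.
    \<exists>c\<in>carrier R. \<forall>x\<in>ann J. h x = c \<odot>\<^bsub>E\<^esub> x)" for J
  have "{J. ideal J R \<and> pow n \<subseteq> J \<and> \<not> good J} \<noteq> {}" using no J h by (auto simp: good_def)
  then obtain I where I: "ideal I R" "pow n \<subseteq> I" "\<not> good I"
    and maxi: "\<And>J. ideal J R \<Longrightarrow> I \<subset> J \<Longrightarrow> good J"
  proof (rule maximal_ideal_in_family[of "{J. ideal J R \<and> pow n \<subseteq> J \<and> \<not> good J}"])
    fix I assume I: "I \<in> {J. ideal J R \<and> pow n \<subseteq> J \<and> \<not> good J}"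
      and "\<And>J. J \<in> {J. ideal J R \<and> pow n \<subseteq> J \<and> \<not> good J} \<Longrightarrow> I \<subseteq> J \<Longrightarrow> J = I"
    hence "good J" if "ideal J R" "I \<subset> J" for J using that by blast
    thus thesis using that I by blast
  qed auto
  interpret I: ideal I R by (rule I)
  have Isub: "submodule (ann I) R E" by (rule ann_submodule[OF I.a_subset])
  have Imod: "module R (E\<lparr>carrier := ann I\<rparr>)" by (rule submodule.submodule_is_module[OF Isub E_module])
  obtain h where h: "h \<in> module_hom R (E\<lparr>carrier := ann I\<rparr>) E"
    and no: "\<And>c. c \<in> carrier R \<Longrightarrow> \<exists>x\<in>ann I. h x \<noteq> c \<odot>\<^bsub>E\<^esub> x" using I(3) by (auto simp: good_def)
  note Ic = ann_carrier[of _ I]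
  note hs = module_homD[OF h, simplified]
  have h_diff: "h (x \<ominus>\<^bsub>E\<^esub> y) = h x \<ominus>\<^bsub>E\<^esub> h y" if "x \<in> ann I" "y \<in> ann I" for x y
  proof -
    have m: "\<ominus>\<^bsub>E\<^esub> y = (\<ominus> \<one>) \<odot>\<^bsub>E\<^esub> y" using Ic[OF that(2)] by (simp add: smult_l_minus)
    have "(\<ominus> \<one>) \<odot>\<^bsub>E\<^esub> y \<in> ann I" using submoduleE(4)[OF Isub] that(2) by blast
    thus ?thesis using that hs by (simp add: M.minus_eq m) (simp add: smult_l_minus)
  qed
  \<comment> \<open>a socle element modulo \<open>I\<close>\<close>
  obtain y where y: "y \<in> carrier R" "y \<notin> I" "\<And>z. z \<in> \<mm> \<Longrightarrow> z \<otimes> y \<in> I"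
  proof -
    define k where "k = (LEAST k. pow k \<subseteq> I)"
    have k: "pow k \<subseteq> I" unfolding k_def using I(2) by (rule LeastI)
    have "I \<noteq> carrier R"
    proof
      assume "I = carrier R"
      hence "ann I = {\<zero>\<^bsub>E\<^esub>}" by (auto simp: ann_def) (metis R.one_closed smult_one)
      moreover have "h \<zero>\<^bsub>E\<^esub> = \<zero>\<^bsub>E\<^esub>" using module_hom_zero[OF Imod E_module h] by simp
      ultimately show False using no[OF R.zero_closed] by simp
    qed
    hence "k \<noteq> 0" using k pow_0 I.a_subset by (metis subset_antisym)
    then obtain j where j: "k = Suc j" using not0_implies_Suc by blast
    hence "\<not> pow j \<subseteq> I" using not_less_Least[of j "\<lambda>k. pow k \<subseteq> I"] unfolding k_def by simp
    then obtain y where y: "y \<in> pow j" "y \<notin> I" by blast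
    interpret P: ideal "pow j" R by (rule pow_ideal)
    have yc: "y \<in> carrier R" using y(1) by (rule P.Icarr)
    have "z \<otimes> y \<in> I" if "z \<in> \<mm>" for z
    proof -
      have "y \<otimes> z \<in> pow k" unfolding j pow_Suc using y that by (intro ideal_prod.prod)
      thus ?thesis using k R.m_comm[OF yc \<mm>.Icarr[OF that]] by auto
    qed
    thus thesis using that yc y(2) by blast
  qed
  define J where "J = I <+>\<^bsub>R\<^esub> PIdl y"
  interpret Py: ideal "PIdl y" R by (rule cgenideal_ideal[OF y(1)])
  have J: "ideal J R" unfolding J_def by (rule add_ideals[OF I(1) Py.ideal_axioms])
  interpret J: ideal J R by (rule J)
  have J_mem: "s \<in> J \<longleftrightarrow> (\<exists>i\<in>I. \<exists>r\<in>carrier R. s = i \<oplus> r \<otimes> y)" for s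
    unfolding J_def set_add_def' cgenideal_def by blast
  have yJ: "y \<in> J" unfolding J_mem using y(1)
    by (intro bexI[of _ \<zero>] bexI[of _ \<one>]) simp_all
  have IJ: "I \<subseteq> J"
  proof
    fix i assume "i \<in> I"
    thus "i \<in> J" unfolding J_mem using y(1) I.Icarr
      by (intro bexI[of _ i] bexI[of _ \<zero>]) simp_all
  qed
  have annJ: "ann J = {x \<in> ann I. y \<odot>\<^bsub>E\<^esub> x = \<zero>\<^bsub>E\<^esub>}"
  proof
    show "ann J \<subseteq> {x \<in> ann I. y \<odot>\<^bsub>E\<^esub> x = \<zero>\<^bsub>E\<^esub>}" using yJ IJ by (auto simp: ann_def)
    show "{x \<in> ann I. y \<odot>\<^bsub>E\<^esub> x = \<zero>\<^bsub>E\<^esub>} \<subseteq> ann J"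
      using y(1) I.Icarr by (auto simp: ann_def J_mem smult_l_distr smult_assoc1)
  qed
  have "good J" using maxi J IJ yJ y(2) by blast
  moreover have "h \<in> module_hom R (E\<lparr>carrier := ann J\<rparr>) E"
    using hs by (auto simp: module_hom_def annJ)
  ultimately obtain r where r: "r \<in> carrier R" "\<And>x. x \<in> ann J \<Longrightarrow> h x = r \<odot>\<^bsub>E\<^esub> x"
    unfolding good_def by blast
  define h' where "h' x = h x \<ominus>\<^bsub>E\<^esub> r \<odot>\<^bsub>E\<^esub> x" for x
  have h'c: "h' x \<in> carrier E" if "x \<in> ann I" for x
    using that r(1) hs(1) Ic unfolding h'_def by simp
  have h'_diff: "h' (u \<ominus>\<^bsub>E\<^esub> v) = h' u \<ominus>\<^bsub>E\<^esub> h' v" if "u \<in> ann I" "v \<in> ann I" for u v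
    using that r(1) hs(1) Ic unfolding h'_def
    by (simp add: h_diff smult_diff_right) (simp add: M.minus_eq M.minus_add M.a_ac)
  have h'_smult: "h' (s \<odot>\<^bsub>E\<^esub> v) = s \<odot>\<^bsub>E\<^esub> h' v" if "s \<in> carrier R" "v \<in> ann I" for s v
    using that r(1) hs Ic unfolding h'_def by (simp add: smult_diff_right smult_lcomm[of r s])
  have h'_J: "h' x = \<zero>\<^bsub>E\<^esub>" if "x \<in> ann J" for x
    using that r annJ Ic unfolding h'_def by (simp add: diff_self)
  have yx: "\<exists>u\<in>carrier R. y \<odot>\<^bsub>E\<^esub> x = u \<odot>\<^bsub>E\<^esub> e" if x: "x \<in> ann I" for x
  proof -
    have "z \<odot>\<^bsub>E\<^esub> (y \<odot>\<^bsub>E\<^esub> x) = \<zero>\<^bsub>E\<^esub>" if "z \<in> \<mm>" for z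
      using ann_kill[OF x y(3)[OF that]] Ic[OF x] y(1) \<mm>.Icarr[OF that] by (simp add: smult_assoc1)
    thus ?thesis using socle_cyclic[of "y \<odot>\<^bsub>E\<^esub> x"] Ic[OF x] y(1) by blast
  qed
  have "\<exists>c\<in>carrier R. \<forall>x\<in>ann I. h' x = c \<odot>\<^bsub>E\<^esub> (y \<odot>\<^bsub>E\<^esub> x)"
  proof (cases "\<exists>x\<in>ann I. y \<odot>\<^bsub>E\<^esub> x \<noteq> \<zero>\<^bsub>E\<^esub>")
    case False
    hence "h' x = \<zero> \<odot>\<^bsub>E\<^esub> (y \<odot>\<^bsub>E\<^esub> x)" if "x \<in> ann I" for x
      using h'_J that annJ y(1) Ic by simp
    thus ?thesis by blast
  next
    case True
    then obtain x0 where x0: "x0 \<in> ann I" "y \<odot>\<^bsub>E\<^esub> x0 \<noteq> \<zero>\<^bsub>E\<^esub>" by blast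
    obtain u where u: "u \<in> carrier R" "y \<odot>\<^bsub>E\<^esub> x0 = u \<odot>\<^bsub>E\<^esub> e" using yx[OF x0(1)] by blast
    obtain u' where u': "u' \<in> carrier R" "u' \<otimes> u = \<one>" using e_multiple[OF u(1)] x0(2) u(2) by metis
    define x1 where "x1 = u' \<odot>\<^bsub>E\<^esub> x0"
    have x1: "x1 \<in> ann I" unfolding x1_def using submoduleE(4)[OF Isub u'(1) x0(1)] .
    have yx1: "y \<odot>\<^bsub>E\<^esub> x1 = e"
      unfolding x1_def using smult_lcomm[OF y(1) u'(1) Ic[OF x0(1)]] u u' e_closed
      by (simp add: smult_assoc1[symmetric])
    have "z \<odot>\<^bsub>E\<^esub> h' x1 = \<zero>\<^bsub>E\<^esub>" if z: "z \<in> \<mm>" for z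
    proof -
      have "z \<odot>\<^bsub>E\<^esub> x1 \<in> ann I" using submoduleE(4)[OF Isub \<mm>.Icarr[OF z] x1] .
      moreover have "y \<odot>\<^bsub>E\<^esub> (z \<odot>\<^bsub>E\<^esub> x1) = \<zero>\<^bsub>E\<^esub>"
        using smult_lcomm[OF y(1) \<mm>.Icarr[OF z] Ic[OF x1]] yx1 e_socle[OF z] by simp
      ultimately show ?thesis using h'_J annJ h'_smult[OF \<mm>.Icarr[OF z] x1] by simp
    qed
    then obtain c where c: "c \<in> carrier R" "h' x1 = c \<odot>\<^bsub>E\<^esub> e" using socle_cyclic[OF h'c[OF x1]] by blast
    have "h' x = c \<odot>\<^bsub>E\<^esub> (y \<odot>\<^bsub>E\<^esub> x)" if x: "x \<in> ann I" for x
    proof -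
      obtain v where v: "v \<in> carrier R" "y \<odot>\<^bsub>E\<^esub> x = v \<odot>\<^bsub>E\<^esub> e" using yx[OF x] by blast
      have vx: "v \<odot>\<^bsub>E\<^esub> x1 \<in> ann I" using submoduleE(4)[OF Isub v(1) x1] .
      have "y \<odot>\<^bsub>E\<^esub> (x \<ominus>\<^bsub>E\<^esub> v \<odot>\<^bsub>E\<^esub> x1) = \<zero>\<^bsub>E\<^esub>"
        using smult_lcomm[OF y(1) v(1) Ic[OF x1]] v y(1) Ic[OF x] Ic[OF vx] e_closed
        by (simp add: smult_diff_right yx1 diff_self)
      hence "h' (x \<ominus>\<^bsub>E\<^esub> v \<odot>\<^bsub>E\<^esub> x1) = \<zero>\<^bsub>E\<^esub>"
        using h'_J annJ submodule_minus[OF Isub x vx] by simp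
      hence "h' x = h' (v \<odot>\<^bsub>E\<^esub> x1)"
        using h'_diff[OF x vx] diff_zeroD[OF _ h'c[OF x] h'c[OF vx]] by simp
      thus ?thesis using h'_smult[OF v(1) x1] c v smult_lcomm[OF v(1) c(1) e_closed] by simp
    qed
    thus ?thesis using c(1) by blast
  qed
  then obtain c where c: "c \<in> carrier R" "\<And>x. x \<in> ann I \<Longrightarrow> h' x = c \<odot>\<^bsub>E\<^esub> (y \<odot>\<^bsub>E\<^esub> x)" by blast
  have "h x = (c \<otimes> y \<oplus> r) \<odot>\<^bsub>E\<^esub> x" if x: "x \<in> ann I" for x
  proof -
    have "h x = h' x \<oplus>\<^bsub>E\<^esub> r \<odot>\<^bsub>E\<^esub> x"
      unfolding h'_def using hs(1)[OF x] r(1) Ic[OF x] by (simp add: diff_add)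
    thus ?thesis using c y(1) r(1) Ic[OF x] x by (simp add: smult_l_distr smult_assoc1)
  qed
  thus False using no[of "c \<otimes> y \<oplus> r"] c(1) y(1) r(1) by fastforce
qed

text \<open>
  Otherwise a homomorphism \<open>R \<rightarrow> E\<close> separates \<open>r\<close> from the power of \<open>\<mm>\<close>; its value at \<open>1\<close> is
  annihilated by that power but not by \<open>r\<close>.
\<close>

lemma pow_faithful:
  assumes r: "r \<in> carrier R" and kill: "\<And>x. x \<in> ann (pow n) \<Longrightarrow> r \<odot>\<^bsub>E\<^esub> x = \<zero>\<^bsub>E\<^esub>"
  shows "r \<in> pow n"
proof (rule ccontr)
  assume "r \<notin> pow n"
  then obtain h where h: "h \<in> module_hom R (regular_module R) E" "\<And>v. v \<in> pow n \<Longrightarrow> h v = \<zero>\<^bsub>E\<^esub>" "h r = e"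
    using separating_hom[OF regular_module ideal_submodule[OF pow_ideal[of n]], of r] r by auto
  interpret P: ideal "pow n" R by (rule pow_ideal)
  have hr: "h s = s \<odot>\<^bsub>E\<^esub> h \<one>" if "s \<in> carrier R" for s
    using module_homD(3)[OF h(1) that, of \<one>] that by simp
  have "s \<odot>\<^bsub>E\<^esub> h \<one> = \<zero>\<^bsub>E\<^esub>" if "s \<in> pow n" for s
    using h(2)[OF that] hr[OF P.Icarr[OF that]] by simp
  hence "h \<one> \<in> ann (pow n)" using module_homD(1)[OF h(1), of \<one>] unfolding ann_def by simp
  from kill[OF this] show False using hr[OF r] h(3) e_nonzero by simp
qed

lemma component:
  assumes "a \<in> carrier completed"
  obtains r where "r \<in> carrier R" "r \<in> a n" "a n = pow n +>\<^bsub>R\<^esub> r"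
proof -
  interpret P: ideal "pow n" R by (rule pow_ideal)
  have "a n \<in> carrier (R Quot pow n)" using assms by (simp add: completion_sel)
  then obtain r where "r \<in> carrier R" "a n = pow n +>\<^bsub>R\<^esub> r" unfolding FactRing_def A_RCOSETS_def' by auto
  thus thesis using that P.a_rcos_self by blast
qed

lemma component_eq:
  assumes "a \<in> carrier completed" "r \<in> a n"
  shows "r \<in> carrier R" "a n = pow n +>\<^bsub>R\<^esub> r"
proof -
  interpret P: ideal "pow n" R by (rule pow_ideal)
  obtain s where s: "s \<in> carrier R" "a n = pow n +>\<^bsub>R\<^esub> s" using component[OF assms(1)] by metis
  show "r \<in> carrier R" using P.a_elemrcos_carrier[OF s(1)] assms(2) s(2) by simp
  show "a n = pow n +>\<^bsub>R\<^esub> r" using P.a_repr_independence'[OF _ s(1)] assms(2) s(2) by simp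
qed

lemma component_diff:
  assumes "a \<in> carrier completed" "r \<in> a n" "s \<in> a n"
  shows "r \<ominus> s \<in> pow n"
  using component_eq[OF assms(1,2)] component_eq[OF assms(1,3)]
    R.quotient_eq_iff_same_a_r_cos[OF pow_ideal, of r s n] by simp

lemma component_antimono: "a \<in> carrier completed \<Longrightarrow> i \<le> j \<Longrightarrow> a j \<subseteq> a i"
  by (simp add: completion_sel)

text \<open>
  The multiplication of the completion on \<open>E\<close>.  An element killed by \<open>\<mm>\<^sup>n\<close> is multiplied by a
  representative of the \<open>n\<close>-th component; the least exponent only fixes a choice, see \<open>act_eq\<close>.
\<close>

definition act :: "(nat \<Rightarrow> 'a set) \<Rightarrow> 'e \<Rightarrow> 'e"
  where "act a x = (SOME r. r \<in> a (LEAST n. x \<in> ann (pow n))) \<odot>\<^bsub>E\<^esub> x"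

lemma act_eq:
  assumes a: "a \<in> carrier completed" and x: "x \<in> ann (pow n)" and r: "r \<in> a n"
  shows "act a x = r \<odot>\<^bsub>E\<^esub> x"
proof -
  define k where "k = (LEAST n. x \<in> ann (pow n))"
  define s where "s = (SOME r. r \<in> a k)"
  have k: "x \<in> ann (pow k)" "k \<le> n" unfolding k_def using x by (auto intro: LeastI Least_le)
  have s: "s \<in> a k" unfolding s_def using component[OF a, of k] by (metis someI)
  have "r \<in> a k" using component_antimono[OF a k(2)] r by blast
  hence "(r \<ominus> s) \<odot>\<^bsub>E\<^esub> x = \<zero>\<^bsub>E\<^esub>" using ann_kill[OF k(1) component_diff[OF a _ s]] by blast
  moreover have "r \<in> carrier R" "s \<in> carrier R" using component_eq(1)[OF a] r s by auto
  ultimately have "r \<odot>\<^bsub>E\<^esub> x = s \<odot>\<^bsub>E\<^esub> x" using ann_carrier[OF x] diff_zeroD by (simp add: smult_diff_left)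
  thus ?thesis unfolding act_def k_def s_def by simp
qed

lemma act_hom:
  assumes a: "a \<in> carrier completed"
  shows "act a \<in> module_hom R E E"
  unfolding module_hom_def
proof (intro CollectI conjI ballI funcsetI)
  fix x assume x: "x \<in> carrier E"
  obtain n where n: "x \<in> ann (pow n)" using torsion[OF x] .
  obtain r where r: "r \<in> carrier R" "r \<in> a n" using component[OF a] by metis
  show "act a x \<in> carrier E" using act_eq[OF a n r(2)] r x by simp
  show "act a (s \<odot>\<^bsub>E\<^esub> x) = s \<odot>\<^bsub>E\<^esub> act a x" if s: "s \<in> carrier R" for s
    using act_eq[OF a submoduleE(4)[OF ann_pow_submodule s n] r(2)] act_eq[OF a n r(2)]
      smult_lcomm[OF r(1) s x] by simp
  fix y assume y: "y \<in> carrier E"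
  obtain m where m: "y \<in> ann (pow m)" using torsion[OF y] .
  define k where "k = max n m"
  have k: "x \<in> ann (pow k)" "y \<in> ann (pow k)" using ann_mono[of n k x] ann_mono[of m k y] n m by (simp_all add: k_def)
  obtain s where s: "s \<in> carrier R" "s \<in> a k" using component[OF a] by metis
  show "act a (x \<oplus>\<^bsub>E\<^esub> y) = act a x \<oplus>\<^bsub>E\<^esub> act a y"
    using act_eq[OF a submoduleE(5)[OF ann_pow_submodule k] s(2)] act_eq[OF a k(1) s(2)]
      act_eq[OF a k(2) s(2)] s(1) x y by (simp add: smult_r_distr)
qed

lemma act_mult:
  assumes a: "a \<in> carrier completed" and b: "b \<in> carrier completed" and x: "x \<in> carrier E"
  shows "act (a \<otimes>\<^bsub>completed\<^esub> b) x = act a (act b x)"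
proof -
  obtain n where n: "x \<in> ann (pow n)" using torsion[OF x] .
  interpret P: ideal "pow n" R by (rule pow_ideal)
  obtain r where r: "r \<in> carrier R" "r \<in> a n" "a n = pow n +>\<^bsub>R\<^esub> r" using component[OF a] .
  obtain s where s: "s \<in> carrier R" "s \<in> b n" "b n = pow n +>\<^bsub>R\<^esub> s" using component[OF b] .
  have "(a \<otimes>\<^bsub>completed\<^esub> b) n = pow n +>\<^bsub>R\<^esub> (r \<otimes> s)"
    using ring_hom_mult[OF P.rcos_ring_hom r(1) s(1)] r s by (simp add: completion_sel)
  hence "r \<otimes> s \<in> (a \<otimes>\<^bsub>completed\<^esub> b) n" using P.a_rcos_self r(1) s(1) by simp
  from act_eq[OF completed.m_closed[OF a b] n this] act_eq[OF b n s(2)]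
    act_eq[OF a submoduleE(4)[OF ann_pow_submodule s(1) n] r(2)] r s x
  show ?thesis by (simp add: smult_assoc1)
qed

lemma act_scalar:
  assumes r: "r \<in> carrier R" and x: "x \<in> carrier E"
  shows "act (to_completion R \<mm> r) x = r \<odot>\<^bsub>E\<^esub> x"
proof -
  obtain n where n: "x \<in> ann (pow n)" using torsion[OF x] .
  interpret P: ideal "pow n" R by (rule pow_ideal)
  have "to_completion R \<mm> r \<in> carrier completed"
    using ring_hom_closed[OF completion_cring(2)[OF R.cring_axioms \<mm>.ideal_axioms] r] .
  thus ?thesis using act_eq[OF _ n] P.a_rcos_self[OF r] by (simp add: to_completion_def)
qed

lemma act_faithful:
  assumes a: "a \<in> carrier completed" and b: "b \<in> carrier completed"
    and eq: "\<And>x. x \<in> carrier E \<Longrightarrow> act a x = act b x"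
  shows "a = b"
proof
  fix n
  interpret P: ideal "pow n" R by (rule pow_ideal)
  obtain r where r: "r \<in> carrier R" "r \<in> a n" "a n = pow n +>\<^bsub>R\<^esub> r" using component[OF a] .
  obtain s where s: "s \<in> carrier R" "s \<in> b n" "b n = pow n +>\<^bsub>R\<^esub> s" using component[OF b] .
  have "(r \<ominus> s) \<odot>\<^bsub>E\<^esub> x = \<zero>\<^bsub>E\<^esub>" if x: "x \<in> ann (pow n)" for x
    using eq[OF ann_carrier[OF x]] act_eq[OF a x r(2)] act_eq[OF b x s(2)] r(1) s(1) ann_carrier[OF x]
    by (simp add: smult_diff_left diff_self)
  hence "r \<ominus> s \<in> pow n" using pow_faithful r(1) s(1) by simp
  thus "a n = b n" using R.quotient_eq_iff_same_a_r_cos[OF pow_ideal r(1) s(1)] r s by simp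
qed

text \<open>
  On each \<open>ann (\<mm>\<^sup>n)\<close> the endomorphism is multiplication by some \<open>c n\<close>, and \<open>pow_faithful\<close> makes
  these scalars compatible modulo the powers of \<open>\<mm>\<close>.
\<close>

lemma hom_is_act:
  assumes h: "h \<in> module_hom R E E"
  obtains a where "a \<in> carrier completed" "\<And>x. x \<in> carrier E \<Longrightarrow> act a x = h x"
proof -
  have "\<exists>c\<in>carrier R. \<forall>x\<in>ann (pow n). h x = c \<odot>\<^bsub>E\<^esub> x" for n
  proof (rule ann_hom_scalar[OF pow_ideal order_refl])
    show "h \<in> module_hom R (E\<lparr>carrier := ann (pow n)\<rparr>) E"
      using module_homD[OF h] ann_carrier by (auto simp: module_hom_def)
  qed
  hence "\<exists>c. \<forall>n. c n \<in> carrier R \<and> (\<forall>x\<in>ann (pow n). h x = c n \<odot>\<^bsub>E\<^esub> x)" by (intro choice) blast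
  then obtain c where c: "\<And>n. c n \<in> carrier R" "\<And>n x. x \<in> ann (pow n) \<Longrightarrow> h x = c n \<odot>\<^bsub>E\<^esub> x" by blast
  define a where "a n = pow n +>\<^bsub>R\<^esub> c n" for n
  have "a j \<subseteq> a i" if ij: "i \<le> j" for i j
  proof -
    have "(c j \<ominus> c i) \<odot>\<^bsub>E\<^esub> x = \<zero>\<^bsub>E\<^esub>" if x: "x \<in> ann (pow i)" for x
      using c(2)[OF x] c(2)[OF ann_mono[OF ij x]] c(1) ann_carrier[OF x] by (simp add: smult_diff_left diff_self)
    hence "c j \<ominus> c i \<in> pow i" using pow_faithful c(1) by simp
    hence "a i = pow i +>\<^bsub>R\<^esub> c j" using R.quotient_eq_iff_same_a_r_cos[OF pow_ideal c(1) c(1)] by (simp add: a_def)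
    thus ?thesis using pow_antimono[OF ij] by (auto simp: a_def a_r_coset_def r_coset_def)
  qed
  moreover have "a n \<in> carrier (R Quot pow n)" for n
    using ring_hom_closed[OF ideal.rcos_ring_hom[OF pow_ideal] c(1)] by (simp add: a_def)
  ultimately have a: "a \<in> carrier completed" by (simp add: completion_sel)
  moreover have "act a x = h x" if x: "x \<in> carrier E" for x
  proof -
    obtain n where n: "x \<in> ann (pow n)" using torsion[OF x] .
    interpret P: ideal "pow n" R by (rule pow_ideal)
    have "c n \<in> a n" using P.a_rcos_self[OF c(1)] by (simp add: a_def)
    thus ?thesis using act_eq[OF a n] c(2)[OF n] by simp
  qed
  ultimately show thesis using that by blast
qed


section \<open>Simple divisibility\<close>

lemma completed_hom: "to_completion R \<mm> \<in> ring_hom R completed"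
  by (rule completion_cring(2)[OF R.cring_axioms \<mm>.ideal_axioms])

lemma act_zero: "x \<in> carrier E \<Longrightarrow> act \<zero>\<^bsub>completed\<^esub> x = \<zero>\<^bsub>E\<^esub>"
  using act_scalar[of \<zero> x] ring_hom_zero[OF completed_hom ring_axioms completed.ring_axioms] by simp

lemma act_mult_scalar:
  assumes "s \<in> carrier R" "b \<in> carrier completed" "a \<in> carrier completed" "b \<otimes>\<^bsub>completed\<^esub> a = to_completion R \<mm> s"
    "x \<in> carrier E"
  shows "s \<odot>\<^bsub>E\<^esub> x = act b (act a x)"
  using assms act_scalar act_mult by metis

lemma divisible_point:
  assumes "s \<in> nonzerodivisors R" "x \<in> carrier E"
  obtains y where "y \<in> carrier E" "x = s \<odot>\<^bsub>E\<^esub> y"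
  using divisible_E assms unfolding divisible_def by blast

text \<open>
  Divisibility of \<open>E\<close> stands in for flatness of the completion: if \<open>s a = 0\<close> then
  \<open>a E = a s E = 0\<close>, whence \<open>a = 0\<close> because the action on \<open>E\<close> is faithful.
\<close>

sublocale completed: regular_algebra R completed "to_completion R \<mm>"
proof unfold_locales
  show "to_completion R \<mm> \<in> ring_hom R completed" by (rule completed_hom)
  fix s assume s: "s \<in> nonzerodivisors R"
  have sc: "s \<in> carrier R" "to_completion R \<mm> s \<in> carrier completed"
    using nonzerodivisors_carrier[OF s] ring_hom_closed[OF completed_hom] by auto
  have "a = \<zero>\<^bsub>completed\<^esub>" if a: "a \<in> carrier completed" "to_completion R \<mm> s \<otimes>\<^bsub>completed\<^esub> a = \<zero>\<^bsub>completed\<^esub>" for a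
  proof (rule act_faithful[OF a(1) completed.zero_closed])
    fix x assume "x \<in> carrier E"
    then obtain y where y: "y \<in> carrier E" "x = s \<odot>\<^bsub>E\<^esub> y" using divisible_point[OF s] by blast
    have ay: "act a y \<in> carrier E" using module_homD(1)[OF act_hom[OF a(1)] y(1)] .
    have "act a x = s \<odot>\<^bsub>E\<^esub> act a y" using module_homD(3)[OF act_hom[OF a(1)] sc(1) y(1)] y(2) by simp
    also have "\<dots> = act \<zero>\<^bsub>completed\<^esub> y" using act_mult[OF sc(2) a(1) y(1)] a(2) act_scalar[OF sc(1) ay] by simp
    finally show "act a x = act \<zero>\<^bsub>completed\<^esub> x" using act_zero y \<open>x \<in> carrier E\<close> by simp
  qed
  thus "to_completion R \<mm> s \<in> nonzerodivisors completed" using sc(2) by (simp add: nonzerodivisors_def)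
qed

lemma factor_through:
  assumes f: "f \<in> module_hom R E E" and onto: "f ` carrier E = carrier E"
    and g: "g \<in> module_hom R E E" and ker: "\<And>x. x \<in> carrier E \<Longrightarrow> f x = \<zero>\<^bsub>E\<^esub> \<Longrightarrow> g x = \<zero>\<^bsub>E\<^esub>"
  obtains h where "h \<in> module_hom R E E" "\<And>x. x \<in> carrier E \<Longrightarrow> h (f x) = g x"
proof -
  define p where "p = inv_into (carrier E) f"
  have p: "p y \<in> carrier E" "f (p y) = y" if "y \<in> carrier E" for y
    unfolding p_def using that onto by (auto intro: inv_into_into f_inv_into_f)
  have gp: "g (p (f x)) = g x" if x: "x \<in> carrier E" for x
  proof -
    have fx: "f x \<in> carrier E" using module_homD(1)[OF f x] .
    note q = p[OF fx]
    have "f (p (f x) \<ominus>\<^bsub>E\<^esub> x) = \<zero>\<^bsub>E\<^esub>"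
      using module_hom_minus[OF E_module E_module f q(1) x] q(2) fx by (simp add: diff_self)
    hence "g (p (f x)) \<ominus>\<^bsub>E\<^esub> g x = \<zero>\<^bsub>E\<^esub>"
      using ker[of "p (f x) \<ominus>\<^bsub>E\<^esub> x"] q(1) x module_hom_minus[OF E_module E_module g q(1) x] by simp
    thus ?thesis using diff_zeroD module_homD(1)[OF g] q(1) x by blast
  qed
  have "(\<lambda>y. g (p y)) \<in> module_hom R E E"
    unfolding module_hom_def
  proof (intro CollectI conjI ballI funcsetI)
    fix y assume y: "y \<in> carrier E"
    show "g (p y) \<in> carrier E" using module_homD(1)[OF g] p(1)[OF y] .
    show "g (p (r \<odot>\<^bsub>E\<^esub> y)) = r \<odot>\<^bsub>E\<^esub> g (p y)" if "r \<in> carrier R" for r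
      using gp[of "r \<odot>\<^bsub>E\<^esub> p y"] module_homD(3)[OF f that p(1)[OF y]] module_homD(3)[OF g that p(1)[OF y]]
        p[OF y] that by simp
    fix z assume z: "z \<in> carrier E"
    show "g (p (y \<oplus>\<^bsub>E\<^esub> z)) = g (p y) \<oplus>\<^bsub>E\<^esub> g (p z)"
      using gp[of "p y \<oplus>\<^bsub>E\<^esub> p z"] module_homD(2)[OF f p(1)[OF y] p(1)[OF z]]
        module_homD(2)[OF g p(1)[OF y] p(1)[OF z]] p[OF y] p[OF z] by simp
  qed
  thus thesis using that gp by blast
qed

lemma field_if_simple_divisible:
  assumes simple: "simple_divisible R E" and a: "a \<in> carrier completed" "a \<noteq> \<zero>\<^bsub>completed\<^esub>"
  shows "\<exists>b\<in>carrier completed. \<exists>s\<in>nonzerodivisors R. b \<otimes>\<^bsub>completed\<^esub> a = to_completion R \<mm> s"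
proof -
  have trivial: "V = {\<zero>\<^bsub>E\<^esub>} \<or> V = carrier E"
    if "submodule V R E" "\<And>s. s \<in> nonzerodivisors R \<Longrightarrow> V \<subseteq> (\<lambda>x. s \<odot>\<^bsub>E\<^esub> x) ` V" for V
    using simple that divisible_submodule_iff unfolding simple_divisible_def by blast
  note ah = act_hom[OF a(1)]
  note ahs = module_homD[OF ah]
  have nz: "\<exists>x\<in>carrier E. act a x \<noteq> \<zero>\<^bsub>E\<^esub>"
    using act_faithful[OF a(1) completed.zero_closed] a(2) act_zero by metis
  have im: "submodule (act a ` carrier E) R E" by (rule image_submodule[OF E_module ah carrier_is_submodule])
  have "act a ` carrier E \<subseteq> (\<lambda>x. s \<odot>\<^bsub>E\<^esub> x) ` act a ` carrier E" if s: "s \<in> nonzerodivisors R" for s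
  proof
    fix u assume "u \<in> act a ` carrier E"
    then obtain x where x: "x \<in> carrier E" "u = act a x" by blast
    then obtain y where y: "y \<in> carrier E" "x = s \<odot>\<^bsub>E\<^esub> y" using divisible_point[OF s] by blast
    thus "u \<in> (\<lambda>x. s \<odot>\<^bsub>E\<^esub> x) ` act a ` carrier E" using x ahs(3)[OF nonzerodivisors_carrier[OF s] y(1)] by simp
  qed
  from trivial[OF im this] have onto: "act a ` carrier E = carrier E" using nz by blast
  define V where "V = {x \<in> carrier E. act a x = \<zero>\<^bsub>E\<^esub>}"
  have V: "submodule V R E" unfolding V_def by (rule kernel_submodule[OF E_module ah])
  have mul: "submodule ((\<lambda>x. s \<odot>\<^bsub>E\<^esub> x) ` W) R E" if "s \<in> carrier R" "submodule W R E" for s W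
    using image_submodule[OF E_module scalar_hom[OF that(1)] that(2)] .
  have mulV: "(\<lambda>x. s \<odot>\<^bsub>E\<^esub> x) ` W \<subseteq> W" if "s \<in> carrier R" "submodule W R E" for s W
    using submoduleE(4)[OF that(2,1)] by blast
  \<comment> \<open>a minimal multiple of the kernel is divisible\<close>
  obtain W where W: "W \<in> (\<lambda>s. (\<lambda>x. s \<odot>\<^bsub>E\<^esub> x) ` V) ` nonzerodivisors R"
    and mini: "\<And>U. U \<in> (\<lambda>s. (\<lambda>x. s \<odot>\<^bsub>E\<^esub> x) ` V) ` nonzerodivisors R \<Longrightarrow> U \<subseteq> W \<Longrightarrow> U = W"
  proof (rule dcc_minimal[OF dcc_E, of "(\<lambda>s. (\<lambda>x. s \<odot>\<^bsub>E\<^esub> x) ` V) ` nonzerodivisors R"])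
    show "(\<lambda>s. (\<lambda>x. s \<odot>\<^bsub>E\<^esub> x) ` V) ` nonzerodivisors R \<noteq> {}" using nonzerodivisors_one by blast
    show "submodule U R E \<and> U \<subseteq> carrier E" if "U \<in> (\<lambda>s. (\<lambda>x. s \<odot>\<^bsub>E\<^esub> x) ` V) ` nonzerodivisors R" for U
      using that mul[OF nonzerodivisors_carrier V] submoduleE(1) by blast
  qed blast
  then obtain s where s: "s \<in> nonzerodivisors R" "W = (\<lambda>x. s \<odot>\<^bsub>E\<^esub> x) ` V" by blast
  have Wsub: "submodule W R E" unfolding s(2) by (rule mul[OF nonzerodivisors_carrier[OF s(1)] V])
  have "W \<subseteq> (\<lambda>x. t \<odot>\<^bsub>E\<^esub> x) ` W" if t: "t \<in> nonzerodivisors R" for t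
  proof -
    have "(\<lambda>x. t \<odot>\<^bsub>E\<^esub> x) ` W = (\<lambda>x. (t \<otimes> s) \<odot>\<^bsub>E\<^esub> x) ` V"
      unfolding s(2) image_image using submoduleE(1)[OF V] nonzerodivisors_carrier t s(1)
      by (intro image_cong) (auto simp: smult_assoc1)
    moreover have "t \<otimes> s \<in> nonzerodivisors R" using nonzerodivisors_mult[OF t s(1)] .
    ultimately have "(\<lambda>x. t \<odot>\<^bsub>E\<^esub> x) ` W = W" using mini mulV[OF nonzerodivisors_carrier[OF t] Wsub] by blast
    thus ?thesis by simp
  qed
  moreover have "W \<noteq> carrier E"
    using mulV[OF nonzerodivisors_carrier[OF s(1)] V] s(2) nz unfolding V_def by blast
  ultimately have "W = {\<zero>\<^bsub>E\<^esub>}" using trivial[OF Wsub] by blast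
  hence "s \<odot>\<^bsub>E\<^esub> x = \<zero>\<^bsub>E\<^esub>" if "x \<in> carrier E" "act a x = \<zero>\<^bsub>E\<^esub>" for x
    using that s(2) unfolding V_def by blast
  from factor_through[OF ah onto scalar_hom[OF nonzerodivisors_carrier[OF s(1)]] this]
  obtain h where h: "h \<in> module_hom R E E" "\<And>x. x \<in> carrier E \<Longrightarrow> h (act a x) = s \<odot>\<^bsub>E\<^esub> x" by blast
  obtain b where b: "b \<in> carrier completed" "\<And>x. x \<in> carrier E \<Longrightarrow> act b x = h x" using hom_is_act[OF h(1)] by blast
  have "b \<otimes>\<^bsub>completed\<^esub> a = to_completion R \<mm> s"
  proof (rule act_faithful)
    show "b \<otimes>\<^bsub>completed\<^esub> a \<in> carrier completed" using b(1) a(1) by simp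
    show "to_completion R \<mm> s \<in> carrier completed"
      using ring_hom_closed[OF completed_hom nonzerodivisors_carrier[OF s(1)]] .
    show "act (b \<otimes>\<^bsub>completed\<^esub> a) x = act (to_completion R \<mm> s) x" if "x \<in> carrier E" for x
      using act_mult[OF b(1) a(1) that] b(2)[OF ahs(1)[OF that]] h(2)[OF that]
        act_scalar[OF nonzerodivisors_carrier[OF s(1)] that] by simp
  qed
  thus ?thesis using b(1) s(1) by blast
qed

lemma simple_divisible_if_field:
  assumes inv: "\<And>a. a \<in> carrier completed \<Longrightarrow> a \<noteq> \<zero>\<^bsub>completed\<^esub> \<Longrightarrow>
    \<exists>b\<in>carrier completed. \<exists>s\<in>nonzerodivisors R. b \<otimes>\<^bsub>completed\<^esub> a = to_completion R \<mm> s"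
  shows "simple_divisible R E"
  unfolding simple_divisible_def
proof (intro conjI allI impI notI)
  show "divisible R E" by (rule divisible_E)
  show False if "carrier E = {\<zero>\<^bsub>E\<^esub>}" using that e_closed e_nonzero by simp
  fix V assume V: "submodule V R E \<and> V \<noteq> {\<zero>\<^bsub>E\<^esub>} \<and> V \<noteq> carrier E" and "divisible R (E\<lparr>carrier := V\<rparr>)"
  hence div: "V \<subseteq> (\<lambda>x. s \<odot>\<^bsub>E\<^esub> x) ` V" if "s \<in> nonzerodivisors R" for s
    using divisible_submodule_iff that by blast
  have VE: "V \<subseteq> carrier E" using submoduleE(1) V by blast
  then obtain x where x: "x \<in> carrier E" "x \<notin> V" using V by blast
  obtain h where h: "h \<in> module_hom R E E" "\<And>v. v \<in> V \<Longrightarrow> h v = \<zero>\<^bsub>E\<^esub>" "h x = e"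
    using separating_hom[OF E_module _ x] V by blast
  obtain a where a: "a \<in> carrier completed" "\<And>x. x \<in> carrier E \<Longrightarrow> act a x = h x" using hom_is_act[OF h(1)] by blast
  have "a \<noteq> \<zero>\<^bsub>completed\<^esub>" using a(2)[OF x(1)] h(3) act_zero[OF x(1)] e_nonzero by auto
  then obtain b s where bs: "b \<in> carrier completed" "s \<in> nonzerodivisors R"
    "b \<otimes>\<^bsub>completed\<^esub> a = to_completion R \<mm> s" using inv[OF a(1)] by blast
  have "s \<odot>\<^bsub>E\<^esub> v = \<zero>\<^bsub>E\<^esub>" if v: "v \<in> V" for v
  proof -
    have "s \<odot>\<^bsub>E\<^esub> v = act b \<zero>\<^bsub>E\<^esub>"
      using act_mult_scalar[OF nonzerodivisors_carrier[OF bs(2)] bs(1) a(1) bs(3)] a(2) h(2)[OF v] v VE by auto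
    thus ?thesis using module_hom_zero[OF E_module E_module act_hom[OF bs(1)]] by simp
  qed
  hence "V \<subseteq> {\<zero>\<^bsub>E\<^esub>}" using div[OF bs(2)] by auto
  thus False using V submodule_zero by blast
qed

lemma simple_divisible_iff_field:
  "simple_divisible R E \<longleftrightarrow> field (tensor_product R completed (to_completion R \<mm>)
     (total_quotient_ring R) (to_total_quotient_ring R))"
proof -
  have "\<one>\<^bsub>completed\<^esub> \<noteq> \<zero>\<^bsub>completed\<^esub>"
    using act_scalar[OF R.one_closed e_closed] act_zero[OF e_closed] ring_hom_one[OF completed_hom]
      e_closed e_nonzero by auto
  thus ?thesis
    unfolding completed.field_tensor_iff
    using field_if_simple_divisible simple_divisible_if_field by blast
qed

end


text \<open>
  A nonzero submodule meets \<open>\<iota> (R/\<mm>)\<close> nontrivially, and every nonzero element of the field \<open>R/\<mm>\<close>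
  has the unit class among its multiples.
\<close>

lemma socle_injective_hull:
  fixes R :: "('a, 'r) ring_scheme" and E :: "('a, 'e, 'm) module_scheme"
  assumes R: "noetherian_ring R" and local: "local_ring R \<mm>"
    and hull: "injective_hull R (quotient_module R \<mm>) E \<iota>"
  shows "socle_injective R E \<mm> (\<iota> (\<mm> +>\<^bsub>R\<^esub> \<one>\<^bsub>R\<^esub>))"
proof -
  interpret R: cring R using local by (simp add: local_ring_def)
  interpret m: maximalideal \<mm> R using local by (simp add: local_ring_def)
  interpret F: field "R Quot \<mm>" by (rule m.quotient_is_field[OF R.cring_axioms])
  let ?k = "quotient_module R \<mm>"
  note k = quotient_module_sel[of R \<mm>]
  have E: "injective_module R E" "module R E" using hull by (auto simp: injective_hull_def injective_module_def)
  interpret E: module R E by (rule E)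
  have k_mod: "module R ?k" by (rule quotient_module[OF R.cring_axioms m.ideal_axioms])
  have \<iota>: "\<iota> \<in> module_hom R ?k E" "inj_on \<iota> (carrier ?k)"
    and ess: "\<And>V. submodule V R E \<Longrightarrow> V \<noteq> {\<zero>\<^bsub>E\<^esub>} \<Longrightarrow> V \<inter> \<iota> ` carrier ?k \<noteq> {\<zero>\<^bsub>E\<^esub>}"
    using hull by (auto simp: injective_hull_def)
  let ?one = "\<mm> +>\<^bsub>R\<^esub> \<one>\<^bsub>R\<^esub>"
  have one: "?one = \<one>\<^bsub>R Quot \<mm>\<^esub>" using ring_hom_one[OF m.rcos_ring_hom] .
  have one_k: "?one \<in> carrier ?k" unfolding one k by simp
  have \<iota>0: "\<iota> \<zero>\<^bsub>?k\<^esub> = \<zero>\<^bsub>E\<^esub>" using module_hom_zero[OF k_mod E(2) \<iota>(1)] .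
  have k0: "\<zero>\<^bsub>?k\<^esub> \<in> carrier ?k" unfolding k by simp
  have inj0: "u = \<zero>\<^bsub>?k\<^esub>" if "u \<in> carrier ?k" "\<iota> u = \<zero>\<^bsub>E\<^esub>" for u
    using inj_onD[OF \<iota>(2) _ that(1) k0] that(2) \<iota>0 by simp
  have coset: "\<exists>r\<in>carrier R. u = \<mm> +>\<^bsub>R\<^esub> r" if "u \<in> carrier ?k" for u
    using that unfolding k FactRing_def A_RCOSETS_def' by auto
  have rc: "\<mm> +>\<^bsub>R\<^esub> r \<in> carrier (R Quot \<mm>)" if "r \<in> carrier R" for r
    using ring_hom_closed[OF m.rcos_ring_hom that] .
  have smult: "r \<odot>\<^bsub>?k\<^esub> u = (\<mm> +>\<^bsub>R\<^esub> r) \<otimes>\<^bsub>R Quot \<mm>\<^esub> u" for r u by (rule k)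
  show ?thesis
  proof (intro socle_injective.intro socle_injective_axioms.intro E R local)
    show "\<iota> ?one \<in> carrier E" using module_homD(1)[OF \<iota>(1) one_k] .
    show "\<iota> ?one \<noteq> \<zero>\<^bsub>E\<^esub>" using inj0[OF one_k] F.one_not_zero unfolding one k by auto
    show "r \<odot>\<^bsub>E\<^esub> \<iota> ?one = \<zero>\<^bsub>E\<^esub>" if r: "r \<in> \<mm>" for r
    proof -
      have "\<mm> +>\<^bsub>R\<^esub> r = \<zero>\<^bsub>R Quot \<mm>\<^esub>"
        using R.a_rcos_zero[OF m.ideal_axioms r] by (simp add: FactRing_def)
      hence "r \<odot>\<^bsub>?k\<^esub> ?one = \<zero>\<^bsub>?k\<^esub>" unfolding smult one k(4) by simp
      thus ?thesis using module_homD(3)[OF \<iota>(1) m.Icarr[OF r] one_k] \<iota>0 by simp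
    qed
    fix V assume V: "submodule V R E" "V \<noteq> {\<zero>\<^bsub>E\<^esub>}"
    have "\<zero>\<^bsub>E\<^esub> \<in> V \<inter> \<iota> ` carrier ?k" using E.submodule_zero[OF V(1)] \<iota>0 k0 by (metis IntI image_eqI)
    then obtain u where u: "u \<in> carrier ?k" "\<iota> u \<in> V" "\<iota> u \<noteq> \<zero>\<^bsub>E\<^esub>" using ess[OF V] by blast
    have "u \<in> Units (R Quot \<mm>)" using u \<iota>0 by (auto simp: F.field_Units k)
    then obtain w where w: "w \<in> carrier ?k" "w \<otimes>\<^bsub>R Quot \<mm>\<^esub> u = ?one" unfolding Units_def one k by blast
    then obtain r where r: "r \<in> carrier R" "w = \<mm> +>\<^bsub>R\<^esub> r" using coset by blast
    have "\<iota> ?one = r \<odot>\<^bsub>E\<^esub> \<iota> u" using module_homD(3)[OF \<iota>(1) r(1) u(1)] w(2) r(2) smult by simp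
    thus "\<iota> ?one \<in> V" using E.submoduleE(4)[OF V(1) r(1) u(2)] by simp
  qed
qed

theorem mainTheorem4:
  fixes R :: "('a, 'r) ring_scheme" and \<mm> :: "'a set"
    and E :: "('a, 'e, 'm) module_scheme" and \<iota> :: "'a set \<Rightarrow> 'e"
  assumes "noetherian_ring R" and "local_ring R \<mm>"
    and "injective_hull R (quotient_module R \<mm>) E \<iota>"
  shows "simple_divisible R E \<longleftrightarrow>
    field (tensor_product R (completion R \<mm>) (to_completion R \<mm>)
                            (total_quotient_ring R) (to_total_quotient_ring R))"
  by (rule socle_injective.simple_divisible_iff_field[OF socle_injective_hull[OF assms]])

end
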